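(* Let $\Lambda$ be a strongly connected finite $k$-graph with $\{0,1\}$ vertex matrices $A_1,\dots, A_k$, such that the product $A := A_1 \cdots A_k$ is also a $\{0,1\}$ matrix. Let $X = \Psi(\Lambda^\infty)\subseteq[0,1]$ and let $\mu$ be the measure on $X$ given by $\mu(E) = M(\Psi^{-1}(E))$, where $M$ is the Perron-Frobenius measure on $\Lambda^\infty$. Then $\mu = \frac{1}{H^s(X)}H^s$, where $H^s$ is the Hausdorff measure on $X$ associated to its Hausdorff dimension $s$. Moreover $$N^{k s} =\rho(A), \qquad s = \frac1k\, \frac{\ln \rho(A)}{\ln N},$$ where $N= |\Lambda^0|$ and $\rho(A)$ denotes the Perron-Frobenius eigenvalue of $A$.
   Context: Notation: $\mathbb N=\{0,1,2,\dots\}$, $k\ge 1$, and $e_1,\dots,e_k$ are the generators of $\mathbb N^k$. $k$-graphs: A $k$-graph is a countable category $\Lambda$ with a functor $d:\Lambda\to\mathbb N^k$ satisfying the factorization property: whenever $d(\lambda)=m+n$ there are unique $\mu,\nu\in\Lambda$ with $\lambda=\mu\nu$, $d(\mu)=m$, $d(\nu)=n$. $\Lambda^0$ is the set of identity morphisms (vertices), $r,s:\Lambda\to\Lambda^0$ are the range and source maps, $\Lambda^n=\{\lambda: d(\lambda)=n\}$, $v\Lambda w=\{\lambda: r(\lambda)=v, s(\lambda)=w\}$. $\Lambda$ is finite if every $\Lambda^n$ is finite; strongly connected if $v\Lambda w\neq\emptyset$ for all $v,w\in\Lambda^0$. The vertex matrices are $A_i\in M_{\Lambda^0}(\mathbb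 N)$, $A_i(v,w)=|v\Lambda^{e_i}w|$. Infinite paths: $\Omega_k=\{(p,q)\in\mathbb N^k\times\mathbb N^k: p\le q\}$ is the $k$-graph with $r(p,q)=p$, $s(p,q)=q$, $(p,q)(q,m)=(p,m)$, $d(p,q)=q-p$. An infinite path is a $k$-graph morphism (degree-preserving functor) $x:\Omega_k\to\Lambda$; $\Lambda^\infty$ is the set of them, with topology having as basis the cylinder sets $Z(\lambda)=\{x\in\Lambda^\infty: x(0,d(\lambda))=\lambda\}$. Perron-Frobenius data: $x^\Lambda$ denotes the unique vector with positive entries and $\ell^1$-norm one such that $A_ix^\Lambda=\rho(A_i)x^\Lambda$ for all $i$, where $\rho(A_i)$ is the spectral radius; it is also the unique positive unimodular ($\ell^1$-norm one) eigenvector of $A=A_1\cdots A_k$, with eigenvalue $\rho(A)$. Put $\rho(\Lambda)=(\rho(A_1),\dots,\rho(A_k))$ and $\rho(\Lambda)^n=\prod_i\rho(A_i)^{n_i}$. $M$ is the Borel probability measure on $\Lambda^\infty$ with $M(Z(\lambda))=\rho(\Lambda)^{-d(\lambda)}x^\Lambda_{s(\lambda)}$ for all $\lambda\in\Lambda$. The map $\Psi$: Label $\Lambda^0$ by the integers $0,1,\dots,N-1$, where $N=|\Lambda^0|$, and identify vertices with labels. Each $x\in\Lambda^\infty$ has a unique decomposition $x=f^x_{11}f^x_{21}\cdots f^x_{k1}f^x_{12}\cdots f^x_{k2}f^x_{13}\cdots$ with $d(f^x_{ij})=e_i$ for all $1\le i\le k$, $j\ge1$. Let $v^x_{ij}=r(f^x_{ij})$,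 so that $A_i(v^x_{ij},v^x_{(i+1)j})=1$ for $1\le i\le k-1$ and $A_k(v^x_{kj},v^x_{1(j+1)})=1$ for all $j$. Then $\Psi:\Lambda^\infty\to[0,1]$ is given in $N$-adic expansion by $\Psi(x)=0.v^x_{11}v^x_{21}\ldots v^x_{k1}v^x_{12}\ldots=\sum_{1\le i\le k,\,j\ge1}\frac{v^x_{ij}}{N^{i+k(j-1)}}$. Hausdorff measure and dimension: For $E\subset\mathbb R^n$, $H^s_\delta(E)=\inf\sum_j\mathrm{diam}(A_j)^s$ over countable covers of $E$ by sets $A_j$ of diameter $<\delta$, and $H^s(E)=\lim_{\delta\to0^+}H^s_\delta(E)$. $E$ has Hausdorff dimension $s_0$ if $E$ is $H^{s_0}$-measurable and $0<H^{s_0}(E)<\infty$; the restriction of $H^{s_0}$ to measurable subsets of $E$ is the Hausdorff measure on $E$.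
   Formalization: The uniqueness of x^Λ as positive unimodular eigenvector of A for ρ(A), which the paper asserts as a standing fact, is taken as a hypothesis: it can fail for strongly connected finite k-graphs (A reducible), and then μ = H^s/H^s(X) can be false. *)

theory Defs
  imports
    "HOL-Probability.Probability"
    "Jordan_Normal_Form.Spectral_Radius"
begin

section \<open>Higher-rank graphs\<close>

text \<open>
  The monoid \<open>\<nat>\<^sup>k\<close>: functions on the naturals that vanish outside \<open>{1..k}\<close>, with the
  pointwise order.
\<close>

definition Nk :: "nat \<Rightarrow> (nat \<Rightarrow> nat) set" where
  "Nk k = {n. \<forall>i. i \<notin> {1..k} \<longrightarrow> n i = 0}"

definition unit_deg :: "nat \<Rightarrow> nat \<Rightarrow> nat" where
  "unit_deg i = (\<lambda>j. if j = i then 1 else 0)"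

text \<open>
  Small categories are given by their morphisms only; objects are identified with identity
  morphisms, so \<open>rng\<close> and \<open>src\<close> are morphism-valued.  \<open>cmp \<Lambda> \<mu> \<nu>\<close> is the composite
  \<open>\<mu>\<nu>\<close>, which is meaningful when \<open>src \<Lambda> \<mu> = rng \<Lambda> \<nu>\<close>.
\<close>

record 'a graded_cat =
  Mor :: "'a set"
  rng :: "'a \<Rightarrow> 'a"
  src :: "'a \<Rightarrow> 'a"
  cmp :: "'a \<Rightarrow> 'a \<Rightarrow> 'a"
  deg :: "'a \<Rightarrow> nat \<Rightarrow> nat"

definition is_category :: "('a, 'b) graded_cat_scheme \<Rightarrow> bool" where
  "is_category \<Lambda> \<longleftrightarrow>
     (\<forall>\<eta>\<in>Mor \<Lambda>. rng \<Lambda> \<eta> \<in> Mor \<Lambda> \<and> src \<Lambda> \<eta> \<in> Mor \<Lambda> \<and>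
        rng \<Lambda> (rng \<Lambda> \<eta>) = rng \<Lambda> \<eta> \<and> src \<Lambda> (rng \<Lambda> \<eta>) = rng \<Lambda> \<eta> \<and>
        rng \<Lambda> (src \<Lambda> \<eta>) = src \<Lambda> \<eta> \<and> src \<Lambda> (src \<Lambda> \<eta>) = src \<Lambda> \<eta> \<and>
        cmp \<Lambda> (rng \<Lambda> \<eta>) \<eta> = \<eta> \<and> cmp \<Lambda> \<eta> (src \<Lambda> \<eta>) = \<eta>) \<and>
     (\<forall>\<mu>\<in>Mor \<Lambda>. \<forall>\<nu>\<in>Mor \<Lambda>. src \<Lambda> \<mu> = rng \<Lambda> \<nu> \<longrightarrow>
        cmp \<Lambda> \<mu> \<nu> \<in> Mor \<Lambda> \<and>
        rng \<Lambda> (cmp \<Lambda> \<mu> \<nu>) = rng \<Lambda> \<mu> \<and> src \<Lambda> (cmp \<Lambda> \<mu> \<nu>) = src \<Lambda> \<nu>) \<and>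
     (\<forall>\<kappa>\<in>Mor \<Lambda>. \<forall>\<mu>\<in>Mor \<Lambda>. \<forall>\<nu>\<in>Mor \<Lambda>. src \<Lambda> \<kappa> = rng \<Lambda> \<mu> \<longrightarrow> src \<Lambda> \<mu> = rng \<Lambda> \<nu> \<longrightarrow>
        cmp \<Lambda> (cmp \<Lambda> \<kappa> \<mu>) \<nu> = cmp \<Lambda> \<kappa> (cmp \<Lambda> \<mu> \<nu>))"

definition vertices :: "('a, 'b) graded_cat_scheme \<Rightarrow> 'a set" where
  "vertices \<Lambda> = {v \<in> Mor \<Lambda>. rng \<Lambda> v = v \<and> src \<Lambda> v = v}"

definition degree_functor :: "nat \<Rightarrow> ('a, 'b) graded_cat_scheme \<Rightarrow> bool" where
  "degree_functor k \<Lambda> \<longleftrightarrow>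
     (\<forall>\<eta>\<in>Mor \<Lambda>. deg \<Lambda> \<eta> \<in> Nk k) \<and>
     (\<forall>v\<in>vertices \<Lambda>. deg \<Lambda> v = (\<lambda>_. 0)) \<and>
     (\<forall>\<mu>\<in>Mor \<Lambda>. \<forall>\<nu>\<in>Mor \<Lambda>. src \<Lambda> \<mu> = rng \<Lambda> \<nu> \<longrightarrow>
        deg \<Lambda> (cmp \<Lambda> \<mu> \<nu>) = (\<lambda>i. deg \<Lambda> \<mu> i + deg \<Lambda> \<nu> i))"

definition factorization_property :: "nat \<Rightarrow> ('a, 'b) graded_cat_scheme \<Rightarrow> bool" where
  "factorization_property k \<Lambda> \<longleftrightarrow>
     (\<forall>\<eta>\<in>Mor \<Lambda>. \<forall>m\<in>Nk k. \<forall>n\<in>Nk k. deg \<Lambda> \<eta> = (\<lambda>i. m i + n i) \<longrightarrow>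
        (\<exists>!(\<mu>, \<nu>). \<mu> \<in> Mor \<Lambda> \<and> \<nu> \<in> Mor \<Lambda> \<and> src \<Lambda> \<mu> = rng \<Lambda> \<nu> \<and>
           \<eta> = cmp \<Lambda> \<mu> \<nu> \<and> deg \<Lambda> \<mu> = m \<and> deg \<Lambda> \<nu> = n))"

definition k_graph :: "nat \<Rightarrow> ('a, 'b) graded_cat_scheme \<Rightarrow> bool" where
  "k_graph k \<Lambda> \<longleftrightarrow>
     is_category \<Lambda> \<and> countable (Mor \<Lambda>) \<and> degree_functor k \<Lambda> \<and> factorization_property k \<Lambda>"

definition paths_of_degree :: "('a, 'b) graded_cat_scheme \<Rightarrow> (nat \<Rightarrow> nat) \<Rightarrow> 'a set" where
  "paths_of_degree \<Lambda> n = {\<eta> \<in> Mor \<Lambda>. deg \<Lambda> \<eta> = n}"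

definition hom_set :: "('a, 'b) graded_cat_scheme \<Rightarrow> 'a \<Rightarrow> 'a \<Rightarrow> 'a set" where
  "hom_set \<Lambda> v w = {\<eta> \<in> Mor \<Lambda>. rng \<Lambda> \<eta> = v \<and> src \<Lambda> \<eta> = w}"

definition finite_kgraph :: "nat \<Rightarrow> ('a, 'b) graded_cat_scheme \<Rightarrow> bool" where
  "finite_kgraph k \<Lambda> \<longleftrightarrow> (\<forall>n\<in>Nk k. finite (paths_of_degree \<Lambda> n))"

definition strongly_connected :: "('a, 'b) graded_cat_scheme \<Rightarrow> bool" where
  "strongly_connected \<Lambda> \<longleftrightarrow> (\<forall>v\<in>vertices \<Lambda>. \<forall>w\<in>vertices \<Lambda>. hom_set \<Lambda> v w \<noteq> {})"

section \<open>Infinite paths\<close>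

definition Omega :: "nat \<Rightarrow> ((nat \<Rightarrow> nat) \<times> (nat \<Rightarrow> nat)) graded_cat" where
  "Omega k = \<lparr>
     Mor = {(p, q). p \<in> Nk k \<and> q \<in> Nk k \<and> p \<le> q},
     rng = (\<lambda>(p, q). (p, p)),
     src = (\<lambda>(p, q). (q, q)),
     cmp = (\<lambda>(p, q) (q', m). (p, m)),
     deg = (\<lambda>(p, q) i. q i - p i)\<rparr>"

definition kgraph_morphism ::
  "('a, 'c) graded_cat_scheme \<Rightarrow> ('b, 'd) graded_cat_scheme \<Rightarrow> ('a \<Rightarrow> 'b) \<Rightarrow> bool" where
  "kgraph_morphism \<Gamma> \<Lambda> x \<longleftrightarrow>
     (\<forall>\<eta>\<in>Mor \<Gamma>. x \<eta> \<in> Mor \<Lambda> \<and> x (rng \<Gamma> \<eta>) = rng \<Lambda> (x \<eta>) \<and>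
        x (src \<Gamma> \<eta>) = src \<Lambda> (x \<eta>) \<and> deg \<Lambda> (x \<eta>) = deg \<Gamma> \<eta>) \<and>
     (\<forall>\<mu>\<in>Mor \<Gamma>. \<forall>\<nu>\<in>Mor \<Gamma>. src \<Gamma> \<mu> = rng \<Gamma> \<nu> \<longrightarrow>
        x (cmp \<Gamma> \<mu> \<nu>) = cmp \<Lambda> (x \<mu>) (x \<nu>))"

text \<open>
  Infinite paths are total functions, made \<open>extensional\<close> so that equality of paths is equality
  of functions.
\<close>

definition infinite_paths ::
  "nat \<Rightarrow> ('a, 'b) graded_cat_scheme \<Rightarrow> ((nat \<Rightarrow> nat) \<times> (nat \<Rightarrow> nat) \<Rightarrow> 'a) set" where
  "infinite_paths k \<Lambda> = {x \<in> extensional (Mor (Omega k)). kgraph_morphism (Omega k) \<Lambda> x}"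

definition cylinder ::
  "nat \<Rightarrow> ('a, 'b) graded_cat_scheme \<Rightarrow> 'a \<Rightarrow> ((nat \<Rightarrow> nat) \<times> (nat \<Rightarrow> nat) \<Rightarrow> 'a) set" where
  "cylinder k \<Lambda> \<eta> = {x \<in> infinite_paths k \<Lambda>. x (\<lambda>_. 0, deg \<Lambda> \<eta>) = \<eta>}"

definition path_topology ::
  "nat \<Rightarrow> ('a, 'b) graded_cat_scheme \<Rightarrow> ((nat \<Rightarrow> nat) \<times> (nat \<Rightarrow> nat) \<Rightarrow> 'a) topology" where
  "path_topology k \<Lambda> = topology_generated_by (cylinder k \<Lambda> ` Mor \<Lambda>)"

section \<open>Perron-Frobenius data\<close>

text \<open>
  A labelling \<open>l\<close> of the vertices by \<open>{0..<N}\<close> identifies the vertex set with the index set of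
  the matrices and vectors below.
\<close>

definition vertex_labelling :: "('a, 'b) graded_cat_scheme \<Rightarrow> ('a \<Rightarrow> nat) \<Rightarrow> bool" where
  "vertex_labelling \<Lambda> l \<longleftrightarrow> bij_betw l (vertices \<Lambda>) {0..<card (vertices \<Lambda>)}"

definition vertex_of :: "('a, 'b) graded_cat_scheme \<Rightarrow> ('a \<Rightarrow> nat) \<Rightarrow> nat \<Rightarrow> 'a" where
  "vertex_of \<Lambda> l = inv_into (vertices \<Lambda>) l"

definition vertex_matrix ::
  "('a, 'b) graded_cat_scheme \<Rightarrow> ('a \<Rightarrow> nat) \<Rightarrow> nat \<Rightarrow> nat mat" where
  "vertex_matrix \<Lambda> l i = mat (card (vertices \<Lambda>)) (card (vertices \<Lambda>))
     (\<lambda>(a, b). card (paths_of_degree \<Lambda> (unit_deg i)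
                      \<inter> hom_set \<Lambda> (vertex_of \<Lambda> l a) (vertex_of \<Lambda> l b)))"

definition product_matrix ::
  "nat \<Rightarrow> ('a, 'b) graded_cat_scheme \<Rightarrow> ('a \<Rightarrow> nat) \<Rightarrow> nat mat" where
  "product_matrix k \<Lambda> l =
     foldr (*) (map (vertex_matrix \<Lambda> l) [1..<Suc k]) (1\<^sub>m (card (vertices \<Lambda>)))"

definition zero_one_matrix :: "nat mat \<Rightarrow> bool" where
  "zero_one_matrix B \<longleftrightarrow> elements_mat B \<subseteq> {0, 1}"

definition rho :: "nat mat \<Rightarrow> real" where
  "rho B = spectral_radius (map_mat of_nat B)"

definition positive_unimodular_eigenvector :: "nat mat \<Rightarrow> real \<Rightarrow> real vec \<Rightarrow> bool" where
  "positive_unimodular_eigenvector B c x \<longleftrightarrow>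
     x \<in> carrier_vec (dim_row B) \<and> (\<forall>a<dim_row B. x $ a > 0) \<and> (\<Sum>a<dim_row B. \<bar>x $ a\<bar>) = 1 \<and>
     map_mat of_nat B *\<^sub>v x = c \<cdot>\<^sub>v x"

definition pf_vector :: "nat \<Rightarrow> ('a, 'b) graded_cat_scheme \<Rightarrow> ('a \<Rightarrow> nat) \<Rightarrow> real vec" where
  "pf_vector k \<Lambda> l = (THE x. \<forall>i\<in>{1..k}.
     positive_unimodular_eigenvector (vertex_matrix \<Lambda> l i) (rho (vertex_matrix \<Lambda> l i)) x)"

text \<open>
  \<open>pf_vector\<close> is always an eigenvector of the product matrix \<open>A\<close>, but strong connectivity of
  \<open>\<Lambda>\<close> alone does not make it the only positive unimodular one: \<open>A\<close> may be reducible, e.g. for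
  \<open>k = 2\<close> with \<open>A\<^sub>1 = A\<^sub>2\<close> the swap of two vertices.  Hence results that rely on this
  uniqueness have to assume it.
\<close>

definition rho_power ::
  "nat \<Rightarrow> ('a, 'b) graded_cat_scheme \<Rightarrow> ('a \<Rightarrow> nat) \<Rightarrow> (nat \<Rightarrow> nat) \<Rightarrow> real" where
  "rho_power k \<Lambda> l n = (\<Prod>i=1..k. rho (vertex_matrix \<Lambda> l i) ^ n i)"

definition perron_frobenius_measure ::
  "nat \<Rightarrow> ('a, 'b) graded_cat_scheme \<Rightarrow> ('a \<Rightarrow> nat) \<Rightarrow>
   ((nat \<Rightarrow> nat) \<times> (nat \<Rightarrow> nat) \<Rightarrow> 'a) measure \<Rightarrow> bool" where
  "perron_frobenius_measure k \<Lambda> l M \<longleftrightarrow>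
     space M = infinite_paths k \<Lambda> \<and>
     sets M = sigma_sets (infinite_paths k \<Lambda>) {U. openin (path_topology k \<Lambda>) U} \<and>
     prob_space M \<and>
     (\<forall>\<eta>\<in>Mor \<Lambda>. measure M (cylinder k \<Lambda> \<eta>) =
        inverse (rho_power k \<Lambda> l (deg \<Lambda> \<eta>)) * pf_vector k \<Lambda> l $ l (src \<Lambda> \<eta>))"

section \<open>The map into the unit interval\<close>

text \<open>
  \<open>path_corner k i j\<close> is the total degree \<open>(j - 1)(e\<^sub>1 + \<dots> + e\<^sub>k) + e\<^sub>1 + \<dots> + e\<^bsub>i-1\<^esub>\<close> of the
  factors preceding \<open>f\<^bsub>ij\<^esub>\<close> in \<open>x = f\<^bsub>11\<^esub> \<dots> f\<^bsub>k1\<^esub> f\<^bsub>12\<^esub> \<dots> f\<^bsub>k2\<^esub> f\<^bsub>13\<^esub> \<dots>\<close>.  By unique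
  factorization, \<open>f\<^bsub>ij\<^esub>\<close> is the segment of \<open>x\<close> of degree \<open>e\<^sub>i\<close> starting there.
\<close>

definition path_corner :: "nat \<Rightarrow> nat \<Rightarrow> nat \<Rightarrow> nat \<Rightarrow> nat" where
  "path_corner k i j = (\<lambda>m. if m \<in> {1..k} then (j - 1) + (if m < i then 1 else 0) else 0)"

definition path_factor ::
  "nat \<Rightarrow> ((nat \<Rightarrow> nat) \<times> (nat \<Rightarrow> nat) \<Rightarrow> 'a) \<Rightarrow> nat \<Rightarrow> nat \<Rightarrow> 'a" where
  "path_factor k x i j =
     x (path_corner k i j, \<lambda>m. path_corner k i j m + unit_deg i m)"

definition Psi ::
  "nat \<Rightarrow> ('a, 'b) graded_cat_scheme \<Rightarrow> ('a \<Rightarrow> nat) \<Rightarrow>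
   ((nat \<Rightarrow> nat) \<times> (nat \<Rightarrow> nat) \<Rightarrow> 'a) \<Rightarrow> real" where
  "Psi k \<Lambda> l x = (\<Sum>\<^sub>\<infinity>(i, j)\<in>{1..k} \<times> {1..}.
     real (l (rng \<Lambda> (path_factor k x i j))) / real (card (vertices \<Lambda>)) ^ (i + k * (j - 1)))"

section \<open>Hausdorff measure and dimension\<close>

text \<open>
  \<open>diam(A)\<^sup>s\<close> with the usual conventions that make \<open>H\<^sup>0\<close> the counting measure: the empty set
  contributes nothing and \<open>0\<^sup>0 = 1\<close> (whereas \<open>0 powr 0 = 0\<close>).
\<close>

definition diam_power :: "real \<Rightarrow> 'a::metric_space set \<Rightarrow> ennreal" where
  "diam_power s A =
     (if A = {} then 0 else if s = 0 then 1 else ennreal (diameter A powr s))"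

text \<open>
  Boundedness is required explicitly because \<open>diameter\<close> is unspecified on unbounded sets.
\<close>

definition hausdorff_pre :: "real \<Rightarrow> real \<Rightarrow> 'a::metric_space set \<Rightarrow> ennreal" where
  "hausdorff_pre \<delta> s E =
     (INF A\<in>{A :: nat \<Rightarrow> 'a set. E \<subseteq> (\<Union>j. A j) \<and> (\<forall>j. bounded (A j) \<and> diameter (A j) < \<delta>)}.
        \<Sum>j. diam_power s (A j))"

definition hausdorff_outer :: "real \<Rightarrow> 'a::metric_space set \<Rightarrow> ennreal" where
  "hausdorff_outer s E = Lim (at_right 0) (\<lambda>\<delta>. hausdorff_pre \<delta> s E)"

text \<open>
  The sets of \<open>hausdorff_measure s\<close> are the Caratheodory-measurable sets of the outer measure.
\<close>

definition hausdorff_measure :: "real \<Rightarrow> 'a::metric_space measure" where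
  "hausdorff_measure s =
     measure_of UNIV (lambda_system UNIV (Pow UNIV) (hausdorff_outer s)) (hausdorff_outer s)"

definition has_hausdorff_dimension :: "'a::metric_space set \<Rightarrow> real \<Rightarrow> bool" where
  "has_hausdorff_dimension E s \<longleftrightarrow>
     0 \<le> s \<and> E \<in> sets (hausdorff_measure s) \<and>
     0 < emeasure (hausdorff_measure s) E \<and> emeasure (hausdorff_measure s) E < \<infinity>"

definition hausdorff_dimension :: "'a::metric_space set \<Rightarrow> real" where
  "hausdorff_dimension E = (THE s. has_hausdorff_dimension E s)"

end

(*
  Write R for rho(A), N for the number of vertices and choose s with N^(ks) = R. The values M(Z(v))
  on vertices form a positive common eigenvector of the vertex matrices (strong connectivity), so
  M(Z(lambda)) = R^(-n) M(Z(s(lambda))) for lambda of degree (n,...,n). The image of Z(lambda) lies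
  in an N-adic interval of length N^(-kn), and at most 4N images meet a set of diameter at most
  N^(-kn). Hence the H^s-measures h(v) of the images of the Z(v) are finite (cover by cylinders) and
  positive (mass distribution). The image of Z(lambda) is a copy of the image of Z(s(lambda)) scaled
  by N^(-kn), and points with two expansions form an H^s-null set: for s > 0 they are rational, and
  for s = 0 there are none, since an eventually vanishing digit sequence would give a vertex that no
  path leaves. So A h = R h, and by the uniqueness of the eigenvector H^s is proportional to the image
  of M on all images of cylinders, hence on relatively open sets, hence on Borel sets.
*)

theory Submission
  imports Defs
begin

section \<open>Hausdorff measure\<close>

text \<open>\<open>pf_vector\<close> is a definite description, so its properties are extracted from
  \<open>M\<close>: cylinders of one degree partition the path space, additivity of \<open>M\<close>
  over them is the eigenvector equation, and total mass one rules out a zero spectral radius. A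
  positive eigenvector then identifies rho(A) with the product of the rho(A_i). Levels are taken at
  the diagonal degrees (n,...,n): there a segment corresponds to whole blocks of k digits, and the
  uniqueness hypothesis concerns A alone. The 0-1 entries of each A_i make an edge recoverable from
  its end vertices, so a path of degree (n,...,n) is coded by kn + 1 digits. The first kn of them
  form an integer, for which a set of diameter N^(-kn) leaves 4 values; the last digit, the source,
  accounts for the factor N in 4N. Countability of the points with two expansions does not help for
  s = 0, where H^0 counts points; this forces the separate argument for R = 1. For N = 1 all
  vertices and digits coincide, X is one point and R = 1; since \<open>ln 1 = 0\<close>, division by
  zero gives the correct value s = 0.\<close>

lemma diam_power_empty [simp]: "diam_power s {} = 0"
  by (simp add: diam_power_def)

lemma hausdorff_pre_antimono:
  "\<delta> \<le> \<epsilon> \<Longrightarrow> hausdorff_pre \<epsilon> s E \<le> hausdorff_pre \<delta> s E"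
  unfolding hausdorff_pre_def by (rule INF_superset_mono) (auto intro: less_le_trans)

lemma hausdorff_pre_mono:
  "E \<subseteq> F \<Longrightarrow> hausdorff_pre \<delta> s E \<le> hausdorff_pre \<delta> s F"
  unfolding hausdorff_pre_def by (rule INF_superset_mono) force+

lemma hausdorff_pre_le:
  assumes "E \<subseteq> (\<Union>j. A j)" "\<And>j. bounded (A j)" "\<And>j. diameter (A j) < \<delta>"
  shows "hausdorff_pre \<delta> s E \<le> (\<Sum>j. diam_power s (A j))"
  unfolding hausdorff_pre_def by (rule INF_lower) (use assms in auto)

text \<open>As c is positive and finite, dividing by it turns an estimate for every cover into an
  ordinary lower bound of the infimum. All comparisons of covers below that involve a constant go
  through this form.\<close>

lemma hausdorff_pre_greatest:
  assumes "c > 0"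
    and "\<And>A. E \<subseteq> (\<Union>j. A j) \<Longrightarrow> (\<And>j. bounded (A j)) \<Longrightarrow> (\<And>j. diameter (A j) < \<delta>) \<Longrightarrow>
      x \<le> ennreal c * (\<Sum>j. diam_power s (A j))"
  shows "x \<le> ennreal c * hausdorff_pre \<delta> s E"
proof -
  have cancel: "ennreal c * (ennreal (1 / c) * y) = y" "ennreal (1 / c) * (ennreal c * y) = y" for y
    using assms(1) by (simp_all add: mult.assoc[symmetric] ennreal_mult[symmetric])
  have "ennreal (1 / c) * x \<le> hausdorff_pre \<delta> s E"
    unfolding hausdorff_pre_def
  proof (rule INF_greatest)
    fix A assume "A \<in> {A. E \<subseteq> (\<Union>j::nat. A j) \<and> (\<forall>j. bounded (A j) \<and> diameter (A j) < \<delta>)}"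
    then have "x \<le> ennreal c * (\<Sum>j. diam_power s (A j))" using assms(2) by auto
    then show "ennreal (1 / c) * x \<le> (\<Sum>j. diam_power s (A j))"
      using mult_left_mono[of x _ "ennreal (1 / c)"] cancel(2) by (metis zero_le)
  qed
  then show ?thesis using mult_left_mono[of _ _ "ennreal c"] cancel(1) by (metis zero_le)
qed

text \<open>A finite cover is padded with empty sets, which cost nothing; \<delta> > 0 makes the
  empty set, of diameter 0, admissible.\<close>

lemma hausdorff_pre_le_finite:
  assumes "finite I" "E \<subseteq> (\<Union>i\<in>I. A i)" "\<And>i. i \<in> I \<Longrightarrow> bounded (A i)"
    "\<And>i. i \<in> I \<Longrightarrow> diameter (A i) < \<delta>" "\<delta> > 0"
  shows "hausdorff_pre \<delta> s E \<le> (\<Sum>i\<in>I. diam_power s (A i))"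
proof -
  obtain h where h: "bij_betw h {0..<card I} I"
    using ex_bij_betw_nat_finite[OF assms(1)] by blast
  define B where "B j = (if j < card I then A (h j) else {})" for j
  have hI: "h j \<in> I" if "j < card I" for j
    using h that by (auto simp: bij_betw_def)
  have "E \<subseteq> (\<Union>j. B j)"
  proof
    fix x assume "x \<in> E"
    then obtain i where i: "i \<in> I" "x \<in> A i" using assms(2) by auto
    then have "i \<in> h ` {0..<card I}" using h by (simp add: bij_betw_def)
    then obtain j where "j < card I" "h j = i" by auto
    then show "x \<in> (\<Union>j. B j)" using i by (auto simp: B_def)
  qed
  then have "hausdorff_pre \<delta> s E \<le> (\<Sum>j. diam_power s (B j))"
    by (rule hausdorff_pre_le) (use assms hI in \<open>auto simp: B_def\<close>)
  also have "\<dots> = (\<Sum>j<card I. diam_power s (B j))"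
    by (rule suminf_finite) (auto simp: B_def)
  also have "\<dots> = (\<Sum>j\<in>{0..<card I}. diam_power s (A (h j)))"
    by (auto simp: B_def intro!: sum.cong)
  also have "\<dots> = (\<Sum>i\<in>I. diam_power s (A i))"
    by (rule sum.reindex_bij_betw[OF h])
  finally show ?thesis .
qed

lemma hausdorff_pre_empty [simp]:
  assumes "\<delta> > 0"
  shows "hausdorff_pre \<delta> s {} = 0"
  using hausdorff_pre_le_finite[of "{}" "{}" "\<lambda>_. {}" \<delta> s] assms by auto

lemma hausdorff_pre_approx:
  assumes "hausdorff_pre \<delta> s E < \<infinity>" "e > 0"
  obtains A where "E \<subseteq> (\<Union>j. A j)" "\<And>j. bounded (A j)" "\<And>j. diameter (A j) < \<delta>"
    "(\<Sum>j. diam_power s (A j)) \<le> hausdorff_pre \<delta> s E + e"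
proof -
  have "hausdorff_pre \<delta> s E < hausdorff_pre \<delta> s E + e"
    using assms by (simp add: ennreal_add_left_cancel_less[of _ 0, simplified] less_top)
  then obtain A where "A \<in> {A. E \<subseteq> (\<Union>j. A j) \<and> (\<forall>j. bounded (A j) \<and> diameter (A j) < \<delta>)}"
    "(\<Sum>j. diam_power s (A j)) < hausdorff_pre \<delta> s E + e"
    unfolding hausdorff_pre_def INF_less_iff by blast
  then show thesis by (intro that[of A]) auto
qed

text \<open>Near-optimal covers of the \<open>E i\<close>, with errors e/2^(i+1), are merged into a
  single sequence by the pairing function.\<close>

lemma hausdorff_pre_subadditive:
  fixes E :: "nat \<Rightarrow> 'a::metric_space set"
  shows "hausdorff_pre \<delta> s (\<Union>i. E i) \<le> (\<Sum>i. hausdorff_pre \<delta> s (E i))"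
proof (cases "(\<Sum>i. hausdorff_pre \<delta> s (E i)) = \<infinity>")
  case False
  have fin: "hausdorff_pre \<delta> s (E i) < \<infinity>" for i
  proof -
    have "hausdorff_pre \<delta> s (E i) \<le> (\<Sum>i. hausdorff_pre \<delta> s (E i))"
      using sum_le_suminf[of "\<lambda>i. hausdorff_pre \<delta> s (E i)" "{i}"] by simp
    with False show ?thesis by (simp add: top.not_eq_extremum order_le_less_trans)
  qed
  show ?thesis
  proof (rule ennreal_le_epsilon)
    fix e :: real assume e: "0 < e"
    have "\<exists>A. E i \<subseteq> (\<Union>j. A j) \<and> (\<forall>j. bounded (A j) \<and> diameter (A j) < \<delta>) \<and>
      (\<Sum>j. diam_power s (A j)) \<le> hausdorff_pre \<delta> s (E i) + ennreal (e * (1/2)^Suc i)" for i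
      by (rule hausdorff_pre_approx[OF fin, of "ennreal (e * (1/2)^Suc i)" i]) (use e in auto)
    then obtain A where A: "\<And>i. E i \<subseteq> (\<Union>j. A i j)" "\<And>i j. bounded (A i j)"
      "\<And>i j. diameter (A i j) < \<delta>"
      "\<And>i. (\<Sum>j. diam_power s (A i j)) \<le> hausdorff_pre \<delta> s (E i) + ennreal (e * (1/2)^Suc i)"
      by metis
    define B where "B n = (case prod_decode n of (i, j) \<Rightarrow> A i j)" for n
    have "hausdorff_pre \<delta> s (\<Union>i. E i) \<le> (\<Sum>n. diam_power s (B n))"
    proof (rule hausdorff_pre_le)
      show "(\<Union>i. E i) \<subseteq> (\<Union>n. B n)"
      proof
        fix x assume "x \<in> (\<Union>i. E i)"
        then obtain i j where "x \<in> A i j" using A(1) by blast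
        then have "x \<in> B (prod_encode (i, j))" by (simp add: B_def)
        then show "x \<in> (\<Union>n. B n)" by blast
      qed
    qed (use A in \<open>auto simp: B_def split: prod.split\<close>)
    also have "\<dots> = (\<Sum>i. \<Sum>j. diam_power s (A i j))"
      using suminf_ennreal_2dimen[of "\<lambda>i. \<Sum>j. diam_power s (A i j)" "\<lambda>(i,j). diam_power s (A i j)"]
      by (simp add: B_def o_def prod.case_distrib case_prod_beta')
    also have "\<dots> \<le> (\<Sum>i. hausdorff_pre \<delta> s (E i) + ennreal (e * (1/2)^Suc i))"
      by (intro suminf_le A) auto
    also have "\<dots> = (\<Sum>i. hausdorff_pre \<delta> s (E i)) + (\<Sum>i. ennreal (e * (1/2)^Suc i))"
      by (rule suminf_add[symmetric]) auto
    also have "(\<Sum>i. ennreal (e * (1/2)^Suc i)) = ennreal (\<Sum>i. e * (1/2)^Suc i)"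
      by (rule suminf_ennreal2) (use e in \<open>auto intro!: summable_mult\<close>)
    also have "(\<Sum>i. e * (1/2)^Suc i) = e"
      using sums_mult[OF power_half_series, of e] by (simp add: sums_iff)
    finally show "hausdorff_pre \<delta> s (\<Union>i. E i) \<le> (\<Sum>i. hausdorff_pre \<delta> s (E i)) + ennreal e" .
  qed
qed simp

section \<open>The Hausdorff outer measure and its Caratheodory measure\<close>

text \<open>A smaller \<delta> admits fewer covers, so the limit is one of a monotone family and
  exists. In the form of a supremum it needs no further limit arguments.\<close>

lemma hausdorff_outer_eq_SUP:
  "hausdorff_outer s E = (SUP \<delta>\<in>{0<..}. hausdorff_pre \<delta> s E)"
proof -
  have "((\<lambda>\<delta>. hausdorff_pre \<delta> s E) \<longlongrightarrow> (SUP \<delta>\<in>{0<..}. hausdorff_pre \<delta> s E)) (at_right 0)"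
  proof (rule order_tendstoI)
    fix a assume "a < (SUP \<delta>\<in>{0<..}. hausdorff_pre \<delta> s E)"
    then obtain d where d: "d > 0" "a < hausdorff_pre d s E"
      by (auto simp: less_SUP_iff)
    have "\<forall>\<^sub>F x in at_right 0. x \<in> {0<..<d}"
      using d eventually_at_right_real by blast
    then show "\<forall>\<^sub>F x in at_right 0. a < hausdorff_pre x s E"
      by eventually_elim (use d in \<open>auto intro!: less_le_trans[OF d(2)] hausdorff_pre_antimono\<close>)
  next
    fix a assume a: "(SUP \<delta>\<in>{0<..}. hausdorff_pre \<delta> s E) < a"
    show "\<forall>\<^sub>F x in at_right 0. hausdorff_pre x s E < a"
      using eventually_at_right_less[of "0::real"]
      by eventually_elim (auto intro!: order_le_less_trans[OF _ a] SUP_upper)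
  qed
  then show ?thesis unfolding hausdorff_outer_def by (intro tendsto_Lim) auto
qed

lemma hausdorff_pre_le_outer: "\<delta> > 0 \<Longrightarrow> hausdorff_pre \<delta> s E \<le> hausdorff_outer s E"
  unfolding hausdorff_outer_eq_SUP by (rule SUP_upper) auto

lemma hausdorff_outer_least:
  "(\<And>\<delta>. \<delta> > 0 \<Longrightarrow> hausdorff_pre \<delta> s E \<le> c) \<Longrightarrow> hausdorff_outer s E \<le> c"
  unfolding hausdorff_outer_eq_SUP by (rule SUP_least) auto

lemma hausdorff_outer_mono: "E \<subseteq> F \<Longrightarrow> hausdorff_outer s E \<le> hausdorff_outer s F"
  by (rule hausdorff_outer_least) (blast intro: order_trans hausdorff_pre_mono hausdorff_pre_le_outer)

lemma hausdorff_outer_empty [simp]: "hausdorff_outer s {} = 0"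
  using hausdorff_outer_least[of s "{}" 0] by simp

lemma hausdorff_outer_subadditive:
  "hausdorff_outer s (\<Union>i. E i) \<le> (\<Sum>i::nat. hausdorff_outer s (E i))"
proof (rule hausdorff_outer_least)
  fix \<delta> :: real assume d: "\<delta> > 0"
  have "hausdorff_pre \<delta> s (\<Union>i. E i) \<le> (\<Sum>i. hausdorff_pre \<delta> s (E i))"
    by (rule hausdorff_pre_subadditive)
  also have "\<dots> \<le> (\<Sum>i. hausdorff_outer s (E i))"
    by (intro suminf_le hausdorff_pre_le_outer d) auto
  finally show "hausdorff_pre \<delta> s (\<Union>i. E i) \<le> (\<Sum>i. hausdorff_outer s (E i))" .
qed

lemma hausdorff_outer_measure_space: "outer_measure_space (Pow UNIV) (hausdorff_outer s)"
  unfolding outer_measure_space_def positive_def increasing_def countably_subadditive_def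
  by (auto intro: hausdorff_outer_mono hausdorff_outer_subadditive)

lemma hausdorff_outer_Un: "hausdorff_outer s (A \<union> B) \<le> hausdorff_outer s A + hausdorff_outer s B"
proof -
  have "hausdorff_outer s (\<Union>i::nat. if i = 0 then A else if i = 1 then B else {})
      \<le> (\<Sum>i::nat. hausdorff_outer s (if i = 0 then A else if i = 1 then B else {}))"
    by (rule hausdorff_outer_subadditive)
  also have "\<dots> = (\<Sum>i\<in>{0,1}. hausdorff_outer s (if i = 0 then A else if i = (1::nat) then B else {}))"
    by (rule suminf_finite) auto
  also have "\<dots> = hausdorff_outer s A + hausdorff_outer s B" by simp
  finally show ?thesis
    by (rule order_trans[rotated]) (auto intro!: hausdorff_outer_mono split: if_splits)
qed

lemma hausdorff_measure_space:
  "measure_space UNIV (lambda_system UNIV (Pow UNIV) (hausdorff_outer s)) (hausdorff_outer s)"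
  by (rule sigma_algebra.caratheodory_lemma[OF sigma_algebra_Pow hausdorff_outer_measure_space])

lemma space_hausdorff_measure [simp]: "space (hausdorff_measure s) = UNIV"
  unfolding hausdorff_measure_def by (rule space_measure_of) auto

lemma sets_hausdorff_measure:
  "sets (hausdorff_measure s) = lambda_system UNIV (Pow UNIV) (hausdorff_outer s)"
  unfolding hausdorff_measure_def
  using hausdorff_measure_space[of s] unfolding measure_space_def
  by (intro sigma_algebra.sets_measure_of_eq) auto

lemma emeasure_hausdorff_measure:
  assumes "E \<in> sets (hausdorff_measure s)"
  shows "emeasure (hausdorff_measure s) E = hausdorff_outer s E"
  unfolding hausdorff_measure_def
  by (rule emeasure_measure_of_sigma)
    (use assms hausdorff_measure_space[of s] in \<open>auto simp: measure_space_def sets_hausdorff_measure\<close>)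

text \<open>Subadditivity supplies the other half of the Caratheodory equation, and test sets of
  infinite outer measure satisfy this half trivially.\<close>

lemma hausdorff_measurableI:
  assumes "\<And>E. hausdorff_outer s E < \<infinity> \<Longrightarrow>
    hausdorff_outer s (E \<inter> F) + hausdorff_outer s (E - F) \<le> hausdorff_outer s E"
  shows "F \<in> sets (hausdorff_measure s)"
  unfolding sets_hausdorff_measure lambda_system_def
proof (intro CollectI conjI ballI)
  fix E :: "'a set"
  have "hausdorff_outer s E \<le> hausdorff_outer s (E \<inter> F) + hausdorff_outer s (E - F)"
    using hausdorff_outer_Un[of s "E \<inter> F" "E - F"] by (simp add: Int_Diff_Un)
  moreover have "hausdorff_outer s (E \<inter> F) + hausdorff_outer s (E - F) \<le> hausdorff_outer s E"
    using assms[of E] by (cases "hausdorff_outer s E = \<infinity>") (auto simp: top.not_eq_extremum)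
  ultimately show "hausdorff_outer s (F \<inter> E) + hausdorff_outer s ((UNIV - F) \<inter> E) = hausdorff_outer s E"
    by (simp add: Int_commute Diff_eq)
qed auto

text \<open>A point covers itself at cost 0^s = 0. For s = 0 the convention 0^0 = 1 makes the cost
  1, hence s > 0.\<close>

lemma hausdorff_outer_countable:
  assumes "countable D" "s > 0"
  shows "hausdorff_outer s D = 0"
proof (cases "D = {}")
  case False
  have "hausdorff_outer s {a} = 0" for a :: 'a
  proof -
    have "hausdorff_outer s {a} \<le> 0"
    proof (rule hausdorff_outer_least)
      fix \<delta> :: real assume "\<delta> > 0"
      then have "hausdorff_pre \<delta> s {a} \<le> (\<Sum>i\<in>{()}. diam_power s {a})"
        by (intro hausdorff_pre_le_finite) auto
      then show "hausdorff_pre \<delta> s {a} \<le> 0" using assms by (simp add: diam_power_def)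
    qed
    then show ?thesis by simp
  qed
  then show ?thesis
    using hausdorff_outer_subadditive[of s "\<lambda>i. {from_nat_into D i}"] False assms
    by (simp add: UNION_singleton_eq_range)
qed simp

section \<open>Lipschitz and affine images\<close>

lemma diam_power_mono:
  assumes "A \<subseteq> B" "bounded B" "s \<ge> 0"
  shows "diam_power s A \<le> diam_power s B"
proof (cases "A = {}")
  case False
  have "diameter A \<le> diameter B" "0 \<le> diameter A" 
    using diameter_subset[OF assms(1,2)] diameter_ge_0[OF bounded_subset[OF assms(2,1)]] by auto
  then show ?thesis using assms False
    by (auto simp: diam_power_def intro!: ennreal_leI powr_mono2)
qed simp

lemma hausdorff_outer_lipschitz_image:
  fixes f :: "'a::metric_space \<Rightarrow> 'b::metric_space"
  assumes f: "\<And>x y. x \<in> E \<Longrightarrow> y \<in> E \<Longrightarrow> dist (f x) (f y) \<le> L * dist x y" and L: "L > 0" and s: "s \<ge> 0"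
  shows "hausdorff_outer s (f ` E) \<le> ennreal (L powr s) * hausdorff_outer s E"
proof (rule hausdorff_outer_least)
  fix \<delta> :: real assume d: "\<delta> > 0"
  have "hausdorff_pre \<delta> s (f ` E) \<le> ennreal (L powr s) * hausdorff_pre (\<delta> / L) s E"
  proof (rule hausdorff_pre_greatest)
    show "L powr s > 0" using L by simp
    fix A :: "nat \<Rightarrow> 'a set"
    assume A: "E \<subseteq> (\<Union>j. A j)" "\<And>j. bounded (A j)" "\<And>j. diameter (A j) < \<delta> / L"
    \<comment> \<open>The Lipschitz bound holds on E only, so each covering set is cut down to E
      before it is mapped.\<close>
    define B where "B j = f ` (E \<inter> A j)" for j
    have dB: "dist u v \<le> L * diameter (A j)" if uv: "u \<in> B j" "v \<in> B j" for u v j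
    proof -
      obtain x y where "x \<in> E" "x \<in> A j" "u = f x" "y \<in> E" "y \<in> A j" "v = f y"
        using uv by (auto simp: B_def)
      then have "dist u v \<le> L * dist x y" using f by auto
      also have "\<dots> \<le> L * diameter (A j)"
        using diameter_bounded_bound[OF A(2)] \<open>x \<in> A j\<close> \<open>y \<in> A j\<close> L by simp
      finally show ?thesis .
    qed
    then have bB: "bounded (B j)" for j
      unfolding bounded_two_points by blast
    have diamB: "diameter (B j) \<le> L * diameter (A j)" for j
      using diameter_ge_0[OF A(2)[of j]] dB L
      by (auto simp: diameter_def[of "B j"] intro!: cSUP_least)
    have "hausdorff_pre \<delta> s (f ` E) \<le> (\<Sum>j. diam_power s (B j))"
    proof (rule hausdorff_pre_le)
      show "f ` E \<subseteq> (\<Union>j. B j)" using A(1) unfolding B_def by blast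
      show "diameter (B j) < \<delta>" for j
        using diamB[of j] A(3)[of j] L by (simp add: field_simps)
    qed (use bB in auto)
    also have "\<dots> \<le> (\<Sum>j. ennreal (L powr s) * diam_power s (A j))"
    proof (intro suminf_le)
      fix j
      show "diam_power s (B j) \<le> ennreal (L powr s) * diam_power s (A j)"
      proof (cases "B j = {}")
        case False
        then have "A j \<noteq> {}" by (auto simp: B_def)
        have "diameter (B j) powr s \<le> (L * diameter (A j)) powr s"
          using diamB diameter_ge_0[OF bB] s by (intro powr_mono2) auto
        also have "\<dots> = L powr s * diameter (A j) powr s"
          using L diameter_ge_0[OF A(2)] by (simp add: powr_mult)
        finally show ?thesis using False \<open>A j \<noteq> {}\<close> L
          by (auto simp: diam_power_def ennreal_mult[symmetric] intro!: ennreal_leI)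
      qed simp
    qed auto
    also have "\<dots> = ennreal (L powr s) * (\<Sum>j. diam_power s (A j))" by simp
    finally show "hausdorff_pre \<delta> s (f ` E) \<le> ennreal (L powr s) * (\<Sum>j. diam_power s (A j))" .
  qed
  also have "\<dots> \<le> ennreal (L powr s) * hausdorff_outer s E"
    using d L by (intro mult_left_mono hausdorff_pre_le_outer) auto
  finally show "hausdorff_pre \<delta> s (f ` E) \<le> ennreal (L powr s) * hausdorff_outer s E" .
qed

text \<open>The Lipschitz estimate applied to the map and to its inverse gives the two
  inequalities.\<close>

lemma hausdorff_outer_affine:
  fixes E :: "real set"
  assumes "c > 0" "s \<ge> 0"
  shows "hausdorff_outer s ((\<lambda>y. b + c * y) ` E) = ennreal (c powr s) * hausdorff_outer s E"
proof (rule antisym)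
  show "hausdorff_outer s ((\<lambda>y. b + c * y) ` E) \<le> ennreal (c powr s) * hausdorff_outer s E"
    using assms by (intro hausdorff_outer_lipschitz_image) (auto simp: dist_real_def abs_mult right_diff_distrib[symmetric])
  have E: "(\<lambda>y. (y - b) / c) ` (\<lambda>y. b + c * y) ` E = E"
    using assms by (auto simp: image_image)
  have "hausdorff_outer s E \<le> ennreal ((1 / c) powr s) * hausdorff_outer s ((\<lambda>y. b + c * y) ` E)"
    using assms
    by (subst E[symmetric], intro hausdorff_outer_lipschitz_image)
      (auto simp: dist_real_def abs_mult diff_divide_distrib[symmetric])
  then have "ennreal (c powr s) * hausdorff_outer s E
      \<le> ennreal (c powr s) * (ennreal ((1 / c) powr s) * hausdorff_outer s ((\<lambda>y. b + c * y) ` E))"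
    by (rule mult_left_mono) simp
  also have "\<dots> = hausdorff_outer s ((\<lambda>y. b + c * y) ` E)"
    using assms by (simp add: mult.assoc[symmetric] ennreal_mult[symmetric] powr_mult[symmetric])
  finally show "ennreal (c powr s) * hausdorff_outer s E \<le> hausdorff_outer s ((\<lambda>y. b + c * y) ` E)" .
qed

section \<open>Metric outer measures and the measurability of Borel sets\<close>

text \<open>Covers finer than the distance e split: none of their members meets both A and
  B.\<close>

lemma hausdorff_outer_separated:
  assumes "e > 0" and sep: "\<And>x y. x \<in> A \<Longrightarrow> y \<in> B \<Longrightarrow> dist x y \<ge> e" and s: "s \<ge> 0"
  shows "hausdorff_outer s A + hausdorff_outer s B \<le> hausdorff_outer s (A \<union> B)"
proof -
  have *: "hausdorff_pre \<delta> s A + hausdorff_pre \<delta> s B \<le> hausdorff_outer s (A \<union> B)" if "0 < \<delta>" "\<delta> \<le> e" for \<delta>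
  proof -
    have "hausdorff_pre \<delta> s A + hausdorff_pre \<delta> s B \<le> hausdorff_pre \<delta> s (A \<union> B)"
      unfolding hausdorff_pre_def[of \<delta> s "A \<union> B"]
    proof (rule INF_greatest)
      fix C assume "C \<in> {C. A \<union> B \<subseteq> (\<Union>j::nat. C j) \<and> (\<forall>j. bounded (C j) \<and> diameter (C j) < \<delta>)}"
      then have C: "A \<union> B \<subseteq> (\<Union>j. C j)" "\<And>j. bounded (C j)" "\<And>j. diameter (C j) < \<delta>" by auto
      have sub: "hausdorff_pre \<delta> s D \<le> (\<Sum>j. diam_power s (C j \<inter> D))" if "D \<subseteq> A \<union> B" for D
      proof (rule hausdorff_pre_le)
        show "diameter (C j \<inter> D) < \<delta>" for j
          using diameter_subset[of "C j \<inter> D" "C j"] C(2,3)[of j] by auto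
      qed (use C that in \<open>auto intro: bounded_subset\<close>)
      have "hausdorff_pre \<delta> s A + hausdorff_pre \<delta> s B
          \<le> (\<Sum>j. diam_power s (C j \<inter> A)) + (\<Sum>j. diam_power s (C j \<inter> B))"
        by (intro add_mono sub) auto
      also have "\<dots> = (\<Sum>j. diam_power s (C j \<inter> A) + diam_power s (C j \<inter> B))"
        by (rule suminf_add) auto
      also have "\<dots> \<le> (\<Sum>j. diam_power s (C j))"
      proof (intro suminf_le)
        fix j
        have "C j \<inter> A = {} \<or> C j \<inter> B = {}"
        proof (rule ccontr)
          assume "\<not> (C j \<inter> A = {} \<or> C j \<inter> B = {})"
          then obtain x y where "x \<in> C j" "x \<in> A" "y \<in> C j" "y \<in> B" by auto
          then have "e \<le> diameter (C j)"
            using sep[of x y] diameter_bounded_bound[OF C(2), of x j y] by auto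
          with C(3)[of j] that show False by auto
        qed
        then show "diam_power s (C j \<inter> A) + diam_power s (C j \<inter> B) \<le> diam_power s (C j)"
          using diam_power_mono[of "C j \<inter> A" "C j" s] diam_power_mono[of "C j \<inter> B" "C j" s] C(2)[of j] s
          by auto
      qed auto
      finally show "hausdorff_pre \<delta> s A + hausdorff_pre \<delta> s B \<le> (\<Sum>j. diam_power s (C j))" .
    qed
    also have "\<dots> \<le> hausdorff_outer s (A \<union> B)" using that by (intro hausdorff_pre_le_outer)
    finally show ?thesis .
  qed
  \<comment> \<open>Two independent scales, so that the two suprema can be taken one after the
    other.\<close>
  have **: "hausdorff_pre \<delta> s A + hausdorff_pre \<delta>' s B \<le> hausdorff_outer s (A \<union> B)"
    if "0 < \<delta>" "0 < \<delta>'" for \<delta> \<delta>'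
  proof -
    let ?d = "min (min \<delta> \<delta>') e"
    have "hausdorff_pre \<delta> s A + hausdorff_pre \<delta>' s B \<le> hausdorff_pre ?d s A + hausdorff_pre ?d s B"
      by (intro add_mono hausdorff_pre_antimono) auto
    also have "\<dots> \<le> hausdorff_outer s (A \<union> B)" using that assms by (intro *) auto
    finally show ?thesis .
  qed
  have "hausdorff_outer s A + hausdorff_pre \<delta>' s B \<le> hausdorff_outer s (A \<union> B)" if "0 < \<delta>'" for \<delta>'
    unfolding hausdorff_outer_eq_SUP[of s A]
    by (subst ennreal_SUP_add_left[symmetric]) (auto intro!: SUP_least ** that)
  note *** = this
  show ?thesis
    unfolding hausdorff_outer_eq_SUP[of s B]
    by (subst ennreal_SUP_add_right) (auto intro!: SUP_least ***)
qed

text \<open>Caratheodory's criterion: additivity on separated sets makes closed sets measurable. E -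
  F is approximated from inside by sets at positive distance from F.\<close>

lemma hausdorff_closed_measurable:
  fixes F :: "'a::metric_space set"
  assumes F: "closed F" and s: "s \<ge> 0"
  shows "F \<in> sets (hausdorff_measure s)"
proof (cases "F = {}")
  case False
  show ?thesis
  proof (rule hausdorff_measurableI)
    fix E :: "'a set"
    let ?H = "hausdorff_outer s"
    assume fin: "?H E < \<infinity>"
    \<comment> \<open>\<open>G n\<close> keeps a distance from F, and what it misses of E - F lies
      in the shells \<open>D i\<close> with i \<ge> n. The point is that the measures of the shells
      have a finite sum.\<close>
    define G where "G n = {x \<in> E. infdist x F \<ge> 1 / real (Suc n)}" for n
    define D where "D n = G (Suc n) - G n" for n
    define a where "a n = ?H (D n)" for n
    have infd: "infdist x F \<le> infdist y F + dist x y" for x y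
      by (rule infdist_triangle)
    have EF: "?H (E \<inter> F) + ?H (G n) \<le> ?H E" for n
    proof -
      have "?H (E \<inter> F) + ?H (G n) \<le> ?H (E \<inter> F \<union> G n)"
      proof (rule hausdorff_outer_separated)
        fix x y assume "x \<in> E \<inter> F" "y \<in> G n"
        then show "dist x y \<ge> 1 / real (Suc n)"
          using infdist_le[of x F y] by (auto simp: G_def dist_commute)
      qed (use s in auto)
      also have "\<dots> \<le> ?H E" by (rule hausdorff_outer_mono) (auto simp: G_def)
      finally show ?thesis .
    qed
    have Gmono: "G m \<subseteq> G n" if "m \<le> n" for m n
    proof -
      have "1 / real (Suc n) \<le> 1 / real (Suc m)" using that by (simp add: frac_le)
      then show ?thesis by (auto simp: G_def)
    qed
    have sepD: "?H (D n) + ?H W \<le> ?H (D n \<union> W)" if "m < n" "W \<subseteq> G m" for m n W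
    proof (rule hausdorff_outer_separated)
      show "1 / real (Suc m) - 1 / real (Suc n) > 0" using that by (simp add: frac_less2)
      fix x y assume "x \<in> D n" "y \<in> W"
      then have "infdist x F < 1 / real (Suc n)" "infdist y F \<ge> 1 / real (Suc m)"
        using that by (auto simp: G_def D_def)
      then show "dist x y \<ge> 1 / real (Suc m) - 1 / real (Suc n)"
        using infd[of y x] by (simp add: dist_commute)
    qed (use s in auto)
    \<comment> \<open>Neighbouring shells may touch, but shells whose indices differ by at least two
      are separated. Even and odd indices (c = 0 and c = 1) are therefore summed apart, each bounded
      by the measure of E.\<close>
    have alt: "(\<Sum>i<m. a (2 * i + c)) \<le> ?H (\<Union>i<m. D (2 * i + c))" for m c
    proof (induction m)
      case (Suc m)
      show ?case
      proof (cases m)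
        case 0
        then show ?thesis by (simp add: a_def lessThan_Suc)
      next
        case (Suc m')
        have "(\<Union>i<m. D (2 * i + c)) \<subseteq> G (2 * m' + c + 1)"
        proof
          fix x assume "x \<in> (\<Union>i<m. D (2 * i + c))"
          then obtain i where i: "i < m" "x \<in> D (2 * i + c)" by auto
          then have "x \<in> G (Suc (2 * i + c))" by (auto simp: D_def)
          moreover have "Suc (2 * i + c) \<le> 2 * m' + c + 1" using i Suc by auto
          ultimately show "x \<in> G (2 * m' + c + 1)" using Gmono by blast
        qed
        then have "?H (D (2 * m + c)) + ?H (\<Union>i<m. D (2 * i + c))
            \<le> ?H (D (2 * m + c) \<union> (\<Union>i<m. D (2 * i + c)))"
          by (intro sepD[of "2 * m' + c + 1"]) (use Suc in auto)
        also have "D (2 * m + c) \<union> (\<Union>i<m. D (2 * i + c)) = (\<Union>i<Suc m. D (2 * i + c))"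
          by (auto simp: less_Suc_eq)
        finally show ?thesis
          using order_trans[OF add_left_mono[OF Suc.IH, of "a (2 * m + c)"]]
          by (simp add: a_def add.commute del: ennreal_add_left_cancel_le)
      qed
    qed simp
    have altE: "(\<Sum>i<m. a (2 * i + c)) \<le> ?H E" for m c
      by (rule order_trans[OF alt]) (auto simp: D_def G_def intro!: hausdorff_outer_mono)
    have "(\<Sum>i<m. a i) \<le> ?H E + ?H E" for m
    proof -
      have "(\<Sum>i<m. a i) \<le> (\<Sum>i<2 * m. a i)" by (rule sum_mono2) auto
      also have "\<dots> = (\<Sum>i<m. a (2 * i + 0)) + (\<Sum>i<m. a (2 * i + 1))"
        by (induction m) (auto simp: algebra_simps)
      also have "\<dots> \<le> ?H E + ?H E" by (intro add_mono altE)
      finally show ?thesis .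
    qed
    then have "(\<Sum>i. a i) \<le> ?H E + ?H E" by (intro suminf_le_const) auto
    moreover have "?H E + ?H E < \<infinity>" using fin by (simp add: ennreal_add_less_top)
    ultimately have S: "(\<Sum>i. a i) < \<infinity>" by (rule order_le_less_trans)
    \<comment> \<open>F is closed, so a point outside it has positive distance and belongs to some
      \<open>G p\<close>; the least such p names its shell.\<close>
    have "E - F \<subseteq> G n \<union> (\<Union>i. D (i + n))" for n
    proof
      fix x assume x: "x \<in> E - F"
      then have "infdist x F > 0"
        using F False in_closed_iff_infdist_zero[of F x] infdist_nonneg[of x F] by fastforce
      then obtain p where p: "1 / real (Suc p) < infdist x F"
        using nat_approx_posE by blast
      then have ex: "\<exists>p. x \<in> G p" using x by (auto simp: G_def intro!: exI[of _ p])
      define q where "q = (LEAST p. x \<in> G p)"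
      have q: "x \<in> G q" unfolding q_def using ex by (rule LeastI_ex)
      show "x \<in> G n \<union> (\<Union>i. D (i + n))"
      proof (cases "q \<le> n")
        case True
        with q Gmono show ?thesis by blast
      next
        case qn: False
        then obtain q' where q': "q = Suc q'" "q' \<ge> n" by (cases q) auto
        then have "x \<notin> G q'" using not_less_Least[of q' "\<lambda>p. x \<in> G p"] by (simp add: q_def)
        then have "x \<in> D ((q' - n) + n)" using q q' by (simp add: D_def)
        then show ?thesis by blast
      qed
    qed
    then have "?H (E - F) \<le> ?H (G n \<union> (\<Union>i. D (i + n)))" for n
      by (rule hausdorff_outer_mono)
    moreover have "?H (G n \<union> (\<Union>i. D (i + n))) \<le> ?H (G n) + ?H (\<Union>i. D (i + n))" for n
      by (rule hausdorff_outer_Un)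
    moreover have "?H (G n) + ?H (\<Union>i. D (i + n)) \<le> ?H (G n) + (\<Sum>i. a (i + n))" for n
      unfolding a_def by (intro add_left_mono hausdorff_outer_subadditive)
    ultimately have EmF: "?H (E - F) \<le> ?H (G n) + (\<Sum>i. a (i + n))" for n
      by (blast intro: order_trans)
    \<comment> \<open>Instead of letting the tail sum tend to 0, the first n shells are added to
      both sides; the full sum is finite and is cancelled at the end.\<close>
    have "(\<Sum>i<n. a i) + (?H (E \<inter> F) + ?H (E - F)) \<le> (\<Sum>i. a i) + ?H E" for n
    proof -
      have "(\<Sum>i<n. a i) + (?H (E \<inter> F) + ?H (E - F))
          \<le> (\<Sum>i<n. a i) + (?H (E \<inter> F) + (?H (G n) + (\<Sum>i. a (i + n))))"
        by (intro add_left_mono EmF)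
      also have "\<dots> = (\<Sum>i. a i) + (?H (E \<inter> F) + ?H (G n))"
        by (subst suminf_offset[of a n]) (simp_all add: add_ac)
      also have "\<dots> \<le> (\<Sum>i. a i) + ?H E" by (intro add_left_mono EF)
      finally show ?thesis .
    qed
    then have "(\<Sum>i. a i) + (?H (E \<inter> F) + ?H (E - F)) \<le> (\<Sum>i. a i) + ?H E"
      by (intro ennreal_suminf_bound_add)
    then show "?H (E \<inter> F) + ?H (E - F) \<le> ?H E"
      using S by (auto simp: ennreal_add_left_cancel_le)
  qed
qed (simp add: sets.empty_sets)

lemma borel_subset_hausdorff_measurable:
  assumes "s \<ge> 0"
  shows "sets borel \<subseteq> sets (hausdorff_measure s)"
proof -
  have "sigma_sets UNIV {S. closed S} \<subseteq> sets (hausdorff_measure s)"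
    using sets.sigma_sets_subset[of "{S. closed S}" "hausdorff_measure s"]
      hausdorff_closed_measurable[OF _ assms] by auto
  then show ?thesis by (simp add: borel_eq_closed)
qed

section \<open>Uniqueness of the dimension\<close>

text \<open>For sets of diameter below \<delta> the cost at exponent t is at most \<delta>^(t-s)
  times the cost at exponent s, and this factor tends to 0 with \<delta>.\<close>

lemma hausdorff_outer_higher_null:
  assumes "hausdorff_outer s E < \<infinity>" "0 \<le> s" "s < t"
  shows "hausdorff_outer t E = 0"
proof -
  have *: "hausdorff_pre \<delta> t E \<le> ennreal (\<delta> powr (t - s)) * hausdorff_outer s E" if d: "\<delta> > 0" for \<delta>
  proof -
    have dp: "diam_power t A \<le> ennreal (\<delta> powr (t - s)) * diam_power s A"
      if "bounded A" "diameter A < \<delta>" for A :: "'a set"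
    proof (cases "A = {}")
      case False
      have d0: "0 \<le> diameter A" using diameter_ge_0 that by auto
      show ?thesis
      \<comment> \<open>The convention diam^0 = 1 of \<open>diam_power\<close> differs from
        \<open>0 powr 0 = 0\<close>, so the exponents cannot simply be added here.\<close>
      proof (cases "s = 0")
        case True
        have "diameter A powr t \<le> \<delta> powr t" using d0 that assms by (intro powr_mono2) auto
        then show ?thesis using True False assms by (simp add: diam_power_def ennreal_leI)
      next
        case s0: False
        have "diameter A powr t = diameter A powr (t - s) * diameter A powr s"
          by (simp add: powr_add[symmetric])
        also have "\<dots> \<le> \<delta> powr (t - s) * diameter A powr s"
          using d0 that assms by (intro mult_right_mono powr_mono2) auto
        finally show ?thesis using s0 False assms
          by (simp add: diam_power_def ennreal_mult[symmetric] ennreal_leI)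
      qed
    qed simp
    have "hausdorff_pre \<delta> t E \<le> ennreal (\<delta> powr (t - s)) * hausdorff_pre \<delta> s E"
    proof (rule hausdorff_pre_greatest)
      fix A :: "nat \<Rightarrow> 'a set"
      assume A: "E \<subseteq> (\<Union>j. A j)" "\<And>j. bounded (A j)" "\<And>j. diameter (A j) < \<delta>"
      have "hausdorff_pre \<delta> t E \<le> (\<Sum>j. diam_power t (A j))" by (rule hausdorff_pre_le) fact+
      also have "\<dots> \<le> (\<Sum>j. ennreal (\<delta> powr (t - s)) * diam_power s (A j))"
        by (intro suminf_le dp A) auto
      finally show "hausdorff_pre \<delta> t E \<le> ennreal (\<delta> powr (t - s)) * (\<Sum>j. diam_power s (A j))" by simp
    qed (use d in auto)
    also have "\<dots> \<le> ennreal (\<delta> powr (t - s)) * hausdorff_outer s E"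
      by (intro mult_left_mono hausdorff_pre_le_outer d) auto
    finally show ?thesis .
  qed
  obtain h where h: "h \<ge> 0" "hausdorff_outer s E = ennreal h"
    using assms(1) by (cases "hausdorff_outer s E") auto
  have "hausdorff_outer t E \<le> 0 + ennreal e" if e: "e > 0" for e
  proof (rule hausdorff_outer_least)
    fix \<delta> :: real assume d: "\<delta> > 0"
    \<comment> \<open>Chosen so that d'^(t-s) h \<le> e; the summand 1 in h + 1 covers h =
      0.\<close>
    define d' where "d' = min \<delta> ((e / (h + 1)) powr (1 / (t - s)))"
    have d': "d' > 0" using d e h by (simp add: d'_def)
    have "d' powr (t - s) \<le> ((e / (h + 1)) powr (1 / (t - s))) powr (t - s)"
      using d' assms by (intro powr_mono2) (auto simp: d'_def)
    also have "\<dots> = e / (h + 1)" using assms e h by (simp add: powr_powr)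
    finally have "d' powr (t - s) * h \<le> e / (h + 1) * h" using h by (intro mult_right_mono)
    also have "\<dots> \<le> e" using e h by (simp add: field_simps)
    finally have "ennreal (d' powr (t - s)) * ennreal h \<le> ennreal e"
      using h by (simp add: ennreal_mult[symmetric] ennreal_leI)
    moreover have "hausdorff_pre \<delta> t E \<le> hausdorff_pre d' t E"
      by (rule hausdorff_pre_antimono) (simp add: d'_def)
    ultimately show "hausdorff_pre \<delta> t E \<le> 0 + ennreal e"
      using *[OF d'] h by simp
  qed
  then have "hausdorff_outer t E \<le> 0" by (rule ennreal_le_epsilon)
  then show ?thesis by simp
qed

text \<open>The larger of two candidates would see E as a null set. This makes the definite
  description in \<open>hausdorff_dimension\<close> usable.\<close>

lemma has_hausdorff_dimension_unique:
  assumes "has_hausdorff_dimension E s" "has_hausdorff_dimension E t"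
  shows "s = t"
proof -
  have False if "has_hausdorff_dimension E s" "has_hausdorff_dimension E t" "s < t" for s t
    using that hausdorff_outer_higher_null[of s E t]
    by (auto simp: has_hausdorff_dimension_def emeasure_hausdorff_measure)
  with assms show ?thesis by (meson linorder_neq_iff)
qed

lemma hausdorff_dimension_eq:
  "has_hausdorff_dimension E s \<Longrightarrow> hausdorff_dimension E = s"
  unfolding hausdorff_dimension_def by (blast intro: the_equality has_hausdorff_dimension_unique)

section \<open>Expansions in base N\<close>

definition base_sum :: "nat \<Rightarrow> (nat \<Rightarrow> nat) \<Rightarrow> real" where
  "base_sum N d = (\<Sum>m. real (d m) / real N ^ Suc m)"

lemma sums_max_digits:
  assumes "N \<ge> 2"
  shows "(\<lambda>m. real (N - 1) / real N ^ Suc m) sums 1"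
proof -
  have "(\<lambda>m. (1 / real N) ^ m) sums (1 / (1 - 1 / real N))"
    using assms by (intro geometric_sums) auto
  then have "(\<lambda>m. real (N - 1) / real N * (1 / real N) ^ m) sums (real (N - 1) / real N * (1 / (1 - 1 / real N)))"
    by (rule sums_mult)
  then show ?thesis using assms by (simp add: field_simps of_nat_diff)
qed

lemma summable_max_digits:
  assumes "N \<ge> 1"
  shows "summable (\<lambda>m. real (N - 1) / real N ^ Suc m)"
proof (cases "N = 1")
  case False
  with assms show ?thesis using sums_max_digits[of N] by (simp add: sums_iff)
qed simp

lemma digit_le:
  assumes "d m < N"
  shows "real (d m) / real N ^ Suc m \<le> real (N - 1) / real N ^ Suc m"
  using assms by (intro divide_right_mono) auto

lemma summable_digits:
  assumes "\<And>m. d m < N"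
  shows "summable (\<lambda>m. real (d m) / real N ^ Suc m)"
proof (rule summable_comparison_test'[OF summable_max_digits])
  show "N \<ge> 1" using assms[of 0] by simp
  show "norm (real (d m) / real N ^ Suc m) \<le> real (N - 1) / real N ^ Suc m" for m
    using digit_le[of d m N, OF assms] by simp
qed

lemma base_sum_nonneg:
  assumes "\<And>m. d m < N"
  shows "0 \<le> base_sum N d"
  unfolding base_sum_def by (intro suminf_nonneg summable_digits assms) auto

lemma base_sum_le:
  assumes "\<And>m. d m < N"
  shows "base_sum N d \<le> (if N = 1 then 0 else 1)"
proof (cases "N = 1")
  case True
  with assms have "d = (\<lambda>_. 0)" by auto
  then show ?thesis by (simp add: base_sum_def)
next
  case False
  then have "N \<ge> 2" using assms[of 0] by linarith
  then have "base_sum N d \<le> (\<Sum>m. real (N - 1) / real N ^ Suc m)"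
    unfolding base_sum_def
    by (intro suminf_le digit_le summable_digits assms summable_max_digits) auto
  also have "\<dots> = 1" using sums_max_digits[OF \<open>N \<ge> 2\<close>] by (simp add: sums_iff)
  finally show ?thesis using False by simp
qed

lemma base_sum_split:
  assumes "\<And>m. d m < N"
  shows "base_sum N d = (\<Sum>m<n. real (d m) / real N ^ Suc m) + base_sum N (\<lambda>m. d (m + n)) / real N ^ n"
proof -
  have "base_sum N d = (\<Sum>m. real (d (m + n)) / real N ^ Suc (m + n)) + (\<Sum>m<n. real (d m) / real N ^ Suc m)"
    unfolding base_sum_def by (rule suminf_split_initial_segment[OF summable_digits[OF assms]])
  also have "(\<Sum>m. real (d (m + n)) / real N ^ Suc (m + n)) = (\<Sum>m. real (d (m + n)) / real N ^ Suc m / real N ^ n)"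
    by (simp add: power_add mult_ac)
  also have "\<dots> = base_sum N (\<lambda>m. d (m + n)) / real N ^ n"
    unfolding base_sum_def by (rule suminf_divide[OF summable_digits]) (rule assms)
  finally show ?thesis by simp
qed

lemma base_sum_eq_0D:
  assumes "\<And>m. d m < N" "base_sum N d = 0"
  shows "d m = 0"
  using suminf_eq_zero_iff[OF summable_digits[of d N, OF assms(1)]] assms
  by (auto simp: base_sum_def dest!: spec[of _ m])

text \<open>Complementing every digit to N - 1 - d m subtracts the value from 1, which reduces the
  claim to sums that vanish.\<close>

lemma base_sum_eq_1D:
  assumes "N \<ge> 2" "\<And>m. d m < N" "base_sum N d = 1"
  shows "d m = N - 1"
proof -
  have "base_sum N (\<lambda>m. N - 1 - d m) = (\<Sum>m. real (N - 1) / real N ^ Suc m - real (d m) / real N ^ Suc m)"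
    unfolding base_sum_def
  proof (rule suminf_cong)
    fix m show "real (N - 1 - d m) / real N ^ Suc m = real (N - 1) / real N ^ Suc m - real (d m) / real N ^ Suc m"
      unfolding diff_divide_distrib[symmetric] using assms(1) assms(2)[of m] by (simp add: of_nat_diff)
  qed
  also have "\<dots> = (\<Sum>m. real (N - 1) / real N ^ Suc m) - base_sum N d"
    unfolding base_sum_def using assms
    by (intro suminf_diff[symmetric] summable_max_digits summable_digits) auto
  also have "\<dots> = 0" using sums_max_digits[OF assms(1)] assms(3) by (simp add: sums_iff)
  finally have "N - 1 - d m = 0"
    by (intro base_sum_eq_0D[of "\<lambda>m. N - 1 - d m" N]) (use assms(1) in auto)
  then show ?thesis using assms(2)[of m] by auto
qed

text \<open>At the first difference one side leads by at least one unit of place m, while the tails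
  contribute between 0 and 1 such units. Equality forces both tails to be extremal.\<close>

lemma base_sum_eq_tails:
  assumes N: "N \<ge> 2" and d: "\<And>m. d m < N" and d': "\<And>m. d' m < N" and eq: "base_sum N d = base_sum N d'"
    and pre: "\<And>j. j < m \<Longrightarrow> d j = d' j" and less: "d m < d' m" and j: "m < j"
  shows "d j = N - 1" "d' j = 0"
proof -
  let ?P = "\<Sum>j<m. real (d j) / real N ^ Suc j"
  let ?t = "base_sum N (\<lambda>i. d (i + Suc m))" and ?t' = "base_sum N (\<lambda>i. d' (i + Suc m))"
  have P': "(\<Sum>j<m. real (d' j) / real N ^ Suc j) = ?P" using pre by (intro sum.cong) auto
  have "?P + real (d m) / real N ^ Suc m + ?t / real N ^ Suc m
      = ?P + real (d' m) / real N ^ Suc m + ?t' / real N ^ Suc m"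
    using eq base_sum_split[of d N "Suc m", OF d] base_sum_split[of d' N "Suc m", OF d'] P' by simp
  then have "(real (d m) + ?t) / real N ^ Suc m = (real (d' m) + ?t') / real N ^ Suc m"
    by (simp add: add_divide_distrib)
  then have "real (d m) + ?t = real (d' m) + ?t'" using N by simp
  moreover have "?t \<le> 1" "?t' \<ge> 0"
    using base_sum_le[of "\<lambda>i. d (i + Suc m)" N] base_sum_nonneg[of "\<lambda>i. d' (i + Suc m)" N] d d' N by auto
  moreover have "real (d m) + 1 \<le> real (d' m)" using less by linarith
  ultimately have "?t = 1" "?t' = 0" by linarith+
  then have "d (j - Suc m + Suc m) = N - 1" "d' (j - Suc m + Suc m) = 0"
    using base_sum_eq_1D[OF N, of "\<lambda>i. d (i + Suc m)" "j - Suc m"]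
      base_sum_eq_0D[of "\<lambda>i. d' (i + Suc m)" N "j - Suc m"] d d' by blast+
  then show "d j = N - 1" "d' j = 0" using j by auto
qed

text \<open>Of the two expansions the terminating one is kept: it shows that the point is rational,
  and it is the kind of digit sequence that is impossible when R = 1.\<close>

lemma base_sum_eq_eventually_0:
  assumes N: "N \<ge> 2" and d: "\<And>m. d m < N" and d': "\<And>m. d' m < N" and eq: "base_sum N d = base_sum N d'"
    and ne: "d \<noteq> d'"
  shows "\<exists>m e. e \<in> {d, d'} \<and> (\<forall>j>m. e j = 0)"
proof -
  define m where "m = (LEAST m. d m \<noteq> d' m)"
  have m: "d m \<noteq> d' m" unfolding m_def using ne LeastI_ex[of "\<lambda>m. d m \<noteq> d' m"] by blast
  have pre: "d j = d' j" if "j < m" for j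
    using not_less_Least[of j "\<lambda>m. d m \<noteq> d' m"] that by (simp add: m_def)
  show ?thesis
  proof (cases "d m < d' m")
    case True
    have "\<forall>j>m. d' j = 0"
      by (intro allI impI base_sum_eq_tails(2)[of N d d' m, OF N d d' eq pre True])
    then show ?thesis by (intro exI[of _ m] exI[of _ d']) simp
  next
    case False
    then have "d' m < d m" using m by simp
    then have "\<forall>j>m. d j = 0"
      by (intro allI impI base_sum_eq_tails(2)[of N d' d m, OF N d' d eq[symmetric] pre[symmetric]])
    then show ?thesis by (intro exI[of _ m] exI[of _ d]) simp
  qed
qed

lemma finite_digits_unique:
  assumes N: "N \<ge> 2" and d: "\<And>m. d m < N" and d': "\<And>m. d' m < N"
    and eq: "(\<Sum>m<n. real (d m) / real N ^ Suc m) = (\<Sum>m<n. real (d' m) / real N ^ Suc m)"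
    and m: "m < n"
  shows "d m = d' m"
proof -
  define e e' where "e m = (if m < n then d m else 0)" and "e' m = (if m < n then d' m else 0)" for m
  have es: "e m < N" "e' m < N" for m using d d' N by (auto simp: e_def e'_def)
  have fin: "base_sum N e = (\<Sum>m<n. real (d m) / real N ^ Suc m)" "base_sum N e' = (\<Sum>m<n. real (d' m) / real N ^ Suc m)"
    unfolding base_sum_def by (subst suminf_finite[of "{..<n}"]; auto simp: e_def e'_def)+
  have "e = e'"
  proof (rule ccontr)
    assume "e \<noteq> e'"
    define m where "m = (LEAST m. e m \<noteq> e' m)"
    have m: "e m \<noteq> e' m" unfolding m_def using \<open>e \<noteq> e'\<close> LeastI_ex[of "\<lambda>m. e m \<noteq> e' m"] by blast
    have pre: "e j = e' j" if "j < m" for j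
      using not_less_Least[of j "\<lambda>m. e m \<noteq> e' m"] that by (simp add: m_def)
    have "m < n" using m by (metis e_def e'_def)
    \<comment> \<open>At position \<open>Suc n\<close> both padded sequences vanish, whereas one of
      two distinct expansions of a number has the digit N - 1 there.\<close>
    then have z: "m < Suc n" "e (Suc n) = 0" "e' (Suc n) = 0" by (auto simp: e_def e'_def)
    have eq': "base_sum N e = base_sum N e'" using fin eq by simp
    consider "e m < e' m" | "e' m < e m" using m by linarith
    then have "e (Suc n) = N - 1 \<or> e' (Suc n) = N - 1"
    proof cases
      case 1
      then show ?thesis using base_sum_eq_tails(1)[of N e e' m, OF N es(1) es(2) eq' pre 1 z(1)] by simp
    next
      case 2
      then show ?thesis
        using base_sum_eq_tails(1)[of N e' e m, OF N es(2) es(1) eq'[symmetric] pre[symmetric] 2 z(1)] by simp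
    qed
    then show False using z N by simp
  qed
  then have "e m = e' m" by simp
  then show ?thesis using m by (simp add: e_def e'_def)
qed

text \<open>Each partial sum depends on finitely many coordinates, and the series of maximal digits
  dominates uniformly. Together with compactness of cylinders this makes their images
  compact.\<close>

lemma continuous_on_base_sum:
  assumes "N \<ge> 1"
  shows "continuous_on {d. \<forall>m. d m < N} (base_sum N)"
proof -
  have "uniform_limit {d. \<forall>m. d m < N} (\<lambda>n d. \<Sum>m<n. real (d m) / real N ^ Suc m) (\<lambda>d. \<Sum>m. real (d m) / real N ^ Suc m) sequentially"
  proof (rule Weierstrass_m_test[OF _ summable_max_digits[OF assms]])
    fix n :: nat and d :: "nat \<Rightarrow> nat" assume "d \<in> {d. \<forall>m. d m < N}"
    then show "norm (real (d n) / real N ^ Suc n) \<le> real (N - 1) / real N ^ Suc n"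
      using digit_le[of d n N] by simp
  qed
  moreover have "continuous_on {d. \<forall>m. d m < N} (\<lambda>d. \<Sum>m<n. real (d m) / real N ^ Suc m)" for n
    using assms by (intro continuous_intros continuous_on_of_nat continuous_on_subset[OF continuous_on_product_coordinates]) auto
  ultimately show ?thesis
    unfolding base_sum_def[abs_def] by (intro uniform_limit_theorem) auto
qed

section \<open>Positive eigenvectors\<close>

text \<open>For a nonnegative matrix, a positive eigenvector x belongs to the spectral radius: the
  modulus of any other eigenvector is compared with multiples of x.\<close>

lemma rho_eqI:
  assumes B: "B \<in> carrier_mat n n" and n: "n > 0" and x: "\<And>a. a < n \<Longrightarrow> x a > (0::real)"
    and eig: "\<And>a. a < n \<Longrightarrow> (\<Sum>b<n. real (B $$ (a, b)) * x b) = c * x a"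
  shows "rho B = c"
proof -
  define C :: "complex mat" where "C = map_mat of_nat B"
  have C: "C \<in> carrier_mat n n" using B by (simp add: C_def)
  have mv: "(C *\<^sub>v u) $ a = (\<Sum>b<n. of_nat (B $$ (a, b)) * u $ b)" if "u \<in> carrier_vec n" "a < n" for u a
    using that B by (auto simp: C_def scalar_prod_def lessThan_atLeast0 intro!: sum.cong)
  have c0: "c \<ge> 0"
  proof -
    have "0 \<le> (\<Sum>b<n. real (B $$ (0, b)) * x b)" by (intro sum_nonneg mult_nonneg_nonneg) (auto intro: less_imp_le x)
    then have "0 \<le> c * x 0" using eig[OF n] by simp
    then show ?thesis using x[OF n] by (simp add: zero_le_mult_iff)
  qed
  have "eigenvector C (vec n (\<lambda>a. complex_of_real (x a))) (complex_of_real c)"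
    unfolding eigenvector_def
  proof (intro conjI)
    show "vec n (\<lambda>a. complex_of_real (x a)) \<in> carrier_vec (dim_row C)" using C by simp
    show "vec n (\<lambda>a. complex_of_real (x a)) \<noteq> 0\<^sub>v (dim_row C)"
    proof
      assume "vec n (\<lambda>a. complex_of_real (x a)) = 0\<^sub>v (dim_row C)"
      then have "vec n (\<lambda>a. complex_of_real (x a)) $ 0 = 0\<^sub>v (dim_row C) $ 0" by simp
      then show False using n C x[OF n] by simp
    qed
    show "C *\<^sub>v vec n (\<lambda>a. complex_of_real (x a)) = complex_of_real c \<cdot>\<^sub>v vec n (\<lambda>a. complex_of_real (x a))"
    proof (rule eq_vecI)
      fix a assume "a < dim_vec (complex_of_real c \<cdot>\<^sub>v vec n (\<lambda>a. complex_of_real (x a)))"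
      then have a: "a < n" by simp
      have "(C *\<^sub>v vec n (\<lambda>a. complex_of_real (x a))) $ a = (\<Sum>b<n. of_nat (B $$ (a, b)) * complex_of_real (x b))"
        using a by (subst mv) auto
      also have "\<dots> = complex_of_real (\<Sum>b<n. real (B $$ (a, b)) * x b)" by simp
      also have "\<dots> = complex_of_real (c * x a)" using eig[OF a] by simp
      finally show "(C *\<^sub>v vec n (\<lambda>a. complex_of_real (x a))) $ a
          = (complex_of_real c \<cdot>\<^sub>v vec n (\<lambda>a. complex_of_real (x a))) $ a" using a by simp
    qed (use C in simp)
  qed
  then have "norm (complex_of_real c) \<in> norm ` spectrum C"
    unfolding spectrum_def eigenvalue_def by blast
  then have ge: "c \<le> spectral_radius C"
    using spectral_radius_mem_max(2)[OF C n, of c] c0 by simp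
  obtain ev where "ev \<in> spectrum C" and sr: "spectral_radius C = norm ev"
    using spectral_radius_mem_max(1)[OF C n] by auto
  then obtain u where u: "u \<in> carrier_vec n" "u \<noteq> 0\<^sub>v n" "C *\<^sub>v u = ev \<cdot>\<^sub>v u"
    using C by (auto simp: spectrum_def eigenvalue_def eigenvector_def)
  \<comment> \<open>The least t for which the moduli of the entries of u are bounded by t x. At an
    index a of equality the eigenvalue equation reads |ev| t x_a \<le> c t x_a.\<close>
  define t where "t = Max ((\<lambda>b. norm (u $ b) / x b) ` {..<n})"
  have tge: "norm (u $ b) \<le> t * x b" if "b < n" for b
  proof -
    have "norm (u $ b) / x b \<le> t" unfolding t_def using that by (intro Max_ge) auto
    then show ?thesis using x[OF that] by (simp add: field_simps)
  qed
  have "t \<in> (\<lambda>b. norm (u $ b) / x b) ` {..<n}" unfolding t_def using n by (intro Max_in) auto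
  then obtain a where a: "a < n" "t = norm (u $ a) / x a" by auto
  then have ta: "norm (u $ a) = t * x a" using x[of a] by simp
  have "t > 0"
  proof (rule ccontr)
    assume "\<not> t > 0"
    have "u = 0\<^sub>v n"
    proof (rule eq_vecI)
      fix b assume "b < dim_vec (0\<^sub>v n)"
      then have b: "b < n" by simp
      have "t * x b \<le> 0" using \<open>\<not> t > 0\<close> x[OF b] by (simp add: mult_le_0_iff)
      then show "u $ b = 0\<^sub>v n $ b" using order_trans[OF tge[OF b], of 0] b by simp
    qed (use u in auto)
    with u show False by simp
  qed
  have "norm ev * (t * x a) = norm ((ev \<cdot>\<^sub>v u) $ a)" using u a ta by (simp add: norm_mult)
  also have "\<dots> = norm (\<Sum>b<n. of_nat (B $$ (a, b)) * u $ b)" using u(3)[symmetric] mv[OF u(1) a(1)] by simp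
  also have "\<dots> \<le> (\<Sum>b<n. real (B $$ (a, b)) * (t * x b))"
    by (rule sum_norm_le) (auto simp: norm_mult intro!: mult_left_mono tge)
  also have "\<dots> = t * (\<Sum>b<n. real (B $$ (a, b)) * x b)" by (simp add: sum_distrib_left mult_ac)
  also have "\<dots> = c * (t * x a)" using eig[OF a(1)] by simp
  finally have "norm ev \<le> c" using \<open>t > 0\<close> x[OF a(1)] by simp
  with ge sr show ?thesis unfolding rho_def C_def by simp
qed

section \<open>Higher-rank graphs and their infinite paths\<close>

abbreviation deg_zero :: "nat \<Rightarrow> nat" where "deg_zero \<equiv> \<lambda>_. 0"

abbreviation deg_add :: "(nat \<Rightarrow> nat) \<Rightarrow> (nat \<Rightarrow> nat) \<Rightarrow> nat \<Rightarrow> nat" (infixl "\<boxplus>" 65)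
  where "m \<boxplus> n \<equiv> (\<lambda>i. m i + n i)"

lemma deg_zero_Nk [simp]: "deg_zero \<in> Nk k"
  by (simp add: Nk_def)

lemma deg_add_Nk [simp]: "m \<in> Nk k \<Longrightarrow> n \<in> Nk k \<Longrightarrow> m \<boxplus> n \<in> Nk k"
  by (simp add: Nk_def)

lemma unit_deg_Nk [simp]: "i \<in> {1..k} \<Longrightarrow> unit_deg i \<in> Nk k"
  by (auto simp: Nk_def unit_deg_def)

lemma deg_zero_le [simp]: "deg_zero \<le> n"
  by (simp add: le_fun_def)

lemma deg_le_add [simp]: "m \<le> m \<boxplus> n"
  by (simp add: le_fun_def)

lemma deg_add_mono [simp]: "p \<boxplus> n \<le> q \<boxplus> n \<longleftrightarrow> p \<le> q"
  by (simp add: le_fun_def)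

lemma deg_diff_Nk [simp]: "q \<in> Nk k \<Longrightarrow> (\<lambda>i. q i - p i) \<in> Nk k"
  by (simp add: Nk_def)

lemma Omega_simps [simp]:
  "(p, q) \<in> Mor (Omega k) \<longleftrightarrow> p \<in> Nk k \<and> q \<in> Nk k \<and> p \<le> q"
  "rng (Omega k) (p, q) = (p, p)" "src (Omega k) (p, q) = (q, q)"
  "cmp (Omega k) (p, q) (q', r) = (p, r)" "deg (Omega k) (p, q) = (\<lambda>i. q i - p i)"
  by (auto simp: Omega_def)

lemma infinite_paths_iff:
  "x \<in> infinite_paths k \<Lambda> \<longleftrightarrow> x \<in> extensional (Mor (Omega k)) \<and>
    (\<forall>p q. p \<in> Nk k \<and> q \<in> Nk k \<and> p \<le> q \<longrightarrow> x (p, q) \<in> Mor \<Lambda> \<and> deg \<Lambda> (x (p, q)) = (\<lambda>i. q i - p i) \<and>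
      rng \<Lambda> (x (p, q)) = x (p, p) \<and> src \<Lambda> (x (p, q)) = x (q, q)) \<and>
    (\<forall>p q r. p \<in> Nk k \<and> q \<in> Nk k \<and> r \<in> Nk k \<and> p \<le> q \<and> q \<le> r \<longrightarrow>
      x (p, r) = cmp \<Lambda> (x (p, q)) (x (q, r)))"
  unfolding infinite_paths_def kgraph_morphism_def
  by (simp add: Ball_def split_paired_All, rule iffI; elim conjE; intro conjI allI impI; metis)

context
  fixes k :: nat and \<Lambda> :: "('a, 'b) graded_cat_scheme" and x
  assumes x: "x \<in> infinite_paths k \<Lambda>"
begin

lemma path_segment:
  assumes "p \<in> Nk k" "q \<in> Nk k" "p \<le> q"
  shows "x (p, q) \<in> Mor \<Lambda>" "deg \<Lambda> (x (p, q)) = (\<lambda>i. q i - p i)"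
    "rng \<Lambda> (x (p, q)) = x (p, p)" "src \<Lambda> (x (p, q)) = x (q, q)"
  using x assms by (auto simp: infinite_paths_iff)

lemma path_cmp:
  assumes "p \<in> Nk k" "q \<in> Nk k" "r \<in> Nk k" "p \<le> q" "q \<le> r"
  shows "cmp \<Lambda> (x (p, q)) (x (q, r)) = x (p, r)"
  using x assms by (auto simp: infinite_paths_iff)

end

text \<open>The shift that drops the initial segment of degree n; the restriction keeps the result
  extensional, as \<open>infinite_paths\<close> demands.\<close>

definition path_shift :: "nat \<Rightarrow> (nat \<Rightarrow> nat) \<Rightarrow> ((nat \<Rightarrow> nat) \<times> (nat \<Rightarrow> nat) \<Rightarrow> 'a) \<Rightarrow> (nat \<Rightarrow> nat) \<times> (nat \<Rightarrow> nat) \<Rightarrow> 'a"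
  where "path_shift k n x = restrict (\<lambda>(p, q). x (p \<boxplus> n, q \<boxplus> n)) (Mor (Omega k))"

lemma path_shift_apply:
  "p \<in> Nk k \<Longrightarrow> q \<in> Nk k \<Longrightarrow> p \<le> q \<Longrightarrow> path_shift k n x (p, q) = x (p \<boxplus> n, q \<boxplus> n)"
  by (simp add: path_shift_def)

lemma path_shift_infinite_paths:
  assumes "x \<in> infinite_paths k \<Lambda>" "n \<in> Nk k"
  shows "path_shift k n x \<in> infinite_paths k \<Lambda>"
  unfolding infinite_paths_iff
  using assms by (auto simp: path_shift_apply path_segment path_cmp) (simp add: path_shift_def)

locale kgraph =
  fixes k :: nat and \<Lambda> :: "('a, 'b) graded_cat_scheme"
  assumes kgraph: "k_graph k \<Lambda>"
begin

lemma rng_src_Mor [simp]: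
  assumes "\<eta> \<in> Mor \<Lambda>"
  shows "rng \<Lambda> \<eta> \<in> Mor \<Lambda>" "src \<Lambda> \<eta> \<in> Mor \<Lambda>"
    "rng \<Lambda> (rng \<Lambda> \<eta>) = rng \<Lambda> \<eta>" "src \<Lambda> (rng \<Lambda> \<eta>) = rng \<Lambda> \<eta>"
    "rng \<Lambda> (src \<Lambda> \<eta>) = src \<Lambda> \<eta>" "src \<Lambda> (src \<Lambda> \<eta>) = src \<Lambda> \<eta>"
    "cmp \<Lambda> (rng \<Lambda> \<eta>) \<eta> = \<eta>" "cmp \<Lambda> \<eta> (src \<Lambda> \<eta>) = \<eta>"
  using kgraph assms by (auto simp: k_graph_def is_category_def)

lemma cmp_Mor [simp]:
  assumes "\<mu> \<in> Mor \<Lambda>" "\<nu> \<in> Mor \<Lambda>" "src \<Lambda> \<mu> = rng \<Lambda> \<nu>"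
  shows "cmp \<Lambda> \<mu> \<nu> \<in> Mor \<Lambda>" "rng \<Lambda> (cmp \<Lambda> \<mu> \<nu>) = rng \<Lambda> \<mu>" "src \<Lambda> (cmp \<Lambda> \<mu> \<nu>) = src \<Lambda> \<nu>"
    "deg \<Lambda> (cmp \<Lambda> \<mu> \<nu>) = deg \<Lambda> \<mu> \<boxplus> deg \<Lambda> \<nu>"
  using kgraph assms by (auto simp: k_graph_def is_category_def degree_functor_def)

lemma deg_Nk [simp]: "\<eta> \<in> Mor \<Lambda> \<Longrightarrow> deg \<Lambda> \<eta> \<in> Nk k"
  using kgraph by (auto simp: k_graph_def degree_functor_def)

lemma rng_src_vertices [simp]:
  "\<eta> \<in> Mor \<Lambda> \<Longrightarrow> rng \<Lambda> \<eta> \<in> vertices \<Lambda>" "\<eta> \<in> Mor \<Lambda> \<Longrightarrow> src \<Lambda> \<eta> \<in> vertices \<Lambda>"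
  by (auto simp: vertices_def)

lemma deg_vertex: "v \<in> vertices \<Lambda> \<Longrightarrow> deg \<Lambda> v = deg_zero"
  using kgraph by (auto simp: k_graph_def degree_functor_def)

lemma vertexD:
  assumes "v \<in> vertices \<Lambda>"
  shows "v \<in> Mor \<Lambda>" "rng \<Lambda> v = v" "src \<Lambda> v = v"
  using assms by (auto simp: vertices_def)

lemma factorization:
  assumes "\<eta> \<in> Mor \<Lambda>" "m \<in> Nk k" "n \<in> Nk k" "deg \<Lambda> \<eta> = m \<boxplus> n"
  obtains \<mu> \<nu> where "\<mu> \<in> Mor \<Lambda>" "\<nu> \<in> Mor \<Lambda>" "src \<Lambda> \<mu> = rng \<Lambda> \<nu>" "\<eta> = cmp \<Lambda> \<mu> \<nu>"
    "deg \<Lambda> \<mu> = m" "deg \<Lambda> \<nu> = n"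
proof -
  have "\<exists>!(\<mu>, \<nu>). \<mu> \<in> Mor \<Lambda> \<and> \<nu> \<in> Mor \<Lambda> \<and> src \<Lambda> \<mu> = rng \<Lambda> \<nu> \<and>
           \<eta> = cmp \<Lambda> \<mu> \<nu> \<and> deg \<Lambda> \<mu> = m \<and> deg \<Lambda> \<nu> = n"
    using kgraph assms unfolding k_graph_def factorization_property_def by blast
  then show thesis using that by (auto elim!: ex1E)
qed

text \<open>Comparing the degrees of the first factors is enough: those of the second factors then
  agree by cancellation, and uniqueness of the factorization applies.\<close>

lemma cmp_cancel:
  assumes "\<mu> \<in> Mor \<Lambda>" "\<nu> \<in> Mor \<Lambda>" "src \<Lambda> \<mu> = rng \<Lambda> \<nu>"
    and "\<mu>' \<in> Mor \<Lambda>" "\<nu>' \<in> Mor \<Lambda>" "src \<Lambda> \<mu>' = rng \<Lambda> \<nu>'"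
    and eq: "cmp \<Lambda> \<mu> \<nu> = cmp \<Lambda> \<mu>' \<nu>'" and deg: "deg \<Lambda> \<mu> = deg \<Lambda> \<mu>'"
  shows "\<mu> = \<mu>'" "\<nu> = \<nu>'"
proof -
  have "deg \<Lambda> \<mu> \<boxplus> deg \<Lambda> \<nu> = deg \<Lambda> \<mu>' \<boxplus> deg \<Lambda> \<nu>'"
    using assms cmp_Mor(4) by metis
  then have deg': "deg \<Lambda> \<nu> = deg \<Lambda> \<nu>'" using deg by (simp add: fun_eq_iff)
  have "\<exists>!(\<mu>1, \<nu>1). \<mu>1 \<in> Mor \<Lambda> \<and> \<nu>1 \<in> Mor \<Lambda> \<and> src \<Lambda> \<mu>1 = rng \<Lambda> \<nu>1 \<and>
           cmp \<Lambda> \<mu> \<nu> = cmp \<Lambda> \<mu>1 \<nu>1 \<and> deg \<Lambda> \<mu>1 = deg \<Lambda> \<mu> \<and> deg \<Lambda> \<nu>1 = deg \<Lambda> \<nu>"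
    using kgraph cmp_Mor[OF assms(1-3)] deg_Nk[OF assms(1)] deg_Nk[OF assms(2)]
    by (simp add: k_graph_def factorization_property_def)
  then have "(\<mu>, \<nu>) = (\<mu>', \<nu>')"
    using assms deg' by (elim ex1E) (metis (mono_tags, lifting) case_prod_conv)
  then show "\<mu> = \<mu>'" "\<nu> = \<nu>'" by auto
qed

text \<open>Both r(v) v and v s(v) factor v into two morphisms of degree 0, so uniqueness forces
  r(v) = v = s(v).\<close>

lemma deg_zero_vertex:
  assumes "v \<in> Mor \<Lambda>" "deg \<Lambda> v = deg_zero"
  shows "v \<in> vertices \<Lambda>"
proof -
  note c = cmp_cancel[of "rng \<Lambda> v" v v "src \<Lambda> v", OF _ assms(1) _ assms(1)]
  have "rng \<Lambda> v = v" by (rule c(1)) (use assms deg_vertex[of "rng \<Lambda> v"] in auto)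
  moreover have "v = src \<Lambda> v" by (rule c(2)) (use assms deg_vertex[of "rng \<Lambda> v"] in auto)
  ultimately show ?thesis using assms by (auto simp: vertices_def)
qed

lemma paths_of_degree_zero: "paths_of_degree \<Lambda> deg_zero = vertices \<Lambda>"
  using deg_zero_vertex deg_vertex vertexD by (auto simp: paths_of_degree_def)

lemma path_vertex:
  assumes "x \<in> infinite_paths k \<Lambda>" "p \<in> Nk k"
  shows "x (p, p) \<in> vertices \<Lambda>"
  using path_segment[OF assms(1) assms(2) assms(2)] by (auto intro: deg_zero_vertex)

text \<open>Unique factorization is applied twice, first to cut off at q and then at p.\<close>

lemma path_segment_determined:
  assumes x: "x \<in> infinite_paths k \<Lambda>" and y: "y \<in> infinite_paths k \<Lambda>"
    and N: "p \<in> Nk k" "q \<in> Nk k" "r \<in> Nk k" "p \<le> q" "q \<le> r" and eq: "x (deg_zero, r) = y (deg_zero, r)"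
  shows "x (p, q) = y (p, q)"
proof -
  have *: "x (a, b) = y (a, b) \<and> x (b, c) = y (b, c)"
    if "a \<in> Nk k" "b \<in> Nk k" "c \<in> Nk k" "a \<le> b" "b \<le> c" "x (a, c) = y (a, c)" for a b c
    using cmp_cancel[of "x (a, b)" "x (b, c)" "y (a, b)" "y (b, c)"] that
      path_segment[OF x, of a b] path_segment[OF x, of b c] path_segment[OF y, of a b] path_segment[OF y, of b c]
      path_cmp[OF x, of a b c] path_cmp[OF y, of a b c] by auto
  have "x (deg_zero, q) = y (deg_zero, q)" using *[of deg_zero q r] N eq by auto
  then show ?thesis using *[of deg_zero p q] N by auto
qed

lemma cylinderD:
  assumes "x \<in> cylinder k \<Lambda> \<eta>"
  shows "x \<in> infinite_paths k \<Lambda>" "x (deg_zero, deg \<Lambda> \<eta>) = \<eta>"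
  using assms by (auto simp: cylinder_def)

lemma cylinder_vertex:
  assumes "v \<in> vertices \<Lambda>"
  shows "cylinder k \<Lambda> v = {x \<in> infinite_paths k \<Lambda>. x (deg_zero, deg_zero) = v}"
  using assms by (auto simp: cylinder_def deg_vertex)

lemma cylinder_src:
  assumes "x \<in> cylinder k \<Lambda> \<eta>" "\<eta> \<in> Mor \<Lambda>"
  shows "x (deg \<Lambda> \<eta>, deg \<Lambda> \<eta>) = src \<Lambda> \<eta>"
  using path_segment(4)[OF cylinderD(1)[OF assms(1)], of deg_zero "deg \<Lambda> \<eta>"] cylinderD[OF assms(1)] assms(2) by simp

lemma mem_cylinder_initial:
  assumes "x \<in> infinite_paths k \<Lambda>" "n \<in> Nk k"
  shows "x \<in> cylinder k \<Lambda> (x (deg_zero, n))" "x (deg_zero, n) \<in> paths_of_degree \<Lambda> n"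
  using path_segment[OF assms(1), of deg_zero n] assms by (auto simp: cylinder_def paths_of_degree_def)

lemma cylinder_disjoint:
  assumes "\<mu> \<in> paths_of_degree \<Lambda> n" "\<nu> \<in> paths_of_degree \<Lambda> n" "\<mu> \<noteq> \<nu>"
  shows "cylinder k \<Lambda> \<mu> \<inter> cylinder k \<Lambda> \<nu> = {}"
  using assms by (auto simp: cylinder_def paths_of_degree_def)

lemma infinite_paths_eq_UN:
  assumes "n \<in> Nk k"
  shows "infinite_paths k \<Lambda> = (\<Union>\<eta>\<in>paths_of_degree \<Lambda> n. cylinder k \<Lambda> \<eta>)"
  using mem_cylinder_initial[OF _ assms] cylinderD(1) by blast

section \<open>Counting paths of a given degree\<close>

definition paths_from :: "(nat \<Rightarrow> nat) \<Rightarrow> 'a \<Rightarrow> 'a set" where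
  "paths_from n v = {\<eta> \<in> paths_of_degree \<Lambda> n. rng \<Lambda> \<eta> = v}"

lemma paths_from_iff: "\<eta> \<in> paths_from n v \<longleftrightarrow> \<eta> \<in> Mor \<Lambda> \<and> deg \<Lambda> \<eta> = n \<and> rng \<Lambda> \<eta> = v"
  by (auto simp: paths_from_def paths_of_degree_def)

lemma paths_from_zero:
  assumes "v \<in> vertices \<Lambda>"
  shows "paths_from deg_zero v = {v}"
proof (intro equalityI subsetI)
  fix \<eta> assume "\<eta> \<in> paths_from deg_zero v"
  then have \<eta>: "\<eta> \<in> Mor \<Lambda>" "deg \<Lambda> \<eta> = deg_zero" "rng \<Lambda> \<eta> = v" by (auto simp: paths_from_iff)
  have "rng \<Lambda> \<eta> = \<eta>" by (rule vertexD(2)[OF deg_zero_vertex[OF \<eta>(1,2)]])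
  then show "\<eta> \<in> {v}" using \<eta>(3) by simp
next
  fix \<eta> assume "\<eta> \<in> {v}"
  then show "\<eta> \<in> paths_from deg_zero v"
    using vertexD(1,2)[OF assms] deg_vertex[OF assms] unfolding paths_from_iff by blast
qed

lemma cylinder_vertex_eq_UN:
  assumes "v \<in> vertices \<Lambda>" "n \<in> Nk k"
  shows "cylinder k \<Lambda> v = (\<Union>\<eta>\<in>paths_from n v. cylinder k \<Lambda> \<eta>)"
proof -
  have *: "x \<in> cylinder k \<Lambda> v \<longleftrightarrow> rng \<Lambda> \<eta> = v" if "x \<in> cylinder k \<Lambda> \<eta>" "\<eta> \<in> paths_of_degree \<Lambda> n" for x \<eta>
    using that cylinderD[OF that(1)] path_segment(3)[OF cylinderD(1)[OF that(1)] deg_zero_Nk assms(2)]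
    unfolding cylinder_vertex[OF assms(1)] by (simp add: paths_of_degree_def)
  have "\<exists>\<eta>\<in>paths_of_degree \<Lambda> n. x \<in> cylinder k \<Lambda> \<eta>" if "x \<in> cylinder k \<Lambda> v" for x
    using mem_cylinder_initial[OF cylinderD(1)[OF that] assms(2)] by blast
  note ex = this
  show ?thesis
  proof (intro equalityI subsetI)
    fix x assume x: "x \<in> cylinder k \<Lambda> v"
    then obtain \<eta> where \<eta>: "\<eta> \<in> paths_of_degree \<Lambda> n" "x \<in> cylinder k \<Lambda> \<eta>" using ex by auto
    then have "\<eta> \<in> paths_from n v" using x *[OF \<eta>(2,1)] by (simp add: paths_from_def)
    with \<eta>(2) show "x \<in> (\<Union>\<eta>\<in>paths_from n v. cylinder k \<Lambda> \<eta>)" by (rule UN_I[rotated])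
  next
    fix x assume "x \<in> (\<Union>\<eta>\<in>paths_from n v. cylinder k \<Lambda> \<eta>)"
    then obtain \<eta> where \<eta>: "\<eta> \<in> paths_from n v" "x \<in> cylinder k \<Lambda> \<eta>" by (rule UN_E)
    then show "x \<in> cylinder k \<Lambda> v" using *[OF \<eta>(2)] by (simp add: paths_from_def)
  qed
qed

lemma cylinder_cmp:
  assumes "\<mu> \<in> Mor \<Lambda>" "\<nu> \<in> Mor \<Lambda>" "src \<Lambda> \<mu> = rng \<Lambda> \<nu>" "x \<in> cylinder k \<Lambda> (cmp \<Lambda> \<mu> \<nu>)"
  shows "x \<in> cylinder k \<Lambda> \<mu>" "path_shift k (deg \<Lambda> \<mu>) x \<in> cylinder k \<Lambda> \<nu>"
proof -
  note x = cylinderD[OF assms(4)]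
  let ?m = "deg \<Lambda> \<mu>" let ?n = "deg \<Lambda> \<nu>"
  have Nk: "?m \<in> Nk k" "?n \<in> Nk k" "?m \<boxplus> ?n \<in> Nk k" using assms by auto
  have "cmp \<Lambda> (x (deg_zero, ?m)) (x (?m, ?m \<boxplus> ?n)) = cmp \<Lambda> \<mu> \<nu>"
    using path_cmp[OF x(1), of deg_zero ?m "?m \<boxplus> ?n"] x(2) assms Nk by simp
  then have "x (deg_zero, ?m) = \<mu>" "x (?m, ?m \<boxplus> ?n) = \<nu>"
    using cmp_cancel[of "x (deg_zero, ?m)" "x (?m, ?m \<boxplus> ?n)" \<mu> \<nu>] assms(1-3) Nk
      path_segment[OF x(1), of deg_zero ?m] path_segment[OF x(1), of ?m "?m \<boxplus> ?n"] by auto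
  then show "x \<in> cylinder k \<Lambda> \<mu>" "path_shift k (deg \<Lambda> \<mu>) x \<in> cylinder k \<Lambda> \<nu>"
    using x path_shift_infinite_paths[OF x(1) Nk(1)] Nk
    by (auto simp: cylinder_def path_shift_apply add.commute)
qed

lemma path_shift_cylinder_src:
  assumes "\<eta> \<in> Mor \<Lambda>" "x \<in> cylinder k \<Lambda> \<eta>"
  shows "path_shift k (deg \<Lambda> \<eta>) x \<in> cylinder k \<Lambda> (src \<Lambda> \<eta>)"
  using cylinder_cmp(2)[of \<eta> "src \<Lambda> \<eta>" x] assms by simp

text \<open>The matrix of degree n acting on functions of the vertices, written as a sum over paths
  rather than as a product of vertex matrices. Multiplicativity in n is then unique
  factorization.\<close>

definition transfer :: "(nat \<Rightarrow> nat) \<Rightarrow> ('a \<Rightarrow> real) \<Rightarrow> 'a \<Rightarrow> real" where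
  "transfer n g v = (\<Sum>\<eta>\<in>paths_from n v. g (src \<Lambda> \<eta>))"

lemma transfer_zero: "v \<in> vertices \<Lambda> \<Longrightarrow> transfer deg_zero g v = g v"
  by (simp add: transfer_def paths_from_zero vertexD)

lemma bij_betw_paths_from_add:
  assumes "m \<in> Nk k" "n \<in> Nk k"
  shows "bij_betw (\<lambda>(\<mu>, \<nu>). cmp \<Lambda> \<mu> \<nu>) (SIGMA \<mu>:paths_from m v. paths_from n (src \<Lambda> \<mu>)) (paths_from (m \<boxplus> n) v)"
  unfolding bij_betw_def
proof
  show "inj_on (\<lambda>(\<mu>, \<nu>). cmp \<Lambda> \<mu> \<nu>) (SIGMA \<mu>:paths_from m v. paths_from n (src \<Lambda> \<mu>))"
  proof (rule inj_onI, clarsimp)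
    fix \<mu> \<nu> \<mu>' \<nu>'
    assume "\<mu> \<in> paths_from m v" "\<nu> \<in> paths_from n (src \<Lambda> \<mu>)" "\<mu>' \<in> paths_from m v"
      "\<nu>' \<in> paths_from n (src \<Lambda> \<mu>')" "cmp \<Lambda> \<mu> \<nu> = cmp \<Lambda> \<mu>' \<nu>'"
    then show "\<mu> = \<mu>' \<and> \<nu> = \<nu>'"
      using cmp_cancel[of \<mu> \<nu> \<mu>' \<nu>'] unfolding paths_from_iff by metis
  qed
  show "(\<lambda>(\<mu>, \<nu>). cmp \<Lambda> \<mu> \<nu>) ` (SIGMA \<mu>:paths_from m v. paths_from n (src \<Lambda> \<mu>)) = paths_from (m \<boxplus> n) v"
  proof (intro equalityI subsetI)
    fix \<eta> assume "\<eta> \<in> (\<lambda>(\<mu>, \<nu>). cmp \<Lambda> \<mu> \<nu>) ` (SIGMA \<mu>:paths_from m v. paths_from n (src \<Lambda> \<mu>))"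
    then show "\<eta> \<in> paths_from (m \<boxplus> n) v" by (auto simp: paths_from_iff)
  next
    fix \<eta> assume "\<eta> \<in> paths_from (m \<boxplus> n) v"
    then have \<eta>: "\<eta> \<in> Mor \<Lambda>" "deg \<Lambda> \<eta> = m \<boxplus> n" "rng \<Lambda> \<eta> = v" by (auto simp: paths_from_iff)
    obtain \<mu> \<nu> where f: "\<mu> \<in> Mor \<Lambda>" "\<nu> \<in> Mor \<Lambda>" "src \<Lambda> \<mu> = rng \<Lambda> \<nu>" "\<eta> = cmp \<Lambda> \<mu> \<nu>"
      "deg \<Lambda> \<mu> = m" "deg \<Lambda> \<nu> = n"
      using factorization[OF \<eta>(1) assms \<eta>(2)] by blast
    then show "\<eta> \<in> (\<lambda>(\<mu>, \<nu>). cmp \<Lambda> \<mu> \<nu>) ` (SIGMA \<mu>:paths_from m v. paths_from n (src \<Lambda> \<mu>))"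
      using \<eta>(3) by (intro image_eqI[of _ _ "(\<mu>, \<nu>)"]) (auto simp: paths_from_iff)
  qed
qed

end

locale finite_k_graph = kgraph +
  assumes finite: "finite_kgraph k \<Lambda>"
begin

lemma finite_paths_of_degree: "n \<in> Nk k \<Longrightarrow> finite (paths_of_degree \<Lambda> n)"
  using finite by (simp add: finite_kgraph_def)

lemma finite_paths_from [simp]: "n \<in> Nk k \<Longrightarrow> finite (paths_from n v)"
  by (simp add: paths_from_def finite_paths_of_degree)

lemma finite_vertices [simp]: "finite (vertices \<Lambda>)"
  using finite_paths_of_degree[OF deg_zero_Nk] by (simp add: paths_of_degree_zero)

lemma transfer_add:
  assumes "m \<in> Nk k" "n \<in> Nk k"
  shows "transfer (m \<boxplus> n) g v = transfer m (transfer n g) v"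
proof -
  have "transfer (m \<boxplus> n) g v = (\<Sum>(\<mu>, \<nu>)\<in>(SIGMA \<mu>:paths_from m v. paths_from n (src \<Lambda> \<mu>)). g (src \<Lambda> (cmp \<Lambda> \<mu> \<nu>)))"
    unfolding transfer_def by (subst sum.reindex_bij_betw[OF bij_betw_paths_from_add[OF assms], symmetric]) (simp add: case_prod_beta)
  also have "\<dots> = (\<Sum>(\<mu>, \<nu>)\<in>(SIGMA \<mu>:paths_from m v. paths_from n (src \<Lambda> \<mu>)). g (src \<Lambda> \<nu>))"
    by (intro sum.cong) (auto simp: paths_from_iff)
  also have "\<dots> = transfer m (transfer n g) v"
    unfolding transfer_def by (rule sum.Sigma[symmetric]) (use assms in auto)
  finally show ?thesis .
qed

end

text \<open>The hypothesis says that failing to lie in C is visible in finitely many coordinates;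
  fixing these gives an open neighbourhood that misses C.\<close>

lemma closedin_product_discrete:
  assumes "C \<subseteq> PiE I F"
    and "\<And>x. x \<in> PiE I F \<Longrightarrow> x \<notin> C \<Longrightarrow>
      \<exists>J. finite J \<and> J \<subseteq> I \<and> (\<forall>y\<in>PiE I F. (\<forall>j\<in>J. y j = x j) \<longrightarrow> y \<notin> C)"
  shows "closedin (product_topology (\<lambda>i. discrete_topology (F i)) I) C"
proof -
  let ?P = "product_topology (\<lambda>i. discrete_topology (F i)) I"
  have "openin ?P (PiE I F - C)"
  proof (subst openin_subopen, intro ballI)
    fix x assume x: "x \<in> PiE I F - C"
    have "\<exists>J. finite J \<and> J \<subseteq> I \<and> (\<forall>y\<in>PiE I F. (\<forall>j\<in>J. y j = x j) \<longrightarrow> y \<notin> C)"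
      by (rule assms(2)) (use x in auto)
    then obtain J where J: "finite J" "J \<subseteq> I" "\<forall>y\<in>PiE I F. (\<forall>j\<in>J. y j = x j) \<longrightarrow> y \<notin> C"
      by (elim exE conjE)
    define U where "U i = (if i \<in> J then {x i} else F i)" for i
    have UF: "U i \<subseteq> F i" if "i \<in> I" for i using x that by (auto simp: U_def PiE_iff)
    have "{i \<in> I. U i \<noteq> topspace (discrete_topology (F i))} \<subseteq> J" by (auto simp: U_def)
    then have "openin ?P (PiE I U)"
      unfolding openin_PiE_gen using UF finite_subset[OF _ J(1)] by auto
    moreover have "x \<in> PiE I U" using x by (auto simp: U_def PiE_iff)
    moreover have "PiE I U \<subseteq> PiE I F - C"
    proof
      fix y assume y: "y \<in> PiE I U"
      then have "y \<in> PiE I F" using UF by (auto simp: PiE_iff)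
      moreover have "\<forall>j\<in>J. y j = x j" using y J(2) by (auto simp: PiE_iff U_def split: if_splits)
      ultimately show "y \<in> PiE I F - C" using J(3) by blast
    qed
    ultimately show "\<exists>T. openin ?P T \<and> x \<in> T \<and> T \<subseteq> PiE I F - C" by blast
  qed
  then show ?thesis using assms(1) by (simp add: closedin_def)
qed

section \<open>Compactness of cylinders\<close>

context finite_k_graph
begin

text \<open>An ambient product of finite discrete sets, compact by Tychonoff, that contains the
  infinite paths. It is a tool for compactness and is distinct from
  \<open>path_topology\<close>.\<close>

abbreviation path_space :: "((nat \<Rightarrow> nat) \<times> (nat \<Rightarrow> nat) \<Rightarrow> 'a) topology" where
  "path_space \<equiv> product_topology (\<lambda>e. discrete_topology (paths_of_degree \<Lambda> (deg (Omega k) e))) (Mor (Omega k))"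

lemma compact_space_path_space: "compact_space path_space"
  unfolding compact_space_product_topology
  by (rule disjI2) (auto simp: compact_space_discrete_topology intro!: finite_paths_of_degree)

lemma infinite_paths_subset_PiE:
  "infinite_paths k \<Lambda> \<subseteq> (\<Pi>\<^sub>E e\<in>Mor (Omega k). paths_of_degree \<Lambda> (deg (Omega k) e))"
proof
  fix x assume "x \<in> infinite_paths k \<Lambda>"
  then show "x \<in> (\<Pi>\<^sub>E e\<in>Mor (Omega k). paths_of_degree \<Lambda> (deg (Omega k) e))"
    unfolding PiE_def infinite_paths_iff by (intro IntI) (auto simp: paths_of_degree_def)
qed

text \<open>A point of the product lies outside the cylinder because of a wrong initial segment, a
  wrong end vertex or a violated composition, and each of these involves at most three
  coordinates.\<close>

lemma closedin_cylinder:
  assumes "\<eta> \<in> Mor \<Lambda>"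
  shows "closedin path_space (cylinder k \<Lambda> \<eta>)"
proof (rule closedin_product_discrete)
  show "cylinder k \<Lambda> \<eta> \<subseteq> (\<Pi>\<^sub>E e\<in>Mor (Omega k). paths_of_degree \<Lambda> (deg (Omega k) e))"
    using infinite_paths_subset_PiE by (auto simp: cylinder_def)
  fix x assume x: "x \<in> (\<Pi>\<^sub>E e\<in>Mor (Omega k). paths_of_degree \<Lambda> (deg (Omega k) e))" and "x \<notin> cylinder k \<Lambda> \<eta>"
  have xp: "x (p, q) \<in> Mor \<Lambda>" "deg \<Lambda> (x (p, q)) = (\<lambda>i. q i - p i)" if "p \<in> Nk k" "q \<in> Nk k" "p \<le> q" for p q
    using x that by (auto simp: PiE_iff paths_of_degree_def)
  have "x \<in> extensional (Mor (Omega k))" using x by (simp add: PiE_iff)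
  with \<open>x \<notin> cylinder k \<Lambda> \<eta>\<close> consider
    "x (deg_zero, deg \<Lambda> \<eta>) \<noteq> \<eta>"
    | p q where "p \<in> Nk k" "q \<in> Nk k" "p \<le> q" "\<not> (rng \<Lambda> (x (p, q)) = x (p, p) \<and> src \<Lambda> (x (p, q)) = x (q, q))"
    | p q r where "p \<in> Nk k" "q \<in> Nk k" "r \<in> Nk k" "p \<le> q" "q \<le> r"
      "x (p, r) \<noteq> cmp \<Lambda> (x (p, q)) (x (q, r))"
    unfolding cylinder_def infinite_paths_iff using xp by blast
  then show "\<exists>J. finite J \<and> J \<subseteq> Mor (Omega k) \<and>
    (\<forall>y\<in>\<Pi>\<^sub>E e\<in>Mor (Omega k). paths_of_degree \<Lambda> (deg (Omega k) e). (\<forall>j\<in>J. y j = x j) \<longrightarrow> y \<notin> cylinder k \<Lambda> \<eta>)"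
  proof cases
    case 1
    then show ?thesis
      using assms by (intro exI[of _ "{(deg_zero, deg \<Lambda> \<eta>)}"]) (auto simp: cylinder_def)
  next
    case 2
    have "y \<notin> cylinder k \<Lambda> \<eta>" if "\<forall>j\<in>{(p, q), (p, p), (q, q)}. y j = x j" for y
    proof
      assume "y \<in> cylinder k \<Lambda> \<eta>"
      then have "rng \<Lambda> (y (p, q)) = y (p, p)" "src \<Lambda> (y (p, q)) = y (q, q)"
        by (intro path_segment(3,4)[OF cylinderD(1)] 2(1-3); assumption)+
      then show False using that 2(4) by simp
    qed
    then show ?thesis using 2(1-3)
      by (intro exI[of _ "{(p, q), (p, p), (q, q)}"]) simp
  next
    case 3
    have "p \<le> r" using 3 by simp
    have "y \<notin> cylinder k \<Lambda> \<eta>" if "\<forall>j\<in>{(p, r), (p, q), (q, r)}. y j = x j" for y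
    proof
      assume "y \<in> cylinder k \<Lambda> \<eta>"
      then have "cmp \<Lambda> (y (p, q)) (y (q, r)) = y (p, r)"
        by (intro path_cmp[OF cylinderD(1)] 3(1-5))
      then show False using that 3 by simp
    qed
    then show ?thesis using 3 \<open>p \<le> r\<close>
      by (intro exI[of _ "{(p, r), (p, q), (q, r)}"]) simp
  qed
qed

lemma compactin_cylinder: "\<eta> \<in> Mor \<Lambda> \<Longrightarrow> compactin path_space (cylinder k \<Lambda> \<eta>)"
  by (rule closedin_compact_space[OF compact_space_path_space closedin_cylinder])

end

section \<open>The corners of an infinite path\<close>

definition diag_deg :: "nat \<Rightarrow> nat \<Rightarrow> nat \<Rightarrow> nat" where
  "diag_deg k n = (\<lambda>i. if i \<in> {1..k} then n else 0)"

text \<open>The \<open>m\<close>-th corner has \<open>i\<close>-th entry the number of \<open>j < m\<close> with \<open>j mod k = i - 1\<close>.\<close>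

definition corner :: "nat \<Rightarrow> nat \<Rightarrow> nat \<Rightarrow> nat" where
  "corner k m = (\<lambda>i. if i \<in> {1..k} then (m + (k - i)) div k else 0)"

lemma diag_deg_Nk [simp]: "diag_deg k n \<in> Nk k"
  by (simp add: diag_deg_def Nk_def)

lemma diag_deg_add: "diag_deg k m \<boxplus> diag_deg k n = diag_deg k (m + n)"
  by (auto simp: diag_deg_def)

lemma corner_Nk [simp]: "corner k m \<in> Nk k"
  by (simp add: corner_def Nk_def)

lemma corner_mono [simp]: "m \<le> n \<Longrightarrow> corner k m \<le> corner k n"
  by (auto simp: corner_def le_fun_def intro!: div_le_mono)

text \<open>A block of k digits is one diagonal step; hence shifting a path by (n,...,n) drops
  exactly kn digits.\<close>

lemma corner_add: "corner k (m + k * n) = corner k m \<boxplus> diag_deg k n"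
proof
  fix i
  have "(m + k * n + (k - i)) div k = (m + (k - i)) div k + n" if "i \<in> {1..k}"
  proof -
    have "m + k * n + (k - i) = (m + (k - i)) + n * k" by simp
    moreover have "((m + (k - i)) + n * k) div k = n + (m + (k - i)) div k"
      using that by (intro div_mult_self1) auto
    ultimately show ?thesis by (simp only: add.commute)
  qed
  then show "corner k (m + k * n) i = (corner k m \<boxplus> diag_deg k n) i"
    by (simp add: corner_def diag_deg_def)
qed

lemma corner_0: "corner k 0 = deg_zero"
  by (auto simp: corner_def)

lemma corner_mult: "corner k (k * n) = diag_deg k n"
  using corner_add[of k 0 n] by (simp add: corner_0)

text \<open>The factor f_ij has the zero-based position m with i = m mod k + 1 and j = m div k +
  1.\<close>

lemma corner_eq_path_corner:
  "path_corner k (m mod k + 1) (m div k + 1) = corner k m"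
proof
  fix i
  have "m div k + (if i < m mod k + 1 then 1 else 0) = (m + (k - i)) div k" if i: "i \<in> {1..k}"
  proof -
    have "m + (k - i) = (m mod k + (k - i)) + (m div k) * k" by simp
    then have "(m + (k - i)) div k = ((m mod k + (k - i)) + (m div k) * k) div k" by (rule arg_cong)
    also have "\<dots> = m div k + (m mod k + (k - i)) div k" using i by (intro div_mult_self1) auto
    \<comment> \<open>Within the current block the edge of colour i has already been passed exactly
      when i \<le> m mod k.\<close>
    also have "(m mod k + (k - i)) div k = (if i < m mod k + 1 then 1 else 0)"
    proof (cases "i < m mod k + 1")
      case True
      have "m mod k < k" using i by simp
      then have "k * 1 \<le> m mod k + (k - i)" "m mod k + (k - i) < k * Suc 1" using True i by auto
      then have "(m mod k + (k - i)) div k = 1" by (rule div_nat_eqI)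
      then show ?thesis using True by simp
    next
      case False
      then have "m mod k + (k - i) < k" using i by auto
      then show ?thesis using False by simp
    qed
    finally show ?thesis by simp
  qed
  then show "path_corner k (m mod k + 1) (m div k + 1) i = corner k m i"
    by (simp add: path_corner_def corner_def)
qed

lemma corner_Suc:
  assumes "k \<ge> 1"
  shows "corner k (Suc m) = corner k m \<boxplus> unit_deg (m mod k + 1)"
proof
  fix i
  obtain r where r: "m mod k = r" "r < k" using assms by simp
  show "corner k (Suc m) i = (corner k m \<boxplus> unit_deg (m mod k + 1)) i"
    unfolding corner_eq_path_corner[symmetric]
    using r by (auto simp: path_corner_def unit_deg_def mod_Suc div_Suc)
qed

section \<open>The digit sequence of an infinite path\<close>

locale labelled_k_graph = finite_k_graph +
  fixes l :: "'a \<Rightarrow> nat"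
  assumes k1: "k \<ge> 1" and labelling: "vertex_labelling \<Lambda> l" and ne: "vertices \<Lambda> \<noteq> {}"
begin

abbreviation "N \<equiv> card (vertices \<Lambda>)"

lemma N_ge_1: "N \<ge> 1"
  using ne by (simp add: Suc_le_eq card_gt_0_iff)

lemma label_less: "v \<in> vertices \<Lambda> \<Longrightarrow> l v < N"
  using labelling unfolding vertex_labelling_def bij_betw_def by auto

lemma inj_label: "inj_on l (vertices \<Lambda>)"
  using labelling unfolding vertex_labelling_def bij_betw_def by auto

lemma bij_vertex_of: "bij_betw (vertex_of \<Lambda> l) {..<N} (vertices \<Lambda>)"
  using bij_betw_inv_into[of l "vertices \<Lambda>" "{0..<N}"] labelling
  by (simp add: vertex_of_def vertex_labelling_def lessThan_atLeast0)

lemma vertex_of_vertex: "a < N \<Longrightarrow> vertex_of \<Lambda> l a \<in> vertices \<Lambda>"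
  using bij_vertex_of by (auto simp: bij_betw_def)

lemma vertex_of_label: "v \<in> vertices \<Lambda> \<Longrightarrow> vertex_of \<Lambda> l (l v) = v"
  using inj_label by (simp add: vertex_of_def)

text \<open>The labels v_11, v_21, ... read as one zero-based sequence. The vertex at a corner is
  used in place of the range of f_ij; the two coincide.\<close>

definition path_digit :: "((nat \<Rightarrow> nat) \<times> (nat \<Rightarrow> nat) \<Rightarrow> 'a) \<Rightarrow> nat \<Rightarrow> nat" where
  "path_digit x m = l (x (corner k m, corner k m))"

lemma path_digit_less: "x \<in> infinite_paths k \<Lambda> \<Longrightarrow> path_digit x m < N"
  unfolding path_digit_def by (intro label_less path_vertex) auto

lemma bij_betw_digit_position:
  "bij_betw (\<lambda>m. (m mod k + 1, m div k + 1)) UNIV ({1..k} \<times> {1..})"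
proof (rule bij_betw_byWitness[where f' = "\<lambda>(i, j). (i - 1) + k * (j - 1)"])
  show "\<forall>b\<in>{1..k} \<times> {1..}. (\<lambda>m. (m mod k + 1, m div k + 1)) ((\<lambda>(i, j). i - 1 + k * (j - 1)) b) = b"
  proof
    fix b assume "b \<in> {1..k} \<times> {1::nat..}"
    then obtain i j where b: "b = (Suc i, Suc j)" "i < k"
      by (cases b) (auto simp: Suc_le_eq gr0_conv_Suc)
    then have "(i + k * j) mod k = i" "(i + k * j) div k = j" by auto
    with b show "(\<lambda>m. (m mod k + 1, m div k + 1)) ((\<lambda>(i, j). i - 1 + k * (j - 1)) b) = b" by simp
  qed
  show "range (\<lambda>m. (m mod k + 1, m div k + 1)) \<subseteq> {1..k} \<times> {1..}"
    using k1 by (auto simp: Suc_le_eq)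
qed auto

text \<open>\<open>Psi\<close> is an unordered sum over pairs (i, j); since the series of digits
  converges absolutely, it may be summed along m = (i - 1) + k(j - 1).\<close>

lemma Psi_eq_base_sum:
  assumes x: "x \<in> infinite_paths k \<Lambda>"
  shows "Psi k \<Lambda> l x = base_sum N (path_digit x)"
proof -
  let ?f = "\<lambda>(i, j). real (l (rng \<Lambda> (path_factor k x i j))) / real N ^ (i + k * (j - 1))"
  have f: "?f (m mod k + 1, m div k + 1) = real (path_digit x m) / real N ^ Suc m" for m
  proof -
    have "rng \<Lambda> (path_factor k x (m mod k + 1) (m div k + 1)) = x (corner k m, corner k m)"
      unfolding path_factor_def corner_eq_path_corner corner_Suc[OF k1, symmetric]
      using path_segment(3)[OF x, of "corner k m" "corner k (Suc m)"] by simp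
    moreover have "m mod k + 1 + k * (m div k + 1 - 1) = Suc m" by simp
    ultimately show ?thesis by (simp only: path_digit_def prod.case)
  qed
  have "Psi k \<Lambda> l x = (\<Sum>\<^sub>\<infinity>p\<in>{1..k} \<times> {1..}. ?f p)" by (simp add: Psi_def)
  also have "\<dots> = (\<Sum>\<^sub>\<infinity>m. ?f (m mod k + 1, m div k + 1))"
    by (rule infsum_reindex_bij_betw[OF bij_betw_digit_position, symmetric])
  also have "\<dots> = (\<Sum>\<^sub>\<infinity>m. real (path_digit x m) / real N ^ Suc m)"
    unfolding f by simp
  also have "\<dots> = base_sum N (path_digit x)"
  proof (rule infsumI, rule norm_summable_imp_has_sum)
    have "summable (\<lambda>m. real (path_digit x m) / real N ^ Suc m)"
      by (rule summable_digits[OF path_digit_less[OF x]])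
    then show "(\<lambda>m. real (path_digit x m) / real N ^ Suc m) sums base_sum N (path_digit x)"
      "summable (\<lambda>m. norm (real (path_digit x m) / real N ^ Suc m))"
      by (auto simp: base_sum_def summable_sums)
  qed
  finally show ?thesis .
qed

text \<open>On a cylinder \<open>Psi\<close> is the digit map, continuous on the compact ambient
  product, followed by the continuous evaluation of digits.\<close>

lemma compact_Psi_cylinder:
  assumes "\<eta> \<in> Mor \<Lambda>"
  shows "compact (Psi k \<Lambda> l ` cylinder k \<Lambda> \<eta>)"
proof -
  have "continuous_map path_space (product_topology (\<lambda>_. euclidean) UNIV) path_digit"
    unfolding continuous_map_componentwise_UNIV
  proof
    fix m
    have "continuous_map path_space (discrete_topology (paths_of_degree \<Lambda> (deg (Omega k) (corner k m, corner k m))))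
      (\<lambda>x. x (corner k m, corner k m))"
      by (rule continuous_map_product_projection) auto
    moreover have "continuous_map (discrete_topology (paths_of_degree \<Lambda> (deg (Omega k) (corner k m, corner k m)))) euclidean l"
      by simp
    ultimately have "continuous_map path_space euclidean (l \<circ> (\<lambda>x. x (corner k m, corner k m)))"
      by (rule continuous_map_compose)
    then show "continuous_map path_space euclidean (\<lambda>x. path_digit x m)"
      by (simp add: path_digit_def o_def)
  qed
  then have "compactin euclidean (path_digit ` cylinder k \<Lambda> \<eta>)"
    unfolding euclidean_product_topology by (rule image_compactin[OF compactin_cylinder[OF assms]])
  moreover have "continuous_on (path_digit ` cylinder k \<Lambda> \<eta>) (base_sum N)"
    by (rule continuous_on_subset[OF continuous_on_base_sum[OF N_ge_1]]) (auto dest: cylinderD intro: path_digit_less)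
  ultimately have "compact (base_sum N ` path_digit ` cylinder k \<Lambda> \<eta>)"
    by (simp add: compact_continuous_image)
  also have "base_sum N ` path_digit ` cylinder k \<Lambda> \<eta> = Psi k \<Lambda> l ` cylinder k \<Lambda> \<eta>"
    unfolding image_image by (intro image_cong refl Psi_eq_base_sum[symmetric] cylinderD(1))
  finally show ?thesis .
qed

end

section \<open>Perron-Frobenius data\<close>

context labelled_k_graph
begin

lemma vertex_matrix_carrier: "vertex_matrix \<Lambda> l i \<in> carrier_mat N N"
  by (simp add: vertex_matrix_def)

lemma sum_vertex_matrix:
  assumes "i \<in> {1..k}" "a < N"
  shows "(\<Sum>b<N. real (vertex_matrix \<Lambda> l i $$ (a, b)) * g (vertex_of \<Lambda> l b))
    = transfer (unit_deg i) g (vertex_of \<Lambda> l a)"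
proof -
  let ?v = "vertex_of \<Lambda> l a"
  have eq: "{\<eta> \<in> paths_from (unit_deg i) ?v. src \<Lambda> \<eta> = w} = paths_of_degree \<Lambda> (unit_deg i) \<inter> hom_set \<Lambda> ?v w" for w
    by (auto simp: paths_from_def hom_set_def paths_of_degree_def)
  have "(\<Sum>b<N. real (vertex_matrix \<Lambda> l i $$ (a, b)) * g (vertex_of \<Lambda> l b))
      = (\<Sum>b<N. real (card {\<eta> \<in> paths_from (unit_deg i) ?v. src \<Lambda> \<eta> = vertex_of \<Lambda> l b}) * g (vertex_of \<Lambda> l b))"
    using assms by (intro sum.cong) (auto simp: vertex_matrix_def eq)
  also have "\<dots> = (\<Sum>w\<in>vertices \<Lambda>. real (card {\<eta> \<in> paths_from (unit_deg i) ?v. src \<Lambda> \<eta> = w}) * g w)"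
    by (rule sum.reindex_bij_betw[OF bij_vertex_of])
  also have "\<dots> = (\<Sum>w\<in>vertices \<Lambda>. \<Sum>\<eta> | \<eta> \<in> paths_from (unit_deg i) ?v \<and> src \<Lambda> \<eta> = w. g (src \<Lambda> \<eta>))"
    by (intro sum.cong) auto
  also have "\<dots> = (\<Sum>\<eta>\<in>paths_from (unit_deg i) ?v. g (src \<Lambda> \<eta>))"
    by (rule sum.group) (use assms in \<open>auto simp: paths_from_iff\<close>)
  finally show ?thesis by (simp add: transfer_def)
qed

text \<open>Stated for an arbitrary list of colours so that the matrix product can be treated by
  induction; n counts the colours of the list.\<close>

lemma sum_foldr_vertex_matrix:
  assumes "set is \<subseteq> {1..k}" "a < N"
  defines "B \<equiv> foldr (*) (map (vertex_matrix \<Lambda> l) is) (1\<^sub>m N)"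
    and "n \<equiv> foldr (\<lambda>i d. unit_deg i \<boxplus> d) is deg_zero"
  shows "B \<in> carrier_mat N N \<and> n \<in> Nk k \<and>
    (\<Sum>b<N. real (B $$ (a, b)) * g (vertex_of \<Lambda> l b)) = transfer n g (vertex_of \<Lambda> l a)"
  using assms(1,2) unfolding B_def n_def
proof (induction "is" arbitrary: a)
  case Nil
  have "(\<Sum>b<N. real (1\<^sub>m N $$ (a, b)) * g (vertex_of \<Lambda> l b)) = (\<Sum>b<N. if b = a then g (vertex_of \<Lambda> l b) else 0)"
    using Nil by (intro sum.cong) auto
  then show ?case using Nil vertex_of_vertex by (simp add: transfer_zero)
next
  case (Cons i "is")
  let ?B = "foldr (*) (map (vertex_matrix \<Lambda> l) is) (1\<^sub>m N)"
  let ?n = "foldr (\<lambda>i d. unit_deg i \<boxplus> d) is deg_zero"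
  let ?A = "vertex_matrix \<Lambda> l i"
  have i: "i \<in> {1..k}" and IH: "?B \<in> carrier_mat N N" "?n \<in> Nk k"
    "\<And>a. a < N \<Longrightarrow> (\<Sum>b<N. real (?B $$ (a, b)) * g (vertex_of \<Lambda> l b)) = transfer ?n g (vertex_of \<Lambda> l a)"
    using Cons by auto
  have AB: "(?A * ?B) $$ (a, b) = (\<Sum>c<N. ?A $$ (a, c) * ?B $$ (c, b))" if "b < N" for b
    using IH(1) vertex_matrix_carrier[of i] that Cons.prems
    by (auto simp: scalar_prod_def lessThan_atLeast0 intro!: sum.cong)
  have "(\<Sum>b<N. real ((?A * ?B) $$ (a, b)) * g (vertex_of \<Lambda> l b))
      = (\<Sum>b<N. \<Sum>c<N. real (?A $$ (a, c)) * (real (?B $$ (c, b)) * g (vertex_of \<Lambda> l b)))"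
    by (intro sum.cong) (auto simp: AB sum_distrib_right mult.assoc)
  also have "\<dots> = (\<Sum>c<N. real (?A $$ (a, c)) * (\<Sum>b<N. real (?B $$ (c, b)) * g (vertex_of \<Lambda> l b)))"
    by (subst sum.swap) (simp add: sum_distrib_left)
  also have "\<dots> = (\<Sum>c<N. real (?A $$ (a, c)) * transfer ?n g (vertex_of \<Lambda> l c))"
    using IH(3) by (intro sum.cong) auto
  also have "\<dots> = transfer (unit_deg i) (transfer ?n g) (vertex_of \<Lambda> l a)"
    by (rule sum_vertex_matrix[OF i]) (use Cons.prems in auto)
  also have "\<dots> = transfer (unit_deg i \<boxplus> ?n) g (vertex_of \<Lambda> l a)"
    by (rule transfer_add[symmetric]) (use i IH in auto)
  finally show ?case
    using IH(1,2) vertex_matrix_carrier[of i] i by auto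
qed

lemma foldr_unit_deg: "foldr (\<lambda>i d. unit_deg i \<boxplus> d) [1..<Suc k] deg_zero = diag_deg k 1"
proof
  fix j
  have "distinct is \<Longrightarrow> foldr (\<lambda>i d. unit_deg i \<boxplus> d) is deg_zero j = (if j \<in> set is then 1 else 0)" for "is"
    by (induction "is") (auto simp: unit_deg_def)
  from this[of "[1..<Suc k]"] show "foldr (\<lambda>i d. unit_deg i \<boxplus> d) [1..<Suc k] deg_zero j = diag_deg k 1 j"
    by (auto simp: diag_deg_def simp del: upt_Suc)
qed

lemma set_colours: "set [1..<Suc k] \<subseteq> {1..k}"
  by (simp add: atLeastLessThanSuc_atLeastAtMost del: upt_Suc)

lemma product_matrix_carrier: "product_matrix k \<Lambda> l \<in> carrier_mat N N"
  using sum_foldr_vertex_matrix[of "[1..<Suc k]" 0, OF set_colours] N_ge_1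
  by (simp add: product_matrix_def del: upt_Suc)

lemma sum_product_matrix:
  assumes "a < N"
  shows "(\<Sum>b<N. real (product_matrix k \<Lambda> l $$ (a, b)) * g (vertex_of \<Lambda> l b))
    = transfer (diag_deg k 1) g (vertex_of \<Lambda> l a)"
  using sum_foldr_vertex_matrix[of "[1..<Suc k]" a g, OF set_colours assms] unfolding foldr_unit_deg product_matrix_def
  by blast

end

section \<open>Weights and eigenvalues read off from the measure\<close>

locale pf_k_graph = labelled_k_graph k \<Lambda> l
  for k and \<Lambda> :: "('a, 'b) graded_cat_scheme" and l +
  fixes M :: "((nat \<Rightarrow> nat) \<times> (nat \<Rightarrow> nat) \<Rightarrow> 'a) measure"
  assumes strongly_connected: "strongly_connected \<Lambda>"
    and zero_one: "\<forall>i\<in>{1..k}. zero_one_matrix (vertex_matrix \<Lambda> l i)"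
    and pf_unique: "\<forall>y. positive_unimodular_eigenvector (product_matrix k \<Lambda> l)
                 (rho (product_matrix k \<Lambda> l)) y \<longrightarrow> y = pf_vector k \<Lambda> l"
    and pf_measure: "perron_frobenius_measure k \<Lambda> l M"
begin

sublocale prob_space M
  using pf_measure by (simp add: perron_frobenius_measure_def)

lemma space_M: "space M = infinite_paths k \<Lambda>"
  using pf_measure by (simp add: perron_frobenius_measure_def)

definition pf_weight :: "'a \<Rightarrow> real" where
  "pf_weight v = pf_vector k \<Lambda> l $ l v"

abbreviation "scal \<equiv> rho_power k \<Lambda> l"

lemma measure_cylinder:
  "\<eta> \<in> Mor \<Lambda> \<Longrightarrow> measure M (cylinder k \<Lambda> \<eta>) = inverse (scal (deg \<Lambda> \<eta>)) * pf_weight (src \<Lambda> \<eta>)"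
  using pf_measure by (simp add: perron_frobenius_measure_def pf_weight_def)

lemma cylinder_sets [measurable]:
  assumes "\<eta> \<in> Mor \<Lambda>"
  shows "cylinder k \<Lambda> \<eta> \<in> sets M"
proof -
  have "openin (path_topology k \<Lambda>) (cylinder k \<Lambda> \<eta>)"
    using assms unfolding path_topology_def by (intro topology_generated_by_Basis) auto
  then show ?thesis
    using pf_measure by (auto simp: perron_frobenius_measure_def intro!: sigma_sets.Basic)
qed

lemma scal_add: "scal (m \<boxplus> n) = scal m * scal n"
  by (simp add: rho_power_def power_add prod.distrib)

lemma scal_zero [simp]: "scal deg_zero = 1"
  by (simp add: rho_power_def)

lemma scal_unit: "i \<in> {1..k} \<Longrightarrow> scal (unit_deg i) = rho (vertex_matrix \<Lambda> l i)"
  by (simp add: rho_power_def unit_deg_def if_distrib[of "\<lambda>n. _ ^ n"] cong: if_cong)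

lemma measure_cylinder_UN:
  assumes "finite S" "S \<subseteq> paths_of_degree \<Lambda> n"
  shows "measure M (\<Union>\<eta>\<in>S. cylinder k \<Lambda> \<eta>) = (\<Sum>\<eta>\<in>S. measure M (cylinder k \<Lambda> \<eta>))"
proof (rule finite_measure_finite_Union)
  show "cylinder k \<Lambda> ` S \<subseteq> sets M"
    using assms(2) by (auto simp: paths_of_degree_def)
  show "disjoint_family_on (cylinder k \<Lambda>) S"
    using assms(2) cylinder_disjoint unfolding disjoint_family_on_def by (meson subsetD)
qed fact

lemma measure_cylinder_degree:
  "\<eta> \<in> paths_of_degree \<Lambda> n \<Longrightarrow> measure M (cylinder k \<Lambda> \<eta>) = inverse (scal n) * pf_weight (src \<Lambda> \<eta>)"
  by (auto simp: paths_of_degree_def measure_cylinder)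

lemma sum_measure_cylinder:
  assumes "n \<in> Nk k"
  shows "(\<Sum>\<eta>\<in>paths_of_degree \<Lambda> n. inverse (scal n) * pf_weight (src \<Lambda> \<eta>)) = 1"
proof -
  have "(\<Sum>\<eta>\<in>paths_of_degree \<Lambda> n. inverse (scal n) * pf_weight (src \<Lambda> \<eta>))
      = (\<Sum>\<eta>\<in>paths_of_degree \<Lambda> n. measure M (cylinder k \<Lambda> \<eta>))"
    by (intro sum.cong) (auto simp: measure_cylinder_degree)
  also have "\<dots> = measure M (\<Union>\<eta>\<in>paths_of_degree \<Lambda> n. cylinder k \<Lambda> \<eta>)"
    by (rule measure_cylinder_UN[symmetric]) (use finite_paths_of_degree[OF assms] in auto)
  also have "\<dots> = 1"
    using prob_space by (simp add: infinite_paths_eq_UN[OF assms, symmetric] space_M)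
  finally show ?thesis .
qed

lemma scal_pos:
  assumes "n \<in> Nk k"
  shows "scal n > 0"
proof -
  \<comment> \<open>As \<open>inverse 0 = 0\<close>, a zero factor would make every cylinder of
    degree n null, although their masses add up to one.\<close>
  have "scal n \<noteq> 0"
    using sum_measure_cylinder[OF assms] by auto
  moreover have "rho (vertex_matrix \<Lambda> l i) \<ge> 0" for i
    using spectral_radius_mem_max(1)[of "map_mat of_nat (vertex_matrix \<Lambda> l i)" N] vertex_matrix_carrier[of i] N_ge_1
    by (auto simp: rho_def)
  then have "scal n \<ge> 0" unfolding rho_power_def by (intro prod_nonneg zero_le_power) auto
  ultimately show ?thesis by simp
qed

lemma measure_cylinder_vertex:
  "v \<in> vertices \<Lambda> \<Longrightarrow> measure M (cylinder k \<Lambda> v) = pf_weight v"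
  by (simp add: measure_cylinder vertexD deg_vertex)

lemma sum_pf_weight: "(\<Sum>v\<in>vertices \<Lambda>. pf_weight v) = 1"
  using sum_measure_cylinder[OF deg_zero_Nk] vertexD by (simp add: paths_of_degree_zero)

lemma pf_weight_nonneg: "v \<in> vertices \<Lambda> \<Longrightarrow> pf_weight v \<ge> 0"
  using measure_nonneg[of M "cylinder k \<Lambda> v"] by (simp add: measure_cylinder_vertex)

text \<open>The cylinder of v splits into those of the paths of degree n from v; additivity of M
  over them is the eigenvector equation.\<close>

lemma transfer_pf_weight:
  assumes "v \<in> vertices \<Lambda>" "n \<in> Nk k"
  shows "transfer n pf_weight v = scal n * pf_weight v"
proof -
  have "pf_weight v = measure M (\<Union>\<eta>\<in>paths_from n v. cylinder k \<Lambda> \<eta>)"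
    using assms by (simp add: measure_cylinder_vertex cylinder_vertex_eq_UN[symmetric])
  also have "\<dots> = (\<Sum>\<eta>\<in>paths_from n v. measure M (cylinder k \<Lambda> \<eta>))"
    by (rule measure_cylinder_UN[OF finite_paths_from[OF assms(2)]]) (auto simp: paths_from_def)
  also have "\<dots> = inverse (scal n) * transfer n pf_weight v"
    unfolding transfer_def sum_distrib_left
    by (intro sum.cong) (auto simp: paths_from_def measure_cylinder_degree)
  finally show ?thesis using scal_pos[OF assms(2)] by (simp add: field_simps)
qed

text \<open>Some weight is positive because the weights sum to one. A path from any v to such a
  vertex carries positivity to v through the eigenvector equation.\<close>

lemma pf_weight_pos:
  assumes "v \<in> vertices \<Lambda>"
  shows "pf_weight v > 0"
proof -
  obtain w where w: "w \<in> vertices \<Lambda>" "pf_weight w > 0"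
    using sum_pf_weight pf_weight_nonneg sum_nonpos[of "vertices \<Lambda>" pf_weight] by (metis not_less not_one_le_zero)
  then obtain \<eta> where \<eta>: "\<eta> \<in> Mor \<Lambda>" "rng \<Lambda> \<eta> = v" "src \<Lambda> \<eta> = w"
    using strongly_connected assms unfolding strongly_connected_def hom_set_def by blast
  have "pf_weight w \<le> transfer (deg \<Lambda> \<eta>) pf_weight v"
    unfolding transfer_def
    using member_le_sum[of \<eta> "paths_from (deg \<Lambda> \<eta>) v" "\<lambda>\<eta>. pf_weight (src \<Lambda> \<eta>)"] \<eta>
    by (auto simp: paths_from_iff pf_weight_nonneg)
  then have "scal (deg \<Lambda> \<eta>) * pf_weight v > 0"
    using w transfer_pf_weight[OF assms, of "deg \<Lambda> \<eta>"] \<eta>(1) by simp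
  then show ?thesis using scal_pos[of "deg \<Lambda> \<eta>"] \<eta>(1) by (simp add: zero_less_mult_iff)
qed

lemma cylinder_nonempty:
  assumes "\<eta> \<in> Mor \<Lambda>"
  shows "cylinder k \<Lambda> \<eta> \<noteq> {}"
proof
  assume "cylinder k \<Lambda> \<eta> = {}"
  then have "inverse (scal (deg \<Lambda> \<eta>)) * pf_weight (src \<Lambda> \<eta>) = 0"
    using measure_cylinder[OF assms] by simp
  then show False
    using scal_pos[of "deg \<Lambda> \<eta>"] pf_weight_pos[of "src \<Lambda> \<eta>"] assms by simp
qed

text \<open>The product of the rho(A_i). It is defined through \<open>scal\<close> so that cylinder
  measures are expressed in its powers directly; \<open>rho_product_matrix\<close> identifies it
  with rho(A).\<close>

definition "R = scal (diag_deg k 1)"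

lemma R_pos: "R > 0"
  unfolding R_def by (rule scal_pos) simp

lemma scal_diag: "scal (diag_deg k n) = R ^ n"
proof (induction n)
  case 0
  have "diag_deg k 0 = deg_zero" by (auto simp: diag_deg_def)
  then show ?case by simp
next
  case (Suc n)
  then show ?case using scal_add[of "diag_deg k 1" "diag_deg k n"] by (simp add: diag_deg_add R_def)
qed

lemma rho_product_matrix: "rho (product_matrix k \<Lambda> l) = R"
proof (rule rho_eqI[OF product_matrix_carrier])
  fix a assume a: "a < N"
  show "pf_weight (vertex_of \<Lambda> l a) > 0" using a by (simp add: pf_weight_pos vertex_of_vertex)
  show "(\<Sum>b<N. real (product_matrix k \<Lambda> l $$ (a, b)) * pf_weight (vertex_of \<Lambda> l b)) = R * pf_weight (vertex_of \<Lambda> l a)"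
    using a by (simp add: sum_product_matrix transfer_pf_weight vertex_of_vertex R_def)
qed (use N_ge_1 in simp)

lemma paths_from_nonempty:
  assumes "v \<in> vertices \<Lambda>" "n \<in> Nk k"
  shows "paths_from n v \<noteq> {}"
proof
  assume "paths_from n v = {}"
  then have "scal n * pf_weight v = 0"
    using transfer_pf_weight[OF assms] by (simp add: transfer_def)
  then show False using scal_pos[OF assms(2)] pf_weight_pos[OF assms(1)] by simp
qed

text \<open>At a vertex of least weight, a single path of degree (1,...,1) already contributes at
  least that weight to the eigenvector equation.\<close>

lemma R_ge_1: "R \<ge> 1"
proof -
  define v where "v = arg_min_on pf_weight (vertices \<Lambda>)"
  have v: "v \<in> vertices \<Lambda>" "\<And>w. w \<in> vertices \<Lambda> \<Longrightarrow> pf_weight v \<le> pf_weight w"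
    unfolding v_def using arg_min_if_finite(1)[OF finite_vertices ne] arg_min_least[OF finite_vertices ne] by auto
  obtain \<eta> where \<eta>: "\<eta> \<in> paths_from (diag_deg k 1) v" using paths_from_nonempty[OF v(1), of "diag_deg k 1"] by auto
  have "pf_weight v \<le> pf_weight (src \<Lambda> \<eta>)" using \<eta> by (intro v) (auto simp: paths_from_iff)
  also have "\<dots> \<le> transfer (diag_deg k 1) pf_weight v"
    unfolding transfer_def by (rule member_le_sum) (use \<eta> in \<open>auto simp: paths_from_iff pf_weight_nonneg\<close>)
  also have "\<dots> = R * pf_weight v" using v by (simp add: transfer_pf_weight R_def)
  finally show ?thesis using pf_weight_pos[OF v(1)] by simp
qed

lemma edge_unique:
  assumes "i \<in> {1..k}" "\<mu> \<in> paths_of_degree \<Lambda> (unit_deg i)" "\<nu> \<in> paths_of_degree \<Lambda> (unit_deg i)"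
    and "rng \<Lambda> \<mu> = rng \<Lambda> \<nu>" "src \<Lambda> \<mu> = src \<Lambda> \<nu>"
  shows "\<mu> = \<nu>"
proof -
  let ?S = "paths_of_degree \<Lambda> (unit_deg i) \<inter> hom_set \<Lambda> (rng \<Lambda> \<mu>) (src \<Lambda> \<mu>)"
  have \<mu>: "\<mu> \<in> Mor \<Lambda>" using assms by (simp add: paths_of_degree_def)
  let ?a = "l (rng \<Lambda> \<mu>)" and ?b = "l (src \<Lambda> \<mu>)"
  have ab: "?a < N" "?b < N" using \<mu> by (auto intro: label_less)
  have "vertex_matrix \<Lambda> l i $$ (?a, ?b) \<in> elements_mat (vertex_matrix \<Lambda> l i)"
    using ab vertex_matrix_carrier[of i] by (intro elements_matI) auto
  then have "vertex_matrix \<Lambda> l i $$ (?a, ?b) \<in> {0, 1}"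
    using zero_one assms(1) unfolding zero_one_matrix_def by blast
  moreover have "vertex_matrix \<Lambda> l i $$ (?a, ?b) = card ?S"
    using ab \<mu> by (simp add: vertex_matrix_def vertex_of_label)
  ultimately have "card ?S \<le> 1" by auto
  moreover have "finite ?S" using finite_paths_of_degree assms(1) by simp
  moreover have "\<mu> \<in> ?S" "\<nu> \<in> ?S" using assms by (auto simp: hom_set_def paths_of_degree_def)
  ultimately show ?thesis by (auto simp: card_le_Suc0_iff_eq)
qed

text \<open>A single vertex carries at most one edge of each colour. The case matters because
  \<open>ln (real N) = 0\<close> there.\<close>

lemma R_eq_1_if_N_eq_1:
  assumes "N = 1"
  shows "R = 1"
proof -
  obtain v where V: "vertices \<Lambda> = {v}" using assms by (auto simp: card_1_singleton_iff)
  have "scal (unit_deg i) \<le> 1" if i: "i \<in> {1..k}" for i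
  proof -
    have "\<mu> = \<nu>" if "\<mu> \<in> paths_from (unit_deg i) v" "\<nu> \<in> paths_from (unit_deg i) v" for \<mu> \<nu>
      using edge_unique[OF i, of \<mu> \<nu>] that rng_src_vertices(2)[of \<mu>] rng_src_vertices(2)[of \<nu>]
      by (auto simp: paths_from_def paths_of_degree_def V)
    then have "card (paths_from (unit_deg i) v) \<le> 1"
      using i by (auto simp: card_le_Suc0_iff_eq)
    moreover have "transfer (unit_deg i) pf_weight v = (\<Sum>\<eta>\<in>paths_from (unit_deg i) v. pf_weight v)"
      unfolding transfer_def using rng_src_vertices(2) by (intro sum.cong) (auto simp: paths_from_iff V)
    ultimately have "transfer (unit_deg i) pf_weight v \<le> 1 * pf_weight v"
      using pf_weight_nonneg[of v] V mult_right_mono[of "real (card (paths_from (unit_deg i) v))" 1 "pf_weight v"] by simp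
    then show ?thesis using transfer_pf_weight[of v "unit_deg i"] i pf_weight_pos[of v] V by simp
  qed
  then have "(\<Prod>i=1..k. rho (vertex_matrix \<Lambda> l i)) \<le> 1"
    using scal_pos unit_deg_Nk by (intro prod_le_1) (auto simp: scal_unit[symmetric] less_imp_le)
  then have "R \<le> 1" by (simp add: R_def rho_power_def diag_deg_def)
  with R_ge_1 show ?thesis by simp
qed

text \<open>Consecutive corners are joined by one edge, and an edge is determined by its end
  vertices. The m edges up to corner m have m + 1 vertices, hence the range j \<le> m.\<close>

lemma path_digits_determine:
  assumes x: "x \<in> infinite_paths k \<Lambda>" and y: "y \<in> infinite_paths k \<Lambda>"
    and eq: "\<And>j. j \<le> m \<Longrightarrow> path_digit x j = path_digit y j"
  shows "x (deg_zero, corner k m) = y (deg_zero, corner k m)"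
proof -
  have vx: "x (corner k j, corner k j) = y (corner k j, corner k j)" if "j \<le> m" for j
    using eq[OF that] inj_onD[OF inj_label] path_vertex[OF x, of "corner k j"] path_vertex[OF y, of "corner k j"]
    by (simp add: path_digit_def)
  have "j \<le> m \<Longrightarrow> x (deg_zero, corner k j) = y (deg_zero, corner k j)" for j
  proof (induction j)
    case 0
    then show ?case using vx[of 0] by (simp add: corner_0)
  next
    case (Suc j)
    let ?p = "corner k j" and ?q = "corner k (Suc j)"
    have pq: "?p \<le> ?q" by simp
    have deg: "(\<lambda>i. ?q i - ?p i) = unit_deg (j mod k + 1)" by (simp add: corner_Suc[OF k1])
    note sx = path_segment[OF x corner_Nk corner_Nk pq] and sy = path_segment[OF y corner_Nk corner_Nk pq]
    have "x (?p, ?q) = y (?p, ?q)"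
    proof (rule edge_unique)
      show "j mod k + 1 \<in> {1..k}" using k1 by (simp add: Suc_le_eq)
    qed (use sx sy deg vx[of j] vx[of "Suc j"] Suc.prems in \<open>auto simp: paths_of_degree_def\<close>)
    moreover have "x (deg_zero, ?p) = y (deg_zero, ?p)" using Suc by simp
    ultimately show ?case
      using path_cmp[OF x deg_zero_Nk corner_Nk corner_Nk _ pq] path_cmp[OF y deg_zero_Nk corner_Nk corner_Nk _ pq]
      by (metis deg_zero_le)
  qed
  then show ?thesis by simp
qed

text \<open>If the path ends up at the vertex u with label 0, then u has a loop of every colour, so
  each rho(A_i) is at least 1; their product being 1, all equal 1. The loop then exhausts the
  eigenvector equation at u, so every path from u ends at u, against strong connectivity.\<close>

lemma not_eventually_zero_digits:
  assumes R1: "R = 1" and N2: "N \<ge> 2" and x: "x \<in> infinite_paths k \<Lambda>"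
  shows "\<exists>j>m. path_digit x j \<noteq> 0"
proof (rule ccontr)
  assume "\<not> (\<exists>j>m. path_digit x j \<noteq> 0)"
  then have z: "path_digit x j = 0" if "j > m" for j using that by blast
  define u where "u = vertex_of \<Lambda> l 0"
  have u: "u \<in> vertices \<Lambda>" using N2 by (simp add: u_def vertex_of_vertex)
  have xu: "x (corner k j, corner k j) = u" if "j > m" for j
    using z[OF that] vertex_of_label[OF path_vertex[OF x corner_Nk], of j] by (simp add: path_digit_def u_def)
  have loop: "\<exists>\<eta>\<in>paths_from (unit_deg i) u. src \<Lambda> \<eta> = u" if i: "i \<in> {1..k}" for i
  proof -
    \<comment> \<open>A position beyond m at which the path takes an edge of colour i.\<close>
    define j where "j = (i - 1) + k * Suc m"
    have "m < k * Suc m" using k1 by (simp add: add_strict_increasing)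
    then have "j > m" unfolding j_def by linarith
    moreover obtain i' where "i = Suc i'" "i' < k" using i by (cases i) auto
    ultimately have j: "j > m" "j mod k + 1 = i" by (simp_all add: j_def del: mult_Suc_right)
    have "corner k j \<le> corner k (Suc j)" by simp
    note s = path_segment[OF x corner_Nk corner_Nk this]
    have "x (corner k j, corner k (Suc j)) \<in> paths_from (unit_deg i) u \<and> src \<Lambda> (x (corner k j, corner k (Suc j))) = u"
      unfolding paths_from_iff using s xu[of j] xu[of "Suc j"] j by (simp add: corner_Suc[OF k1])
    then show ?thesis by blast
  qed
  \<comment> \<open>The eigenvector equation at u with one closed path split off. Nonnegativity of
    the rest bounds the eigenvalue below by 1, and for eigenvalue 1 the rest vanishes.\<close>
  have sum_ge: "pf_weight u + (\<Sum>\<nu>\<in>paths_from n u - {\<eta>}. pf_weight (src \<Lambda> \<nu>)) = scal n * pf_weight u"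
    if "\<eta> \<in> paths_from n u" "src \<Lambda> \<eta> = u" "n \<in> Nk k" for n \<eta>
    using transfer_pf_weight[OF u that(3)] sum.remove[OF finite_paths_from[OF that(3)] that(1), of "\<lambda>\<eta>. pf_weight (src \<Lambda> \<eta>)"] that(2)
    by (simp add: transfer_def)
  have nonneg: "(\<Sum>\<nu>\<in>paths_from n u - {\<eta>}. pf_weight (src \<Lambda> \<nu>)) \<ge> 0" for n \<eta>
    by (intro sum_nonneg pf_weight_nonneg) (auto simp: paths_from_iff)
  have ge1: "rho (vertex_matrix \<Lambda> l i) \<ge> 1" if i: "i \<in> {1..k}" for i
  proof -
    obtain \<eta> where "\<eta> \<in> paths_from (unit_deg i) u" "src \<Lambda> \<eta> = u" using loop[OF i] by blast
    from sum_ge[OF this] have "pf_weight u \<le> scal (unit_deg i) * pf_weight u"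
      using nonneg[of "unit_deg i" \<eta>] i by simp
    then show ?thesis using pf_weight_pos[OF u] i by (simp add: scal_unit)
  qed
  have eq1: "rho (vertex_matrix \<Lambda> l i) = 1" if i: "i \<in> {1..k}" for i
  proof -
    have "rho (vertex_matrix \<Lambda> l i) \<le> (\<Prod>i=1..k. rho (vertex_matrix \<Lambda> l i))"
      using prod_ge_1[of "{1..k} - {i}" "\<lambda>i. rho (vertex_matrix \<Lambda> l i)"] ge1 ge1[OF i] prod.remove[OF finite_atLeastAtMost i, of "\<lambda>i. rho (vertex_matrix \<Lambda> l i)"]
      by (simp add: mult_le_cancel_left1)
    also have "\<dots> = 1" using R1 by (simp add: R_def rho_power_def diag_deg_def)
    finally show ?thesis using ge1[OF i] by simp
  qed
  have src_u: "src \<Lambda> \<nu> = u" if i: "i \<in> {1..k}" and \<nu>: "\<nu> \<in> paths_from (unit_deg i) u" for i \<nu>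
  proof (rule ccontr)
    assume "src \<Lambda> \<nu> \<noteq> u"
    obtain \<eta> where \<eta>: "\<eta> \<in> paths_from (unit_deg i) u" "src \<Lambda> \<eta> = u" using loop[OF i] by blast
    have "(\<Sum>\<nu>\<in>paths_from (unit_deg i) u - {\<eta>}. pf_weight (src \<Lambda> \<nu>)) = 0"
      using sum_ge[OF \<eta>] i eq1[OF i] by (simp add: scal_unit)
    moreover have "\<nu> \<in> paths_from (unit_deg i) u - {\<eta>}" using \<nu> \<eta> \<open>src \<Lambda> \<nu> \<noteq> u\<close> by auto
    then have "pf_weight (src \<Lambda> \<nu>) \<le> (\<Sum>\<nu>\<in>paths_from (unit_deg i) u - {\<eta>}. pf_weight (src \<Lambda> \<nu>))"
      by (rule member_le_sum) (use i in \<open>auto simp: paths_from_iff pf_weight_nonneg\<close>)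
    ultimately show False using pf_weight_pos[of "src \<Lambda> \<nu>"] \<nu> by (auto simp: paths_from_iff)
  qed
  \<comment> \<open>Induction on the total degree: a first edge is split off, and by
    \<open>src_u\<close> it returns to u.\<close>
  have stays: "\<eta> \<in> paths_from n u \<Longrightarrow> src \<Lambda> \<eta> = u" if "n \<in> Nk k" for n \<eta>
    using that
  proof (induction "\<Sum>i=1..k. n i" arbitrary: n \<eta>)
    case 0
    then have "n = deg_zero" by (auto simp: Nk_def fun_eq_iff)
    then have "\<eta> = u" using 0 paths_from_zero[OF u] by simp
    then show ?case using vertexD(3)[OF u] by simp
  next
    case (Suc d)
    obtain i where i: "i \<in> {1..k}" "n i > 0"
      using Suc.hyps(2) by (metis gr0I sum.neutral nat.distinct(1))
    define n' where "n' = (\<lambda>j. n j - unit_deg i j)"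
    have n': "n' \<in> Nk k" "n = unit_deg i \<boxplus> n'"
      using Suc.prems i by (auto simp: n'_def Nk_def unit_deg_def fun_eq_iff)
    have "(\<Sum>j=1..k. n j) = (\<Sum>j=1..k. unit_deg i j) + (\<Sum>j=1..k. n' j)"
      by (subst n'(2)) (rule sum.distrib)
    moreover have "(\<Sum>j=1..k. unit_deg i j) = 1" using i by (simp add: unit_deg_def)
    ultimately have d: "d = (\<Sum>j=1..k. n' j)" using Suc.hyps(2) by simp
    have \<eta>: "\<eta> \<in> Mor \<Lambda>" "deg \<Lambda> \<eta> = unit_deg i \<boxplus> n'" "rng \<Lambda> \<eta> = u"
      using Suc.prems n'(2) by (auto simp: paths_from_iff)
    obtain \<mu> \<nu> where f: "\<mu> \<in> Mor \<Lambda>" "\<nu> \<in> Mor \<Lambda>" "src \<Lambda> \<mu> = rng \<Lambda> \<nu>" "\<eta> = cmp \<Lambda> \<mu> \<nu>"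
      "deg \<Lambda> \<mu> = unit_deg i" "deg \<Lambda> \<nu> = n'"
      using factorization[OF \<eta>(1) unit_deg_Nk[OF i(1)] n'(1) \<eta>(2)] by blast
    then have "src \<Lambda> \<mu> = u" using src_u[OF i(1), of \<mu>] \<eta>(3) by (simp add: paths_from_iff)
    then have "\<nu> \<in> paths_from n' u" using f by (simp add: paths_from_iff)
    then have "src \<Lambda> \<nu> = u" using Suc.hyps(1)[OF d _ n'(1)] by blast
    then show ?case using f by simp
  qed
  obtain w where w: "w \<in> vertices \<Lambda>" "w \<noteq> u"
    using N2 u by (metis card_le_Suc0_iff_eq finite_vertices not_less_eq_eq numeral_2_eq_2)
  then obtain \<eta> where "\<eta> \<in> Mor \<Lambda>" "rng \<Lambda> \<eta> = u" "src \<Lambda> \<eta> = w"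
    using strongly_connected u unfolding strongly_connected_def hom_set_def by blast
  then show False using stays[of "deg \<Lambda> \<eta>" \<eta>] w by (simp add: paths_from_iff)
qed

end

section \<open>Self-similarity of the image\<close>

context pf_k_graph
begin

declare ne [simp]

abbreviation "paths \<equiv> infinite_paths k \<Lambda>"
abbreviation "P \<equiv> Psi k \<Lambda> l"
abbreviation "Z \<equiv> cylinder k \<Lambda>"
abbreviation "level n \<equiv> paths_of_degree \<Lambda> (diag_deg k n)"

definition digit_prefix :: "nat \<Rightarrow> ((nat \<Rightarrow> nat) \<times> (nat \<Rightarrow> nat) \<Rightarrow> 'a) \<Rightarrow> real" where
  "digit_prefix m x = (\<Sum>j<m. real (path_digit x j) / real N ^ Suc j)"

text \<open>A bound for the diameters of level-n images that tends to 0 in every case: for N = 1 the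
  quotient 1/N^(kn) would stay at 1 although the image is a single point.\<close>

definition resolution :: "nat \<Rightarrow> real" where
  "resolution n = (if N = 1 then 0 else 1 / real N ^ (k * n))"

lemma resolution_nonneg: "resolution n \<ge> 0"
  by (simp add: resolution_def)

lemma resolution_le: "resolution n \<le> 1 / real N ^ (k * n)"
  by (simp add: resolution_def)

lemma resolution_small:
  assumes "e > 0"
  shows "\<exists>n. resolution n < e"
proof (cases "N = 1")
  case False
  then have N2: "N \<ge> 2" using N_ge_1 by linarith
  obtain n where n: "(1 / 2) ^ n < e" using real_arch_pow_inv[OF assms, of "1/2"] by auto
  have "(2::real) ^ n \<le> 2 ^ (k * n)" using k1 by (intro power_increasing) auto
  also have "\<dots> \<le> real N ^ (k * n)" using N2 by (intro power_mono) auto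
  finally have "1 / real N ^ (k * n) \<le> 1 / 2 ^ n"
    using N2 by (intro divide_left_mono mult_pos_pos zero_less_power) linarith+
  with n False show ?thesis by (intro exI[of _ n]) (simp add: resolution_def power_one_over)
qed (use assms in \<open>simp add: resolution_def\<close>)

lemma level_Mor: "\<eta> \<in> level n \<Longrightarrow> \<eta> \<in> Mor \<Lambda>"
  by (simp add: paths_of_degree_def)

lemma level_deg: "\<eta> \<in> level n \<Longrightarrow> deg \<Lambda> \<eta> = diag_deg k n"
  by (simp add: paths_of_degree_def)

lemma finite_level: "finite (level n)"
  by (simp add: finite_paths_of_degree)

lemma path_digit_shift:
  "x \<in> paths \<Longrightarrow> path_digit (path_shift k (diag_deg k n) x) j = path_digit x (j + k * n)"
  by (simp add: path_digit_def path_shift_apply corner_add)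

lemma Psi_bounds:
  assumes "x \<in> paths"
  shows "0 \<le> P x" "P x \<le> (if N = 1 then 0 else 1)"
  unfolding Psi_eq_base_sum[OF assms]
  using base_sum_nonneg[of "path_digit x" N] base_sum_le[of "path_digit x" N] path_digit_less[OF assms] by auto

lemma Psi_split:
  assumes "x \<in> paths"
  shows "P x = digit_prefix (k * n) x + P (path_shift k (diag_deg k n) x) / real N ^ (k * n)"
proof -
  have "P x = digit_prefix (k * n) x + base_sum N (\<lambda>m. path_digit x (m + k * n)) / real N ^ (k * n)"
    unfolding Psi_eq_base_sum[OF assms] digit_prefix_def
    by (rule base_sum_split) (rule path_digit_less[OF assms])
  also have "base_sum N (\<lambda>m. path_digit x (m + k * n)) = P (path_shift k (diag_deg k n) x)"
    using path_shift_infinite_paths[OF assms diag_deg_Nk]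
    by (simp add: Psi_eq_base_sum path_digit_shift[OF assms, symmetric])
  finally show ?thesis .
qed

text \<open>The range includes j = kn, since the corner there is the source of \<eta>.\<close>

lemma cylinder_digits:
  assumes "\<eta> \<in> level n" "x \<in> Z \<eta>" "y \<in> Z \<eta>" "j \<le> k * n"
  shows "path_digit x j = path_digit y j"
proof -
  have "x (corner k j, corner k j) = y (corner k j, corner k j)"
  proof (rule path_segment_determined)
    show "x \<in> paths" "y \<in> paths" using assms cylinderD(1) by auto
    show "corner k j \<le> corner k (k * n)" using assms(4) by simp
    show "x (deg_zero, corner k (k * n)) = y (deg_zero, corner k (k * n))"
      using cylinderD(2)[OF assms(2)] cylinderD(2)[OF assms(3)] level_deg[OF assms(1)] by (simp add: corner_mult)
  qed auto
  then show ?thesis by (simp add: path_digit_def)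
qed

lemma cylinder_digit_prefix:
  assumes "\<eta> \<in> level n" "x \<in> Z \<eta>" "y \<in> Z \<eta>"
  shows "digit_prefix (k * n) x = digit_prefix (k * n) y"
  unfolding digit_prefix_def by (rule sum.cong) (simp_all add: cylinder_digits[OF assms])

lemma Psi_cylinder_close:
  assumes "\<eta> \<in> level n" "x \<in> Z \<eta>" "y \<in> Z \<eta>"
  shows "dist (P x) (P y) \<le> resolution n"
proof -
  have xy: "x \<in> paths" "y \<in> paths" using assms cylinderD(1) by auto
  let ?x = "path_shift k (diag_deg k n) x" and ?y = "path_shift k (diag_deg k n) y"
  have "?x \<in> paths" "?y \<in> paths" using xy by (auto intro: path_shift_infinite_paths)
  then have "dist (P ?x) (P ?y) \<le> (if N = 1 then 0 else 1)"
    using Psi_bounds[of ?x] Psi_bounds[of ?y] by (auto simp: dist_real_def split: if_splits)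
  then have "dist (P ?x) (P ?y) / real N ^ (k * n) \<le> (if N = 1 then 0 else 1) / real N ^ (k * n)"
    by (intro divide_right_mono) auto
  also have "dist (P ?x) (P ?y) / real N ^ (k * n) = dist (P x) (P y)"
    using Psi_split[OF xy(1), of n] Psi_split[OF xy(2), of n] cylinder_digit_prefix[OF assms]
    by (simp add: dist_real_def diff_divide_distrib[symmetric] abs_divide)
  finally show ?thesis by (simp add: resolution_def split: if_splits)
qed

lemma initial_level: "x \<in> paths \<Longrightarrow> x (deg_zero, diag_deg k n) \<in> level n" "x \<in> paths \<Longrightarrow> x \<in> Z (x (deg_zero, diag_deg k n))"
  using mem_cylinder_initial[of x "diag_deg k n"] by auto

text \<open>Surjectivity onto the affine copy does not need the prolongation of infinite paths: cylinders are
  nonempty because they have positive measure, so the image of \<open>Z \<eta>\<close> is dense in the copy, and it is compact.\<close>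

lemma Psi_cylinder_self_similar:
  assumes \<eta>: "\<eta> \<in> level n" and x0: "x0 \<in> Z \<eta>"
  shows "P ` Z \<eta> = (\<lambda>y. digit_prefix (k * n) x0 + (1 / real N ^ (k * n)) * y) ` P ` Z (src \<Lambda> \<eta>)"
    (is "_ = ?f ` _")
proof (intro equalityI subsetI)
  fix t assume "t \<in> P ` Z \<eta>"
  then obtain x where x: "x \<in> Z \<eta>" "t = P x" by auto
  have "path_shift k (diag_deg k n) x \<in> Z (src \<Lambda> \<eta>)"
    using path_shift_cylinder_src[OF level_Mor[OF \<eta>] x(1)] level_deg[OF \<eta>] by simp
  moreover have "t = ?f (P (path_shift k (diag_deg k n) x))"
    using Psi_split[OF cylinderD(1)[OF x(1)], of n] cylinder_digit_prefix[OF \<eta> x(1) x0] x(2) by simp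
  ultimately show "t \<in> ?f ` P ` Z (src \<Lambda> \<eta>)" by blast
next
  fix t assume "t \<in> ?f ` P ` Z (src \<Lambda> \<eta>)"
  then obtain z where z: "z \<in> Z (src \<Lambda> \<eta>)" "t = ?f (P z)" by auto
  have zp: "z \<in> paths" using z cylinderD(1) by auto
  have \<eta>M: "\<eta> \<in> Mor \<Lambda>" by (rule level_Mor[OF \<eta>])
  have "closed (P ` Z \<eta>)" by (rule compact_imp_closed[OF compact_Psi_cylinder[OF \<eta>M]])
  moreover have "\<forall>e>0. \<exists>y\<in>P ` Z \<eta>. dist y t < e"
  proof (intro allI impI)
    fix e :: real assume "e > 0"
    then obtain p where p: "resolution p < e" using resolution_small by blast
    define \<mu> where "\<mu> = z (deg_zero, diag_deg k p)"
    have \<mu>: "\<mu> \<in> level p" "z \<in> Z \<mu>" using initial_level[OF zp] by (auto simp: \<mu>_def)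
    have "rng \<Lambda> \<mu> = src \<Lambda> \<eta>"
      using path_segment(3)[OF zp, of deg_zero "diag_deg k p"] z(1) \<eta>M by (simp add: \<mu>_def cylinder_vertex)
    then have c: "\<eta> \<in> Mor \<Lambda>" "\<mu> \<in> Mor \<Lambda>" "src \<Lambda> \<eta> = rng \<Lambda> \<mu>" using \<eta>M level_Mor[OF \<mu>(1)] by auto
    then obtain u where u: "u \<in> Z (cmp \<Lambda> \<eta> \<mu>)" using cylinder_nonempty[of "cmp \<Lambda> \<eta> \<mu>"] by auto
    have u1: "u \<in> Z \<eta>" and u2: "path_shift k (diag_deg k n) u \<in> Z \<mu>"
      using cylinder_cmp[OF c u] level_deg[OF \<eta>] by auto
    have "P u = ?f (P (path_shift k (diag_deg k n) u))"
      using Psi_split[OF cylinderD(1)[OF u1], of n] cylinder_digit_prefix[OF \<eta> u1 x0] by simp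
    then have "dist (P u) t = dist (P (path_shift k (diag_deg k n) u)) (P z) / real N ^ (k * n)"
      using z(2) by (simp add: dist_real_def diff_divide_distrib[symmetric] abs_divide)
    also have "\<dots> \<le> dist (P (path_shift k (diag_deg k n) u)) (P z) / 1"
      using N_ge_1 by (intro divide_left_mono) (auto intro: one_le_power)
    also have "\<dots> \<le> resolution p" using Psi_cylinder_close[OF \<mu>(1) u2 \<mu>(2)] by simp
    finally show "\<exists>y\<in>P ` Z \<eta>. dist y t < e" using u1 p by force
  qed
  ultimately show "t \<in> P ` Z \<eta>" using closed_approachable by blast
qed

section \<open>The dimension\<close>

text \<open>The candidate for the dimension. For N = 1 the quotient by \<open>ln 1 = 0\<close> is 0,
  as it should be for a point.\<close>

definition hdim :: real where
  "hdim = 1 / real k * (ln R / ln (real N))"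

lemma N_eq_1_or: "N = 1 \<or> N \<ge> 2"
  using N_ge_1 by linarith

lemma powr_hdim: "real N powr (real k * hdim) = R"
proof (cases "N = 1")
  case True
  then show ?thesis using R_eq_1_if_N_eq_1 by simp
next
  case False
  then have "ln (real N) > 0" using N_eq_1_or by simp
  then have "real k * hdim * ln (real N) = ln R" using k1 by (simp add: hdim_def)
  then show ?thesis using R_pos ne by (simp add: powr_def)
qed

lemma hdim_nonneg: "hdim \<ge> 0"
  unfolding hdim_def using R_ge_1 N_ge_1 by (intro mult_nonneg_nonneg divide_nonneg_nonneg) auto

lemma hdim_eq_0: "hdim = 0 \<Longrightarrow> R = 1"
  using powr_hdim ne by simp

lemma hdim_pos_iff: "hdim > 0 \<longleftrightarrow> R > 1"
proof
  assume "hdim > 0"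
  then have "N \<noteq> 1" by (auto simp: hdim_def)
  with \<open>hdim > 0\<close> N_eq_1_or k1 have "1 < real N powr (real k * hdim)" by (intro gr_one_powr) auto
  then show "R > 1" by (simp add: powr_hdim)
next
  assume "R > 1"
  then show "hdim > 0" using hdim_eq_0 hdim_nonneg by force
qed

text \<open>The exponent is made for this: a contraction by N^(-kn) multiplies H^s by R^(-n), the
  factor by which M shrinks along a level.\<close>

lemma scale_powr_hdim: "(1 / real N ^ (k * n)) powr hdim = 1 / R ^ n"
proof -
  have "(real N ^ (k * n)) powr hdim = (real N powr (real k * hdim)) ^ n"
  proof -
    have N0: "real N > 0" using N_ge_1 by linarith
    have "(real N ^ (k * n)) powr hdim = real N powr (real k * hdim * real n)"
      using N0 by (simp only: powr_realpow[symmetric] powr_powr of_nat_mult mult_ac)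
    also have "\<dots> = (real N powr (real k * hdim)) powr real n" by (simp only: powr_powr)
    also have "\<dots> = (real N powr (real k * hdim)) ^ n" using N0 by (intro powr_realpow) simp
    finally show ?thesis .
  qed
  then show ?thesis by (simp add: powr_divide powr_hdim)
qed

lemma diam_power_cylinder:
  assumes "\<eta> \<in> level n"
  shows "bounded (P ` Z \<eta>)" "diameter (P ` Z \<eta>) \<le> resolution n" "diam_power hdim (P ` Z \<eta>) \<le> ennreal (1 / R ^ n)"
proof -
  show b: "bounded (P ` Z \<eta>)"
    by (rule compact_imp_bounded[OF compact_Psi_cylinder[OF level_Mor[OF assms]]])
  show d: "diameter (P ` Z \<eta>) \<le> resolution n"
    using Psi_cylinder_close[OF assms] resolution_nonneg
    by (auto simp: diameter_def intro!: cSUP_least)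
  show "diam_power hdim (P ` Z \<eta>) \<le> ennreal (1 / R ^ n)"
  \<comment> \<open>With exponent 0 every nonempty set costs 1, which is R^(-n) because then R =
    1.\<close>
  proof (cases "hdim = 0")
    case True
    then show ?thesis using hdim_eq_0 by (simp add: diam_power_def)
  next
    case False
    have "diameter (P ` Z \<eta>) powr hdim \<le> (1 / real N ^ (k * n)) powr hdim"
      using order_trans[OF d resolution_le] diameter_ge_0[OF b] hdim_nonneg by (intro powr_mono2) auto
    with False show ?thesis by (simp add: diam_power_def scale_powr_hdim ennreal_leI)
  qed
qed

lemma Psi_cylinder_vertex:
  "v \<in> vertices \<Lambda> \<Longrightarrow> n \<in> Nk k \<Longrightarrow> P ` Z v = (\<Union>\<eta>\<in>paths_from n v. P ` Z \<eta>)"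
  by (simp add: cylinder_vertex_eq_UN image_UN)

text \<open>Each level-n image costs at most R^(-n). Bounding all weights below by the least one in
  the eigenvector equation shows that at most R^n times a constant of them are needed.\<close>

lemma hausdorff_cylinder_finite:
  assumes v: "v \<in> vertices \<Lambda>"
  shows "hausdorff_outer hdim (P ` Z v) < \<infinity>"
proof -
  define w where "w = arg_min_on pf_weight (vertices \<Lambda>)"
  have w: "w \<in> vertices \<Lambda>" "\<And>u. u \<in> vertices \<Lambda> \<Longrightarrow> pf_weight w \<le> pf_weight u"
    unfolding w_def using arg_min_if_finite(1)[OF finite_vertices ne] arg_min_least[OF finite_vertices ne] by auto
  have "hausdorff_outer hdim (P ` Z v) \<le> ennreal (pf_weight v / pf_weight w)"
  proof (rule hausdorff_outer_least)
    fix \<delta> :: real assume "\<delta> > 0"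
    then obtain n where n: "resolution n < \<delta>" using resolution_small by blast
    let ?S = "paths_from (diag_deg k n) v"
    have S: "?S \<subseteq> level n" by (auto simp: paths_from_def)
    have "hausdorff_pre \<delta> hdim (P ` Z v) \<le> (\<Sum>\<eta>\<in>?S. diam_power hdim (P ` Z \<eta>))"
    proof (rule hausdorff_pre_le_finite)
      show "P ` Z v \<subseteq> (\<Union>\<eta>\<in>?S. P ` Z \<eta>)" using Psi_cylinder_vertex[OF v diag_deg_Nk] by auto
      show "diameter (P ` Z \<eta>) < \<delta>" if "\<eta> \<in> ?S" for \<eta>
        using diam_power_cylinder(2)[of \<eta> n] S that n by auto
    qed (use S diam_power_cylinder(1) \<open>\<delta> > 0\<close> in auto)
    also have "\<dots> \<le> (\<Sum>\<eta>\<in>?S. ennreal (1 / R ^ n))"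
      by (intro sum_mono diam_power_cylinder(3)) (use S in auto)
    also have "\<dots> = ennreal (real (card ?S) / R ^ n)"
      using R_pos by (simp add: ennreal_of_nat_eq_real_of_nat ennreal_mult[symmetric])
    also have "\<dots> \<le> ennreal (pf_weight v / pf_weight w)"
    proof (rule ennreal_leI)
      have "real (card ?S) * pf_weight w = (\<Sum>\<eta>\<in>?S. pf_weight w)" by simp
      also have "\<dots> \<le> transfer (diag_deg k n) pf_weight v"
        unfolding transfer_def by (intro sum_mono w(2)) (auto simp: paths_from_iff)
      also have "\<dots> = R ^ n * pf_weight v" using v by (simp add: transfer_pf_weight scal_diag)
      finally show "real (card ?S) / R ^ n \<le> pf_weight v / pf_weight w"
        using R_pos pf_weight_pos[OF w(1)] by (simp add: field_simps)
    qed
    finally show "hausdorff_pre \<delta> hdim (P ` Z v) \<le> ennreal (pf_weight v / pf_weight w)" .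
  qed
  then show ?thesis by (simp add: order_le_less_trans)
qed

section \<open>Mass distribution\<close>

text \<open>That a given vertex sits at a given corner is a finite union of cylinders, so each digit
  is measurable, and \<open>Psi\<close> is a series of digits.\<close>

lemma measurable_Psi [measurable]: "P \<in> borel_measurable M"
proof -
  have vm: "{x \<in> space M. x (corner k m, corner k m) = v} \<in> sets M" for v m
  proof -
    have "{x \<in> space M. x (corner k m, corner k m) = v}
        = (\<Union>\<eta>\<in>{\<eta> \<in> paths_of_degree \<Lambda> (corner k m). src \<Lambda> \<eta> = v}. Z \<eta>)" (is "?L = ?R")
    proof (intro equalityI subsetI)
      fix x assume "x \<in> ?L"
      then have x: "x \<in> paths" "x (corner k m, corner k m) = v" by (auto simp: space_M)
      have "src \<Lambda> (x (deg_zero, corner k m)) = v"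
        using path_segment(4)[OF x(1), of deg_zero "corner k m"] x(2) by simp
      then show "x \<in> ?R" using mem_cylinder_initial[OF x(1) corner_Nk, of m] by auto
    next
      fix x assume "x \<in> ?R"
      then obtain \<eta> where "\<eta> \<in> Mor \<Lambda>" "deg \<Lambda> \<eta> = corner k m" "src \<Lambda> \<eta> = v" "x \<in> Z \<eta>"
        by (auto simp: paths_of_degree_def)
      then show "x \<in> ?L" using cylinder_src[of x \<eta>] cylinderD(1) by (auto simp: space_M)
    qed
    also have "\<dots> \<in> sets M"
    proof (intro sets.finite_UN)
      show "finite {\<eta> \<in> paths_of_degree \<Lambda> (corner k m). src \<Lambda> \<eta> = v}"
        by (rule finite_subset[OF _ finite_paths_of_degree[OF corner_Nk]]) auto
    qed (auto simp: paths_of_degree_def intro: cylinder_sets)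
    finally show ?thesis .
  qed
  have "(\<lambda>x. real (path_digit x m)) \<in> borel_measurable M" for m
  proof -
    have "(\<lambda>x. \<Sum>v\<in>vertices \<Lambda>. real (l v) * indicator {x \<in> space M. x (corner k m, corner k m) = v} x) \<in> borel_measurable M"
      using vm by measurable
    moreover have "(\<Sum>v\<in>vertices \<Lambda>. real (l v) * indicator {x \<in> space M. x (corner k m, corner k m) = v} x) = real (path_digit x m)"
      if "x \<in> space M" for x
    proof -
      have "(\<Sum>v\<in>vertices \<Lambda>. real (l v) * indicator {x \<in> space M. x (corner k m, corner k m) = v} x)
          = (\<Sum>v\<in>vertices \<Lambda>. if v = x (corner k m, corner k m) then real (l v) else 0)"
        using that by (intro sum.cong) (auto simp: indicator_def)
      also have "\<dots> = real (path_digit x m)"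
        using path_vertex[of x "corner k m"] that by (simp add: space_M path_digit_def path_vertex)
      finally show ?thesis .
    qed
    ultimately show ?thesis by (subst measurable_cong) (auto)
  qed
  then have "(\<lambda>x. base_sum N (path_digit x)) \<in> borel_measurable M"
    unfolding base_sum_def by measurable
  then show ?thesis
    by (subst measurable_cong[where g = "\<lambda>x. base_sum N (path_digit x)"]) (auto simp: space_M Psi_eq_base_sum)
qed

lemma Psi_vimage_sets [measurable]: "B \<in> sets borel \<Longrightarrow> {x \<in> space M. P x \<in> B} \<in> sets M"
  using measurable_sets[OF measurable_Psi, of B] by (simp add: vimage_def Int_def conj_commute)

lemma level_determined_by_digits:
  assumes "\<eta> \<in> level n" "\<eta>' \<in> level n" "x \<in> Z \<eta>" "y \<in> Z \<eta>'"
    and "\<And>j. j \<le> k * n \<Longrightarrow> path_digit x j = path_digit y j"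
  shows "\<eta> = \<eta>'"
  using path_digits_determine[of x y "k * n", OF cylinderD(1)[OF assms(3)] cylinderD(1)[OF assms(4)] assms(5)]
    cylinderD(2)[OF assms(3)] cylinderD(2)[OF assms(4)] level_deg[OF assms(1)] level_deg[OF assms(2)]
  by (simp add: corner_mult)

text \<open>A level-n path is recovered from the integer formed by its first kn digits together with
  its source, which is the digit at position kn.\<close>

lemma card_level_meeting:
  assumes N2: "N \<ge> 2" and u: "u \<in> U" and U: "\<And>y. y \<in> U \<Longrightarrow> dist y u \<le> 1 / real N ^ (k * n)"
  shows "card {\<eta> \<in> level n. P ` Z \<eta> \<inter> U \<noteq> {}} \<le> 4 * N"
proof -
  define S where "S = {\<eta> \<in> level n. P ` Z \<eta> \<inter> U \<noteq> {}}"
  define G where "G x = (\<Sum>j<k * n. path_digit x j * N ^ (k * n - Suc j))" for x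
  have G: "real (G x) = real N ^ (k * n) * digit_prefix (k * n) x" for x
    unfolding G_def digit_prefix_def sum_distrib_left of_nat_sum
  proof (intro sum.cong refl)
    fix j assume "j \<in> {..<k * n}"
    then have "k * n = (k * n - Suc j) + Suc j" by simp
    then have "real N ^ (k * n) = real N ^ (k * n - Suc j) * real N ^ Suc j"
      by (metis power_add)
    then show "real (path_digit x j * N ^ (k * n - Suc j)) = real N ^ (k * n) * (real (path_digit x j) / real N ^ Suc j)"
      using N2 by simp
  qed
  have "\<exists>x. x \<in> Z \<eta> \<and> P x \<in> U" if "\<eta> \<in> S" for \<eta> using that by (auto simp: S_def)
  then obtain X where X: "\<And>\<eta>. \<eta> \<in> S \<Longrightarrow> X \<eta> \<in> Z \<eta>" "\<And>\<eta>. \<eta> \<in> S \<Longrightarrow> P (X \<eta>) \<in> U" by metis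
  have Sl: "\<eta> \<in> level n" if "\<eta> \<in> S" for \<eta> using that by (simp add: S_def)
  let ?a = "real N ^ (k * n) * u"
  \<comment> \<open>After scaling by N^(kn), points of U lie within 1 of \<open>?a\<close>, and the
    tail after kn digits adds between 0 and 1. So the integer lies between ?a - 2 and ?a + 1, which
    leaves four values.\<close>
  let ?T = "{\<lceil>?a\<rceil> - 2..\<lceil>?a\<rceil> + 1} \<times> vertices \<Lambda>"
  have "inj_on (\<lambda>\<eta>. (int (G (X \<eta>)), src \<Lambda> \<eta>)) S"
  proof (rule inj_onI)
    fix \<eta> \<eta>' assume \<eta>: "\<eta> \<in> S" "\<eta>' \<in> S" and eq: "(int (G (X \<eta>)), src \<Lambda> \<eta>) = (int (G (X \<eta>')), src \<Lambda> \<eta>')"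
    have X\<eta>: "X \<eta> \<in> paths" "X \<eta>' \<in> paths" using X(1) \<eta> cylinderD(1) by blast+
    have "digit_prefix (k * n) (X \<eta>) = digit_prefix (k * n) (X \<eta>')"
      using eq G[of "X \<eta>"] G[of "X \<eta>'"] N2 by simp
    then have d: "path_digit (X \<eta>) j = path_digit (X \<eta>') j" if "j < k * n" for j
      using that unfolding digit_prefix_def
      by (intro finite_digits_unique[OF N2, of "path_digit (X \<eta>)" "path_digit (X \<eta>')" "k * n"])
        (auto intro: path_digit_less X\<eta>)
    have "path_digit (X \<eta>) (k * n) = path_digit (X \<eta>') (k * n)"
      using cylinder_src[OF X(1)[OF \<eta>(1)] level_Mor[OF Sl[OF \<eta>(1)]]]
        cylinder_src[OF X(1)[OF \<eta>(2)] level_Mor[OF Sl[OF \<eta>(2)]]] eq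
        level_deg[OF Sl[OF \<eta>(1)]] level_deg[OF Sl[OF \<eta>(2)]]
      by (simp add: path_digit_def corner_mult)
    with d have "path_digit (X \<eta>) j = path_digit (X \<eta>') j" if "j \<le> k * n" for j
      using that by (cases "j = k * n") auto
    then show "\<eta> = \<eta>'" using level_determined_by_digits[OF Sl[OF \<eta>(1)] Sl[OF \<eta>(2)] X(1)[OF \<eta>(1)] X(1)[OF \<eta>(2)]] by blast
  qed
  moreover have "(\<lambda>\<eta>. (int (G (X \<eta>)), src \<Lambda> \<eta>)) ` S \<subseteq> ?T"
  proof (intro image_subsetI)
    fix \<eta> assume \<eta>: "\<eta> \<in> S"
    have p: "X \<eta> \<in> paths" using X(1)[OF \<eta>] cylinderD(1) by blast
    define z where "z = P (path_shift k (diag_deg k n) (X \<eta>))"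
    have z: "0 \<le> z" "z \<le> 1"
      using Psi_bounds[OF path_shift_infinite_paths[OF p diag_deg_Nk, of n]] N2 by (auto simp: z_def split: if_splits)
    have "real N ^ (k * n) * P (X \<eta>) = real (G (X \<eta>)) + z"
      using Psi_split[OF p, of n] N2 unfolding G z_def by (simp add: field_simps)
    moreover have "\<bar>real N ^ (k * n) * P (X \<eta>) - ?a\<bar> \<le> 1"
    proof -
      have "\<bar>real N ^ (k * n) * P (X \<eta>) - ?a\<bar> = real N ^ (k * n) * dist (P (X \<eta>)) u"
        by (simp add: dist_real_def abs_mult right_diff_distrib[symmetric])
      also have "\<dots> \<le> real N ^ (k * n) * (1 / real N ^ (k * n))"
        by (intro mult_left_mono U X(2) \<eta>) auto
      finally show ?thesis using N2 by simp
    qed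
    ultimately have "real (G (X \<eta>)) \<le> ?a + 1" "?a - 2 \<le> real (G (X \<eta>))" using z by linarith+
    then have "int (G (X \<eta>)) \<in> {\<lceil>?a\<rceil> - 2..\<lceil>?a\<rceil> + 1}"
      using le_of_int_ceiling[of ?a] by (simp add: ceiling_le_iff) linarith
    then show "(int (G (X \<eta>)), src \<Lambda> \<eta>) \<in> ?T" using level_Mor[OF Sl[OF \<eta>]] by simp
  qed
  ultimately have "card S \<le> card ?T" by (intro card_inj_on_le) auto
  also have "\<dots> = 4 * N" by (simp add: card_cartesian_product)
  finally show ?thesis unfolding S_def .
qed

lemma measure_small_set:
  assumes N2: "N \<ge> 2" and U: "U \<in> sets borel" "bounded U" "diameter U \<le> 1 / real N ^ (k * n)"
  shows "measure M {x \<in> space M. P x \<in> U} \<le> real (4 * N) / R ^ n"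
proof (cases "U = {}")
  case False
  then obtain u where u: "u \<in> U" by auto
  let ?S = "{\<eta> \<in> level n. P ` Z \<eta> \<inter> U \<noteq> {}}"
  have "measure M {x \<in> space M. P x \<in> U} \<le> measure M (\<Union>\<eta>\<in>?S. Z \<eta>)"
  proof (rule finite_measure_mono)
    show "{x \<in> space M. P x \<in> U} \<subseteq> (\<Union>\<eta>\<in>?S. Z \<eta>)"
    proof
      fix x assume "x \<in> {x \<in> space M. P x \<in> U}"
      then have "x \<in> paths" "P x \<in> U" by (auto simp: space_M)
      then show "x \<in> (\<Union>\<eta>\<in>?S. Z \<eta>)" using initial_level[of x n] by blast
    qed
    show "(\<Union>\<eta>\<in>?S. Z \<eta>) \<in> sets M"
      using finite_level by (intro sets.finite_UN) (auto intro: cylinder_sets level_Mor)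
  qed
  also have "\<dots> = (\<Sum>\<eta>\<in>?S. measure M (Z \<eta>))"
    using finite_level by (intro measure_cylinder_UN) auto
  also have "\<dots> \<le> (\<Sum>\<eta>\<in>?S. 1 / R ^ n)"
  proof (rule sum_mono)
    fix \<eta> assume "\<eta> \<in> ?S"
    then have \<eta>: "\<eta> \<in> level n" by simp
    have "pf_weight (src \<Lambda> \<eta>) \<le> 1"
      using sum_pf_weight member_le_sum[of "src \<Lambda> \<eta>" "vertices \<Lambda>" pf_weight] pf_weight_nonneg level_Mor[OF \<eta>] by simp
    then show "measure M (Z \<eta>) \<le> 1 / R ^ n"
      using measure_cylinder_degree[OF \<eta>] R_pos by (simp add: scal_diag field_simps)
  qed
  also have "\<dots> = real (card ?S) / R ^ n" by simp
  also have "\<dots> \<le> real (4 * N) / R ^ n"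
  proof (intro divide_right_mono of_nat_mono card_level_meeting[OF N2 u])
    show "dist y u \<le> 1 / real N ^ (k * n)" if "y \<in> U" for y
      using diameter_bounded_bound[OF U(2) that u] U(3) by simp
  qed (use R_pos in auto)
  finally show ?thesis .
qed (use R_pos in simp)

text \<open>4N bounds the number of level-n images that a small set meets; the extra R pays for
  passing from a level to the next one.\<close>

definition mass_const :: real where
  "mass_const = real (4 * N) * R"

lemma mass_const_ge_1: "mass_const \<ge> 1"
proof -
  have "1 * 1 \<le> real (4 * N) * R" using R_ge_1 N_ge_1 by (intro mult_mono) auto
  then show ?thesis by (simp add: mass_const_def)
qed

text \<open>The mass distribution estimate: U is compared with the last level whose intervals are at
  least as long as its diameter. Closedness makes the preimage of U measurable.\<close>

lemma mass_le_diam_power: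
  assumes U: "closed U" "bounded U"
  shows "emeasure M {x \<in> space M. P x \<in> U} \<le> ennreal mass_const * diam_power hdim U"
proof (cases "U = {}")
  case False
  have Ub: "U \<in> sets borel" using U by auto
  have le1: "emeasure M {x \<in> space M. P x \<in> U} \<le> ennreal mass_const"
    using prob_le_1[of "{x \<in> space M. P x \<in> U}"] mass_const_ge_1
    by (simp add: emeasure_eq_measure ennreal_leI del: prob_le_1)
  show ?thesis
  proof (cases "hdim = 0")
    case True
    then show ?thesis using le1 False by (simp add: diam_power_def)
  next
    case dim0: False
    then have "hdim > 0" using hdim_nonneg by simp
    then have R1: "R > 1" and N2: "N \<ge> 2"
      using hdim_pos_iff N_eq_1_or R_eq_1_if_N_eq_1 by auto
    have d0: "diameter U \<ge> 0" using U(2) by (rule diameter_ge_0)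
    have "measure M {x \<in> space M. P x \<in> U} \<le> mass_const * diameter U powr hdim"
    proof (cases "diameter U \<ge> 1")
      case True
      have "1 powr hdim \<le> diameter U powr hdim" using True hdim_nonneg by (intro powr_mono2) auto
      then have "1 * 1 \<le> mass_const * diameter U powr hdim" using mass_const_ge_1 by (intro mult_mono) auto
      then show ?thesis using prob_le_1[of "{x \<in> space M. P x \<in> U}"] by linarith
    next
      case small: False
      show ?thesis
      proof (cases "diameter U = 0")
        case True
        \<comment> \<open>A set of diameter 0 is small at every level, and R > 1 sends the bound to
          0.\<close>
        have "measure M {x \<in> space M. P x \<in> U} \<le> real (4 * N) / R ^ n" for n
          using True by (intro measure_small_set N2 Ub U(2)) simp
        moreover have "(\<lambda>n. real (4 * N) / R ^ n) \<longlonglongrightarrow> 0" using R1 by (rule LIMSEQ_divide_realpow_zero)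
        ultimately have "measure M {x \<in> space M. P x \<in> U} \<le> 0"
          by (intro LIMSEQ_le_const[of "\<lambda>n. real (4 * N) / R ^ n"]) auto
        then show ?thesis using True dim0 by simp
      next
        case False
        have dpos: "diameter U > 0" using False d0 by simp
        have "\<exists>n. 1 / real N ^ (k * n) < diameter U"
          using resolution_small[OF dpos] N2 by (simp add: resolution_def)
        \<comment> \<open>Level n gives N^(-kn) < diam U, while at the preceding level n' the
          interval length is still at least diam U. As diam U < 1, level 0 does not qualify, so n'
          exists.\<close>
        define n where "n = (LEAST n. 1 / real N ^ (k * n) < diameter U)"
        have n: "1 / real N ^ (k * n) < diameter U" unfolding n_def by (rule LeastI_ex) fact
        have "n \<noteq> 0" using n small by (intro notI) simp
        then obtain n' where n': "n = Suc n'" by (cases n) auto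
        have "\<not> 1 / real N ^ (k * n') < diameter U"
          using not_less_Least[of n' "\<lambda>n. 1 / real N ^ (k * n) < diameter U"] n' by (simp add: n_def)
        then have "measure M {x \<in> space M. P x \<in> U} \<le> real (4 * N) / R ^ n'"
          by (intro measure_small_set N2 Ub U(2)) simp
        also have "\<dots> = mass_const * (1 / R ^ n)" using R_pos by (simp add: mass_const_def n')
        also have "\<dots> \<le> mass_const * diameter U powr hdim"
          unfolding scale_powr_hdim[symmetric] using n mass_const_ge_1 hdim_nonneg
          by (intro mult_left_mono powr_mono2) auto
        finally show ?thesis .
      qed
    qed
    then show ?thesis using dim0 False mass_const_ge_1
      by (simp add: emeasure_eq_measure diam_power_def ennreal_mult[symmetric] ennreal_leI)
  qed
qed simp

lemma mass_le_hausdorff: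
  assumes "E \<in> sets borel"
  shows "emeasure M {x \<in> space M. P x \<in> E} \<le> ennreal mass_const * hausdorff_outer hdim E"
proof -
  have "emeasure M {x \<in> space M. P x \<in> E} \<le> ennreal mass_const * hausdorff_pre 1 hdim E"
  proof (rule hausdorff_pre_greatest)
    show "mass_const > 0" using mass_const_ge_1 by simp
    fix A :: "nat \<Rightarrow> real set"
    assume A: "E \<subseteq> (\<Union>j. A j)" "\<And>j. bounded (A j)" "\<And>j. diameter (A j) < 1"
    \<comment> \<open>Covering sets are arbitrary; their closures have measurable preimages and the
      same diameters.\<close>
    have "emeasure M {x \<in> space M. P x \<in> E} \<le> emeasure M (\<Union>j. {x \<in> space M. P x \<in> closure (A j)})"
    proof (rule emeasure_mono)
      show "{x \<in> space M. P x \<in> E} \<subseteq> (\<Union>j. {x \<in> space M. P x \<in> closure (A j)})"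
      proof
        fix x assume x: "x \<in> {x \<in> space M. P x \<in> E}"
        then obtain j where "P x \<in> A j" using A(1) by auto
        then have "P x \<in> closure (A j)" by (rule subsetD[OF closure_subset])
        with x show "x \<in> (\<Union>j. {x \<in> space M. P x \<in> closure (A j)})" by auto
      qed
    qed (auto intro!: Psi_vimage_sets)
    also have "\<dots> \<le> (\<Sum>j. emeasure M {x \<in> space M. P x \<in> closure (A j)})"
      by (rule emeasure_subadditive_countably) (auto intro!: Psi_vimage_sets)
    also have "\<dots> \<le> (\<Sum>j. ennreal mass_const * diam_power hdim (closure (A j)))"
      using A(2) by (intro suminf_le mass_le_diam_power) auto
    also have "\<dots> = (\<Sum>j. ennreal mass_const * diam_power hdim (A j))"
    proof -
      have "diam_power hdim (closure (A j)) = diam_power hdim (A j)" for j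
        by (auto simp: diam_power_def diameter_closure[OF A(2)])
      then show ?thesis by simp
    qed
    also have "\<dots> = ennreal mass_const * (\<Sum>j. diam_power hdim (A j))" by simp
    finally show "emeasure M {x \<in> space M. P x \<in> E} \<le> ennreal mass_const * (\<Sum>j. diam_power hdim (A j))" .
  qed
  also have "\<dots> \<le> ennreal mass_const * hausdorff_outer hdim E"
    by (intro mult_left_mono hausdorff_pre_le_outer) auto
  finally show ?thesis .
qed

section \<open>Points with two expansions\<close>

definition ambiguous :: "real set" where
  "ambiguous = {P x | x y. x \<in> paths \<and> y \<in> paths \<and> path_digit x \<noteq> path_digit y \<and> P x = P y}"

lemma ambiguous_eventually_0:
  assumes "t \<in> ambiguous"
  obtains z m where "z \<in> paths" "t = P z" "\<forall>j>m. path_digit z j = 0" "N \<ge> 2"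
proof -
  obtain x y where xy: "x \<in> paths" "y \<in> paths" "path_digit x \<noteq> path_digit y" "P x = P y" "t = P x"
    using assms by (auto simp: ambiguous_def)
  have "N \<noteq> 1"
  proof
    assume "N = 1"
    then have "path_digit x j = 0" "path_digit y j = 0" for j
      using path_digit_less[OF xy(1), of j] path_digit_less[OF xy(2), of j] by auto
    then have "path_digit x = path_digit y" by auto
    with xy(3) show False by blast
  qed
  then have N2: "N \<ge> 2" using N_eq_1_or by blast
  have "base_sum N (path_digit x) = base_sum N (path_digit y)"
    using xy(4) unfolding Psi_eq_base_sum[OF xy(1)] Psi_eq_base_sum[OF xy(2)] .
  from base_sum_eq_eventually_0[of N "path_digit x" "path_digit y", OF N2 path_digit_less[OF xy(1)] path_digit_less[OF xy(2)] this xy(3)]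
  obtain m e where "e = path_digit x \<or> e = path_digit y" "\<forall>j>m. e j = 0" by blast
  with that xy N2 show thesis by metis
qed

lemma ambiguous_Rats: "ambiguous \<subseteq> \<rat>"
proof
  fix t assume "t \<in> ambiguous"
  then obtain z m where z: "z \<in> paths" "t = P z" "\<forall>j>m. path_digit z j = 0" by (rule ambiguous_eventually_0)
  have "t = (\<Sum>j\<in>{..m}. real (path_digit z j) / real N ^ Suc j)"
    unfolding z(2) Psi_eq_base_sum[OF z(1)] base_sum_def
    by (rule suminf_finite) (use z(3) in auto)
  also have "\<dots> \<in> \<rat>" by (intro Rats_sum Rats_divide Rats_power) auto
  finally show "t \<in> \<rat>" .
qed

lemma countable_ambiguous: "countable ambiguous"
  by (rule countable_subset[OF ambiguous_Rats countable_rat])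

lemma ambiguous_borel: "ambiguous \<in> sets borel"
  using countable_ambiguous by (rule sets.countable[rotated]) simp

text \<open>Split by R because H^0 is counting measure: for R = 1 the set has to be empty, for R > 1
  countability suffices.\<close>

lemma hausdorff_ambiguous: "hausdorff_outer hdim ambiguous = 0"
proof (cases "R = 1")
  case True
  have "ambiguous = {}"
  proof (rule equals0I)
    fix t assume "t \<in> ambiguous"
    then obtain z m where z: "z \<in> paths" "\<forall>j>m. path_digit z j = 0" "N \<ge> 2"
      by (rule ambiguous_eventually_0)
    obtain j where "j > m" "path_digit z j \<noteq> 0"
      using not_eventually_zero_digits[OF True z(3,1), of m] by blast
    then show False using z(2)[rule_format, of j] by simp
  qed
  then show ?thesis by simp
next
  case False
  then have "hdim > 0" using R_ge_1 hdim_pos_iff by simp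
  then show ?thesis by (rule hausdorff_outer_countable[OF countable_ambiguous])
qed

section \<open>Comparison of the two measures\<close>

abbreviation "H \<equiv> hausdorff_measure hdim"

lemma borel_sets_H: "A \<in> sets borel \<Longrightarrow> A \<in> sets H"
  using borel_subset_hausdorff_measurable[OF hdim_nonneg] by blast

lemma emeasure_H: "A \<in> sets borel \<Longrightarrow> emeasure H A = hausdorff_outer hdim A"
  by (intro emeasure_hausdorff_measure borel_sets_H)

lemma ambiguous_null: "ambiguous \<in> null_sets H"
  using hausdorff_ambiguous borel_sets_H[OF ambiguous_borel] by (auto simp: null_sets_def emeasure_H ambiguous_borel)

lemma emeasure_Psi_ambiguous: "emeasure M {x \<in> space M. P x \<in> ambiguous} = 0"
  using mass_le_hausdorff[OF ambiguous_borel] hausdorff_ambiguous by simp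

lemma Psi_cylinder_borel [measurable]: "\<eta> \<in> Mor \<Lambda> \<Longrightarrow> P ` Z \<eta> \<in> sets borel"
  using compact_Psi_cylinder by (intro borel_compact)

text \<open>Away from \<open>ambiguous\<close> the value determines the digits, and these determine
  the initial segment.\<close>

lemma Psi_cylinder_inter_subset:
  assumes "\<eta> \<in> level n" "x \<in> paths" "P x \<in> P ` Z \<eta>" "P x \<notin> ambiguous"
  shows "x \<in> Z \<eta>"
proof -
  obtain y where y: "y \<in> Z \<eta>" "P y = P x" using assms(3) by auto
  have d: "path_digit x = path_digit y"
  proof (rule ccontr)
    assume "path_digit x \<noteq> path_digit y"
    then have "P x \<in> ambiguous"
      unfolding ambiguous_def using assms(2) cylinderD(1)[OF y(1)] y(2)[symmetric]
      by (intro CollectI exI[of _ x] exI[of _ y] conjI refl)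
    with assms(4) show False by contradiction
  qed
  have "x (deg_zero, diag_deg k n) = \<eta>"
    by (rule level_determined_by_digits[OF initial_level(1)[OF assms(2), of n] assms(1) initial_level(2)[OF assms(2), of n] y(1)])
      (simp add: d)
  then show ?thesis using initial_level(2)[OF assms(2), of n] by simp
qed

text \<open>Images of distinct cylinders of one level overlap only inside the null set
  \<open>ambiguous\<close>; after removing it they are disjoint.\<close>

lemma emeasure_H_UN:
  assumes S: "S \<subseteq> level n"
  shows "emeasure H (\<Union>\<eta>\<in>S. P ` Z \<eta>) = (\<Sum>\<eta>\<in>S. emeasure H (P ` Z \<eta>))"
proof -
  have fin: "finite S" by (rule finite_subset[OF S finite_level])
  have sets: "P ` Z \<eta> \<in> sets H" if "\<eta> \<in> S" for \<eta>
    using S that level_Mor by (intro borel_sets_H Psi_cylinder_borel) auto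
  have "emeasure H (\<Union>\<eta>\<in>S. P ` Z \<eta>) = emeasure H ((\<Union>\<eta>\<in>S. P ` Z \<eta>) - ambiguous)"
    by (rule emeasure_Diff_null_set[OF ambiguous_null, symmetric]) (use fin sets in auto)
  also have "(\<Union>\<eta>\<in>S. P ` Z \<eta>) - ambiguous = (\<Union>\<eta>\<in>S. P ` Z \<eta> - ambiguous)" by auto
  also have "emeasure H \<dots> = (\<Sum>\<eta>\<in>S. emeasure H (P ` Z \<eta> - ambiguous))"
  proof (rule sum_emeasure[symmetric])
    show "(\<lambda>\<eta>. P ` Z \<eta> - ambiguous) ` S \<subseteq> sets H"
      using sets ambiguous_null by auto
    show "disjoint_family_on (\<lambda>\<eta>. P ` Z \<eta> - ambiguous) S"
      unfolding disjoint_family_on_def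
    proof (intro ballI impI equals0I)
      fix \<eta> \<eta>' t assume \<eta>: "\<eta> \<in> S" "\<eta>' \<in> S" "\<eta> \<noteq> \<eta>'"
        and t: "t \<in> (P ` Z \<eta> - ambiguous) \<inter> (P ` Z \<eta>' - ambiguous)"
      then obtain x where x: "x \<in> Z \<eta>" "t = P x" by auto
      then have "x \<in> Z \<eta>'"
        using t \<eta> S cylinderD(1)[OF x(1)] Psi_cylinder_inter_subset[of \<eta>' n x] by auto
      with x \<eta> S cylinder_disjoint[of \<eta> "diag_deg k n" \<eta>'] show False by auto
    qed
  qed fact
  also have "\<dots> = (\<Sum>\<eta>\<in>S. emeasure H (P ` Z \<eta>))"
    by (intro sum.cong refl emeasure_Diff_null_set[OF ambiguous_null] sets)
  finally show ?thesis .
qed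

text \<open>The preimage of an image of cylinders can exceed the cylinders, but only over
  \<open>ambiguous\<close>. That part is M-null because \<open>mass_le_hausdorff\<close> bounds M by
  H.\<close>

lemma emeasure_M_UN:
  assumes S: "S \<subseteq> level n"
  shows "emeasure M {x \<in> space M. P x \<in> (\<Union>\<eta>\<in>S. P ` Z \<eta>)} = (\<Sum>\<eta>\<in>S. emeasure M (Z \<eta>))"
proof -
  have fin: "finite S" by (rule finite_subset[OF S finite_level])
  have sets: "Z \<eta> \<in> sets M" if "\<eta> \<in> S" for \<eta>
    using S that level_Mor by (intro cylinder_sets) auto
  have U: "(\<Union>\<eta>\<in>S. Z \<eta>) \<in> sets M" using fin sets by auto
  have UP: "(\<Union>\<eta>\<in>S. P ` Z \<eta>) \<in> sets borel"
    using fin S level_Mor by (intro sets.finite_UN Psi_cylinder_borel) auto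
  have A: "{x \<in> space M. P x \<in> ambiguous} \<in> sets M" by (rule Psi_vimage_sets[OF ambiguous_borel])
  have eq: "(\<Sum>\<eta>\<in>S. emeasure M (Z \<eta>)) = emeasure M (\<Union>\<eta>\<in>S. Z \<eta>)"
  proof (rule sum_emeasure)
    show "disjoint_family_on Z S"
      unfolding disjoint_family_on_def using cylinder_disjoint S by (meson subsetD)
  qed (use fin sets in auto)
  show ?thesis
  proof (rule antisym)
    have "emeasure M {x \<in> space M. P x \<in> (\<Union>\<eta>\<in>S. P ` Z \<eta>)}
        \<le> emeasure M ((\<Union>\<eta>\<in>S. Z \<eta>) \<union> {x \<in> space M. P x \<in> ambiguous})"
    proof (rule emeasure_mono)
      show "{x \<in> space M. P x \<in> (\<Union>\<eta>\<in>S. P ` Z \<eta>)} \<subseteq> (\<Union>\<eta>\<in>S. Z \<eta>) \<union> {x \<in> space M. P x \<in> ambiguous}"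
      proof
        fix x assume "x \<in> {x \<in> space M. P x \<in> (\<Union>\<eta>\<in>S. P ` Z \<eta>)}"
        then obtain \<eta> where x: "x \<in> paths" "\<eta> \<in> S" "P x \<in> P ` Z \<eta>" by (auto simp: space_M)
        then show "x \<in> (\<Union>\<eta>\<in>S. Z \<eta>) \<union> {x \<in> space M. P x \<in> ambiguous}"
          using Psi_cylinder_inter_subset[of \<eta> n x] S by (auto simp: space_M)
      qed
    qed (use U A in auto)
    also have "\<dots> \<le> emeasure M (\<Union>\<eta>\<in>S. Z \<eta>) + emeasure M {x \<in> space M. P x \<in> ambiguous}"
      by (rule emeasure_subadditive[OF U A])
    finally show "emeasure M {x \<in> space M. P x \<in> (\<Union>\<eta>\<in>S. P ` Z \<eta>)} \<le> (\<Sum>\<eta>\<in>S. emeasure M (Z \<eta>))"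
      by (simp add: eq emeasure_Psi_ambiguous)
    show "(\<Sum>\<eta>\<in>S. emeasure M (Z \<eta>)) \<le> emeasure M {x \<in> space M. P x \<in> (\<Union>\<eta>\<in>S. P ` Z \<eta>)}"
      unfolding eq
    proof (rule emeasure_mono)
      show "(\<Union>\<eta>\<in>S. Z \<eta>) \<subseteq> {x \<in> space M. P x \<in> (\<Union>\<eta>\<in>S. P ` Z \<eta>)}"
        by (auto simp: space_M cylinderD)
    qed (rule Psi_vimage_sets[OF UP])
  qed
qed

lemma emeasure_H_cylinder:
  assumes \<eta>: "\<eta> \<in> level n"
  shows "emeasure H (P ` Z \<eta>) = ennreal (1 / R ^ n) * emeasure H (P ` Z (src \<Lambda> \<eta>))"
proof -
  obtain x0 where x0: "x0 \<in> Z \<eta>" using cylinder_nonempty[OF level_Mor[OF \<eta>]] by auto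
  have Mor: "\<eta> \<in> Mor \<Lambda>" "src \<Lambda> \<eta> \<in> Mor \<Lambda>" using level_Mor[OF \<eta>] by auto
  have "hausdorff_outer hdim (P ` Z \<eta>) = ennreal ((1 / real N ^ (k * n)) powr hdim) * hausdorff_outer hdim (P ` Z (src \<Lambda> \<eta>))"
    unfolding Psi_cylinder_self_similar[OF \<eta> x0]
  proof (rule hausdorff_outer_affine)
    have "real N > 0" using N_ge_1 by linarith
    then show "1 / real N ^ (k * n) > 0" by (simp del: of_nat_0_less_iff)
  qed (rule hdim_nonneg)
  then show ?thesis using Mor by (simp add: emeasure_H Psi_cylinder_borel scale_powr_hdim)
qed

section \<open>The Hausdorff measures of vertex images as an eigenvector\<close>

definition vertex_mass :: "'a \<Rightarrow> real" where
  "vertex_mass v = enn2real (emeasure H (P ` Z v))"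

definition total_mass :: real where
  "total_mass = (\<Sum>v\<in>vertices \<Lambda>. vertex_mass v)"

lemma emeasure_H_vertex:
  "v \<in> vertices \<Lambda> \<Longrightarrow> emeasure H (P ` Z v) = ennreal (vertex_mass v)"
  using hausdorff_cylinder_finite[of v] vertexD(1)
  by (simp add: vertex_mass_def emeasure_H Psi_cylinder_borel)

lemma vertex_mass_nonneg: "vertex_mass v \<ge> 0"
  by (simp add: vertex_mass_def)

text \<open>A Hausdorff-null image would have M-null preimage by the mass distribution estimate, but
  the preimage contains \<open>Z v\<close>, of mass \<open>pf_weight v\<close>.\<close>

lemma vertex_mass_pos:
  assumes v: "v \<in> vertices \<Lambda>"
  shows "vertex_mass v > 0"
proof -
  have b: "P ` Z v \<in> sets borel" using vertexD(1)[OF v] by (rule Psi_cylinder_borel)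
  have "ennreal (pf_weight v) = emeasure M (Z v)"
    by (simp add: emeasure_eq_measure measure_cylinder_vertex[OF v])
  also have "\<dots> \<le> emeasure M {x \<in> space M. P x \<in> P ` Z v}"
    by (rule emeasure_mono[OF _ Psi_vimage_sets[OF b]]) (auto simp: space_M cylinderD)
  also have "\<dots> \<le> ennreal mass_const * ennreal (vertex_mass v)"
    using mass_le_hausdorff[OF b] emeasure_H_vertex[OF v] by (simp add: emeasure_H[OF b])
  finally have "vertex_mass v \<noteq> 0" using pf_weight_pos[OF v] by auto
  then show ?thesis using vertex_mass_nonneg[of v] by simp
qed

lemma total_mass_pos: "total_mass > 0"
  unfolding total_mass_def by (intro sum_pos vertex_mass_pos) auto

text \<open>The image of \<open>Z v\<close> splits, up to a null set, into copies of vertex images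
  scaled by N^(-k), each contributing a factor 1/R.\<close>

lemma transfer_vertex_mass:
  assumes v: "v \<in> vertices \<Lambda>"
  shows "transfer (diag_deg k 1) vertex_mass v = R * vertex_mass v"
proof -
  let ?S = "paths_from (diag_deg k 1) v"
  have S: "?S \<subseteq> level 1" by (auto simp: paths_from_def)
  have "ennreal (vertex_mass v) = (\<Sum>\<eta>\<in>?S. emeasure H (P ` Z \<eta>))"
    using emeasure_H_UN[OF S] Psi_cylinder_vertex[OF v, of "diag_deg k 1"] by (simp add: emeasure_H_vertex[OF v, symmetric])
  also have "\<dots> = (\<Sum>\<eta>\<in>?S. ennreal (1 / R * vertex_mass (src \<Lambda> \<eta>)))"
  proof (rule sum.cong[OF refl])
    fix \<eta> assume "\<eta> \<in> ?S"
    then have "\<eta> \<in> level 1" "\<eta> \<in> Mor \<Lambda>" using S by (auto simp: paths_from_iff)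
    then show "emeasure H (P ` Z \<eta>) = ennreal (1 / R * vertex_mass (src \<Lambda> \<eta>))"
      using emeasure_H_cylinder[of \<eta> 1] R_pos
      by (simp add: emeasure_H_vertex ennreal_mult[symmetric] vertex_mass_nonneg)
  qed
  also have "\<dots> = ennreal (\<Sum>\<eta>\<in>?S. 1 / R * vertex_mass (src \<Lambda> \<eta>))"
    by (rule sum_ennreal) (use R_pos vertex_mass_nonneg in auto)
  also have "(\<Sum>\<eta>\<in>?S. 1 / R * vertex_mass (src \<Lambda> \<eta>)) = 1 / R * transfer (diag_deg k 1) vertex_mass v"
    by (simp add: transfer_def sum_distrib_left)
  finally have "vertex_mass v = 1 / R * transfer (diag_deg k 1) vertex_mass v"
    using R_pos by (subst (asm) ennreal_inj) (auto simp: transfer_def intro!: vertex_mass_nonneg sum_nonneg divide_nonneg_nonneg)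
  then show ?thesis using R_pos by (simp add: field_simps)
qed

text \<open>Divided by the total, the vertex masses form a positive unimodular eigenvector of A.
  Here the uniqueness hypothesis enters and identifies it with \<open>pf_vector\<close>.\<close>

lemma vertex_mass_eq:
  assumes v: "v \<in> vertices \<Lambda>"
  shows "vertex_mass v = total_mass * pf_weight v"
proof -
  let ?A = "product_matrix k \<Lambda> l"
  define y where "y = vec N (\<lambda>a. vertex_mass (vertex_of \<Lambda> l a) / total_mass)"
  have A: "?A \<in> carrier_mat N N" by (rule product_matrix_carrier)
  have "positive_unimodular_eigenvector ?A R y"
    unfolding positive_unimodular_eigenvector_def
  proof (intro conjI allI impI)
    show "y \<in> carrier_vec (dim_row ?A)" using A by (simp add: y_def)
    show "y $ a > 0" if "a < dim_row ?A" for a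
      using that A total_mass_pos vertex_mass_pos[OF vertex_of_vertex, of a] by (simp add: y_def)
    have "(\<Sum>a<dim_row ?A. \<bar>y $ a\<bar>) = (\<Sum>a<N. vertex_mass (vertex_of \<Lambda> l a) / total_mass)"
      using A total_mass_pos vertex_mass_nonneg by (intro sum.cong) (auto simp: y_def)
    also have "\<dots> = (\<Sum>v\<in>vertices \<Lambda>. vertex_mass v / total_mass)"
      by (rule sum.reindex_bij_betw[OF bij_vertex_of])
    also have "\<dots> = 1"
      using total_mass_pos by (simp add: sum_divide_distrib[symmetric] total_mass_def[symmetric])
    finally show "(\<Sum>a<dim_row ?A. \<bar>y $ a\<bar>) = 1" .
    show "map_mat real ?A *\<^sub>v y = R \<cdot>\<^sub>v y"
    proof (rule eq_vecI)
      fix a assume "a < dim_vec (R \<cdot>\<^sub>v y)"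
      then have a: "a < N" by (simp add: y_def)
      have "(map_mat real ?A *\<^sub>v y) $ a = (\<Sum>b<N. real (?A $$ (a, b)) * (vertex_mass (vertex_of \<Lambda> l b) / total_mass))"
        using a A by (auto simp: scalar_prod_def lessThan_atLeast0 y_def intro!: sum.cong)
      also have "\<dots> = (\<Sum>b<N. real (?A $$ (a, b)) * vertex_mass (vertex_of \<Lambda> l b)) / total_mass"
        by (simp add: sum_divide_distrib)
      also have "\<dots> = R * vertex_mass (vertex_of \<Lambda> l a) / total_mass"
        using a by (simp only: sum_product_matrix transfer_vertex_mass vertex_of_vertex)
      finally show "(map_mat real ?A *\<^sub>v y) $ a = (R \<cdot>\<^sub>v y) $ a" using a by (simp add: y_def)
    qed (use A in \<open>simp add: y_def\<close>)
  qed
  then have y: "y = pf_vector k \<Lambda> l"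
    using pf_unique by (simp add: rho_product_matrix)
  have "vertex_mass v / total_mass = y $ l v"
    using v by (simp add: y_def label_less vertex_of_label)
  then show ?thesis
    using y total_mass_pos by (simp add: pf_weight_def field_simps)
qed

lemma emeasure_H_eq_M_cylinder:
  assumes \<eta>: "\<eta> \<in> level n"
  shows "emeasure H (P ` Z \<eta>) = ennreal total_mass * emeasure M (Z \<eta>)"
proof -
  have src: "src \<Lambda> \<eta> \<in> vertices \<Lambda>" using level_Mor[OF \<eta>] by simp
  have "emeasure H (P ` Z \<eta>) = ennreal (1 / R ^ n * vertex_mass (src \<Lambda> \<eta>))"
    using emeasure_H_cylinder[OF \<eta>] R_pos
    by (simp add: emeasure_H_vertex[OF src] ennreal_mult[symmetric] vertex_mass_nonneg)
  also have "1 / R ^ n * vertex_mass (src \<Lambda> \<eta>) = total_mass * measure M (Z \<eta>)"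
    using vertex_mass_eq[OF src] by (simp add: measure_cylinder_degree[OF \<eta>] scal_diag field_simps)
  finally show ?thesis using total_mass_pos by (simp add: emeasure_eq_measure ennreal_mult[symmetric])
qed

section \<open>From images of cylinders to Borel sets\<close>

definition psi_image :: "real set" where
  "psi_image = P ` paths"

lemma psi_image_eq_UN: "psi_image = (\<Union>\<eta>\<in>level n. P ` Z \<eta>)"
  by (simp add: psi_image_def infinite_paths_eq_UN[of "diag_deg k n", simplified] image_UN)

lemma compact_psi_image: "compact psi_image"
  unfolding psi_image_eq_UN[of 0] using finite_level by (intro compact_UN compact_Psi_cylinder level_Mor)

lemma psi_image_borel: "psi_image \<in> sets borel"
  by (rule borel_compact[OF compact_psi_image])

lemma emeasure_H_psi_image: "emeasure H psi_image = ennreal total_mass"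
proof -
  have "emeasure H psi_image = (\<Sum>\<eta>\<in>level 0. ennreal total_mass * emeasure M (Z \<eta>))"
    unfolding psi_image_eq_UN[of 0] by (subst emeasure_H_UN) (auto simp: emeasure_H_eq_M_cylinder)
  also have "\<dots> = ennreal total_mass * emeasure M {x \<in> space M. P x \<in> psi_image}"
    unfolding psi_image_eq_UN[of 0] by (subst emeasure_M_UN) (auto simp: sum_distrib_left)
  also have "{x \<in> space M. P x \<in> psi_image} = space M" by (auto simp: psi_image_def space_M)
  finally show ?thesis by (simp add: emeasure_space_1)
qed

text \<open>The level-n images contained in U increase with n and exhaust the part of U in X, as
  their diameters tend to 0. Both measures are continuous from below.\<close>

lemma emeasure_H_open:
  assumes U: "open U"
  shows "emeasure H (U \<inter> psi_image) = ennreal total_mass * emeasure M {x \<in> space M. P x \<in> U}"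
proof -
  define S where "S n = {\<eta> \<in> level n. P ` Z \<eta> \<subseteq> U}" for n
  define G where "G n = (\<Union>\<eta>\<in>S n. P ` Z \<eta>)" for n
  have S: "S n \<subseteq> level n" for n by (auto simp: S_def)
  have Gb: "G n \<in> sets borel" for n
    unfolding G_def
    by (intro sets.finite_UN Psi_cylinder_borel finite_subset[OF S finite_level] level_Mor[OF subsetD[OF S]])
  have GH: "emeasure H (G n) = ennreal total_mass * emeasure M {x \<in> space M. P x \<in> G n}" for n
    unfolding G_def emeasure_M_UN[OF S] emeasure_H_UN[OF S] sum_distrib_left
    using S by (intro sum.cong refl emeasure_H_eq_M_cylinder) auto
  have mem: "P x \<in> G n" if "x \<in> paths" "P ` Z (x (deg_zero, diag_deg k n)) \<subseteq> U" for x n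
    using that initial_level[OF that(1), of n] unfolding G_def S_def by blast
  have "incseq G"
  proof (rule incseq_SucI, rule subsetI)
    fix n t assume "t \<in> G n"
    then obtain \<eta> x where \<eta>: "\<eta> \<in> level n" "P ` Z \<eta> \<subseteq> U" and x: "x \<in> Z \<eta>" "t = P x"
      by (auto simp: G_def S_def)
    have xp: "x \<in> paths" by (rule cylinderD(1)[OF x(1)])
    let ?\<eta> = "x (deg_zero, diag_deg k (Suc n))"
    \<comment> \<open>The longer initial segment of x determines the shorter one, so the deeper
      cylinder lies in the coarser and its image stays inside U.\<close>
    have "Z ?\<eta> \<subseteq> Z \<eta>"
    proof
      fix y assume y: "y \<in> Z ?\<eta>"
      have "y (deg_zero, diag_deg k n) = x (deg_zero, diag_deg k n)"
      proof (rule path_segment_determined[OF cylinderD(1)[OF y] xp])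
        show "diag_deg k n \<le> diag_deg k (Suc n)" by (simp add: diag_deg_def le_fun_def)
        show "y (deg_zero, diag_deg k (Suc n)) = x (deg_zero, diag_deg k (Suc n))"
          using cylinderD(2)[OF y] level_deg[OF initial_level(1)[OF xp]] by simp
      qed auto
      also have "\<dots> = \<eta>" using cylinderD(2)[OF x(1)] level_deg[OF \<eta>(1)] by simp
      finally show "y \<in> Z \<eta>" using cylinderD(1)[OF y] level_deg[OF \<eta>(1)] by (simp add: cylinder_def)
    qed
    then show "t \<in> G (Suc n)" unfolding x(2) using \<eta>(2) by (intro mem[OF xp]) blast
  qed
  have UG: "(\<Union>n. G n) = U \<inter> psi_image"
  proof (intro equalityI subsetI)
    fix t assume "t \<in> (\<Union>n. G n)"
    then obtain n \<eta> x where "\<eta> \<in> level n" "P ` Z \<eta> \<subseteq> U" "x \<in> Z \<eta>" "t = P x"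
      by (auto simp: G_def S_def)
    then show "t \<in> U \<inter> psi_image" using cylinderD(1) by (auto simp: psi_image_def)
  next
    fix t assume "t \<in> U \<inter> psi_image"
    then obtain x where x: "x \<in> paths" "t = P x" "P x \<in> U" by (auto simp: psi_image_def)
    obtain e where e: "e > 0" "\<And>y. dist y (P x) < e \<Longrightarrow> y \<in> U"
      using U x(3) unfolding open_dist by blast
    obtain n where n: "resolution n < e" using resolution_small[OF e(1)] by blast
    have "P ` Z (x (deg_zero, diag_deg k n)) \<subseteq> U"
      using Psi_cylinder_close[OF initial_level(1)[OF x(1)] _ initial_level(2)[OF x(1)], of _ n] n
      by (intro image_subsetI e(2)) (meson order_le_less_trans)
    then show "t \<in> (\<Union>n. G n)" unfolding x(2) using mem[OF x(1)] by blast
  qed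
  have "emeasure H (U \<inter> psi_image) = (SUP n. emeasure H (G n))"
    unfolding UG[symmetric] using \<open>incseq G\<close> borel_sets_H[OF Gb]
    by (intro SUP_emeasure_incseq[symmetric]) auto
  also have "\<dots> = ennreal total_mass * (SUP n. emeasure M {x \<in> space M. P x \<in> G n})"
    unfolding GH by (rule SUP_mult_left_ennreal[symmetric])
  also have "(SUP n. emeasure M {x \<in> space M. P x \<in> G n}) = emeasure M (\<Union>n. {x \<in> space M. P x \<in> G n})"
  proof (rule SUP_emeasure_incseq)
    show "incseq (\<lambda>n. {x \<in> space M. P x \<in> G n})"
      using \<open>incseq G\<close> by (auto simp: incseq_def)
  qed (use Gb in \<open>auto intro!: Psi_vimage_sets\<close>)
  also have "(\<Union>n. {x \<in> space M. P x \<in> G n}) = {x \<in> space M. P x \<in> (\<Union>n. G n)}" by auto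
  also have "\<dots> = {x \<in> space M. P x \<in> U}" unfolding UG by (auto simp: psi_image_def space_M)
  finally show ?thesis .
qed

text \<open>Finite measures that agree on open sets, an intersection-stable generator, agree on all
  Borel sets.\<close>

lemma emeasure_H_borel:
  assumes "E \<in> sets borel"
  shows "emeasure H (E \<inter> psi_image) = ennreal total_mass * emeasure M {x \<in> space M. P x \<in> E}"
proof -
  have imH: "psi_image \<in> sets H" by (rule borel_sets_H[OF psi_image_borel])
  \<comment> \<open>H lives on the Caratheodory-measurable sets; pushing its restriction forward
    along the identity turns it into a measure on the Borel sets, as the uniqueness theorem
    requires.\<close>
  let ?\<nu> = "distr (restrict_space H psi_image) borel (\<lambda>y. y)"
  let ?\<kappa> = "scale_measure (ennreal total_mass) (distr M borel P)"
  have meas: "(\<lambda>y. y) \<in> restrict_space H psi_image \<rightarrow>\<^sub>M borel"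
  proof (rule measurableI)
    fix A :: "real set" assume "A \<in> sets borel"
    then have "A \<inter> psi_image \<in> sets H" using borel_sets_H imH by auto
    then show "(\<lambda>y. y) -` A \<inter> space (restrict_space H psi_image) \<in> sets (restrict_space H psi_image)"
      using imH by (auto simp: sets_restrict_space_iff space_restrict_space)
  qed simp
  have \<nu>: "emeasure ?\<nu> A = emeasure H (A \<inter> psi_image)" if "A \<in> sets borel" for A
    using that imH meas by (subst emeasure_distr) (auto simp: space_restrict_space emeasure_restrict_space)
  have \<kappa>: "emeasure ?\<kappa> A = ennreal total_mass * emeasure M {x \<in> space M. P x \<in> A}" if "A \<in> sets borel" for A
    using that by (simp add: emeasure_distr vimage_def Int_def conj_commute)
  have "?\<nu> = ?\<kappa>"
  proof (rule measure_eqI_generator_eq[where A = "\<lambda>_. UNIV"])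
    show "Int_stable {S :: real set. open S}" by (auto simp: Int_stable_def)
    show "emeasure ?\<nu> U = emeasure ?\<kappa> U" if "U \<in> {S. open S}" for U
    proof -
      have "open U" using that by simp
      then show ?thesis unfolding \<nu>[OF borel_open[OF \<open>open U\<close>]] \<kappa>[OF borel_open[OF \<open>open U\<close>]]
        by (rule emeasure_H_open)
    qed
    show "sets ?\<nu> = sigma_sets UNIV {S. open S}" "sets ?\<kappa> = sigma_sets UNIV {S. open S}"
      by (simp_all add: borel_def)
    show "emeasure ?\<nu> UNIV \<noteq> \<infinity>" by (simp add: \<nu> emeasure_H_psi_image)
  qed auto
  then show ?thesis using \<nu>[OF assms] \<kappa>[OF assms] by simp
qed

lemma has_hausdorff_dimension_psi_image: "has_hausdorff_dimension psi_image hdim"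
  unfolding has_hausdorff_dimension_def
  using hdim_nonneg borel_sets_H[OF psi_image_borel] total_mass_pos by (simp add: emeasure_H_psi_image)

lemma hausdorff_dimension_psi_image: "hausdorff_dimension psi_image = hdim"
  by (rule hausdorff_dimension_eq[OF has_hausdorff_dimension_psi_image])

lemma emeasure_distr_Psi:
  assumes "E \<in> sets (restrict_space borel psi_image)"
  shows "E \<in> sets H"
    and "emeasure (distr M (restrict_space borel psi_image) P) E = 1 / emeasure H psi_image * emeasure H E"
proof -
  have E: "E \<in> sets borel" "E \<subseteq> psi_image"
    using assms psi_image_borel by (auto simp: sets_restrict_space_iff)
  show "E \<in> sets H" by (rule borel_sets_H[OF E(1)])
  have "P \<in> M \<rightarrow>\<^sub>M restrict_space borel psi_image"
    by (rule measurable_restrict_space2) (auto simp: psi_image_def space_M)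
  then have "emeasure (distr M (restrict_space borel psi_image) P) E = emeasure M {x \<in> space M. P x \<in> E}"
    using assms by (simp add: emeasure_distr vimage_def Int_def conj_commute)
  moreover have "emeasure H E = ennreal total_mass * emeasure M {x \<in> space M. P x \<in> E}"
    using emeasure_H_borel[OF E(1)] E(2) by (simp add: Int_absorb2)
  moreover have "1 / ennreal total_mass * (ennreal total_mass * y) = y" for y
    using total_mass_pos
    by (simp add: mult.assoc[symmetric] divide_ennreal[of 1, simplified] ennreal_mult[symmetric])
  ultimately show "emeasure (distr M (restrict_space borel psi_image) P) E = 1 / emeasure H psi_image * emeasure H E"
    by (simp add: emeasure_H_psi_image)
qed

end

theorem theorem3p8:
  fixes k :: nat and \<Lambda> :: "'a graded_cat" and l :: "'a \<Rightarrow> nat"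
    and M :: "((nat \<Rightarrow> nat) \<times> (nat \<Rightarrow> nat) \<Rightarrow> 'a) measure"
  assumes "k \<ge> 1"
    and "k_graph k \<Lambda>"
    and "finite_kgraph k \<Lambda>"
    and "strongly_connected \<Lambda>"
    and "vertex_labelling \<Lambda> l"
    and "\<forall>i\<in>{1..k}. zero_one_matrix (vertex_matrix \<Lambda> l i)"
    and "zero_one_matrix (product_matrix k \<Lambda> l)"
    and pf_unique: "\<forall>y. positive_unimodular_eigenvector (product_matrix k \<Lambda> l)
                 (rho (product_matrix k \<Lambda> l)) y \<longrightarrow> y = pf_vector k \<Lambda> l"
    and "perron_frobenius_measure k \<Lambda> l M"
  shows "let N = card (vertices \<Lambda>);
             A = product_matrix k \<Lambda> l;
             X = Psi k \<Lambda> l ` infinite_paths k \<Lambda>;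
             \<mu> = distr M (restrict_space borel X) (Psi k \<Lambda> l);
             s = hausdorff_dimension X;
             H = hausdorff_measure s
         in has_hausdorff_dimension X s \<and>
            (\<forall>E\<in>sets (restrict_space borel X).
               E \<in> sets H \<and> emeasure \<mu> E = 1 / emeasure H X * emeasure H E) \<and>
            real N powr (real k * s) = rho A \<and>
            s = 1 / real k * (ln (rho A) / ln (real N))"
proof -
  interpret kgraph k \<Lambda> by unfold_locales fact
  \<comment> \<open>A probability space is not empty, so there is an infinite path and hence a
    vertex, as the locale demands.\<close>
  have "space M \<noteq> {}" "space M = infinite_paths k \<Lambda>"
    using assms(9) by (auto simp: perron_frobenius_measure_def prob_space.not_empty)
  then obtain x where "x \<in> infinite_paths k \<Lambda>" by auto
  then have "vertices \<Lambda> \<noteq> {}" using path_vertex[of x deg_zero] by auto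
  then interpret pf_k_graph k \<Lambda> l M
    using assms by unfold_locales
  show ?thesis
    unfolding Let_def psi_image_def[symmetric] hausdorff_dimension_psi_image rho_product_matrix
    using has_hausdorff_dimension_psi_image emeasure_distr_Psi powr_hdim by (auto simp: hdim_def)
qed

end
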